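(* Let $0<\beta<1$ and $k_n=\lfloor\exp(2^{\beta n})\rfloor$ for $n\ge0$, and assume $\beta$ is such that these satisfy $k_{n-1}\le k_n\le k_{n-1}^2$ for all $n\ge1$. Let $\mu$ be the stationary mean of the RHA process with these perplexities and $\alpha=1/\beta-1$. Then: (i) $h_\mu=0$; (ii) there exist constants $C_1,C_2>0$ such that for all sufficiently large $m$, $$\frac{C_1m}{(\log m)^\alpha}\le H_\mu(m)\le C_2m\Big(\frac{\log\log m}{\log m}\Big)^\alpha;$$ (iii) $\mu$ is a regular Hilberg process with exponent $\beta$; (iv) $\mu$ is not ergodic, and $\lim_{m\to\infty}\big(H_\mu(m)-\mathbb E_\mu H_F(m)\big)=\infty$, i.e. the entropy of the shift-invariant $\sigma$-algebra $H_\mu(\mathcal I)=\lim_{m\to\infty}I_\mu(\mathcal I;\xi_{1:m})$ is infinite.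
   Context: Random hierarchical association (RHA) process. Fix positive integers $(k_n)_{n\ge0}$ (perplexities) with $k_{n-1}\le k_n\le k_{n-1}^2$ for all $n\ge1$. On a probability space $(\Omega,\mathcal J,P)$ let, for each $n\ge1$, $(L_{nj},R_{nj})_{j=1}^{k_n}$ be the lexicographically sorted enumeration of a uniformly random $k_n$-element subset of $\{1,\dots,k_{n-1}\}^2$ (each of the $\binom{k_{n-1}^2}{k_n}$ subsets equally likely), independently over $n$. Let $(C_n)_{n\ge0}$ be independent, independent of all $(L_{nj},R_{nj})$, with $C_n$ uniform on $\{1,\dots,k_n\}$. Define strings $Y^0_j=j$ (length 1) for $1\le j\le k_0$ and $Y^n_j=Y^{n-1}_{L_{nj}}Y^{n-1}_{R_{nj}}$ (concatenation); so $Y^n_1,\dots,Y^n_{k_n}$ are distinct strings of length $2^n$. The RHA process is $\mathcal X=Y^0_{C_0}Y^1_{C_1}Y^2_{C_2}\cdots=X_1X_2X_3\cdots$, $X_{k:l}=X_k\cdots X_l$. The limits $\mu(x_{1:m})=\lim_{N\to\infty}\frac1N\sum_{i=1}^NP(X_{i:i+m-1}=x_{1:m})$ exist for all finite strings and define (via $\mu(\xi_{1:m}=x_{1:m})=\mu(x_{1:m})$) a stationary probability measure $\mu$ on $\{1,\dots,k_0\}^{\mathbb N}$, the stationary mean; $\xi_i$ are the coordinate maps. Logarithms are natural. $H_\mu(m)=\mathbb E_\mu[-\log\mu(\xi_{1:m})]$, $h_\mu=\lim_m H_\mu(m)/m$. $\mathcal I$ is the shift-invariant $\sigma$-algebra and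 $F=\mu(\cdot|\mathcal I)$ the random ergodic measure (regular conditional probability), $H_F(m)=\mathbb E_F[-\log F(\xi_{1:m})]$. For a finite string $w$, $L(w)$ is the length of the longest string occurring at least twice as a contiguous substring of $w$; $H_{top}(m|x)=\log\#\{\text{distinct contiguous substrings of length } m \text{ of } x\}$. A stationary $\mu$ is a regular Hilberg process with exponent $\beta$ if: there are constants $c>0$, $C<\infty$, $m_0$ (independent of the sequence) such that for $\mu$-a.e. $x$, $L(x_{1:m})\ge c(\log m)^{1/\beta}$ and $H_{top}(m|x_{1:\infty})\le Cm^\beta$ for all $m\ge m_0$; and for $\mu$-a.e. $x$ there exist $c'(x)>0$, $C'(x)<\infty$ with $L(x_{1:m})\le C'(x)(\log m)^{1/\beta}$ and $H_{top}(m|x_{1:\infty})\ge c'(x)m^\beta$ for all sufficiently large $m$. *)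

theory Defs
  imports "HOL-Probability.Probability"
begin

definition subsets_lvl :: "(nat \<Rightarrow> nat) \<Rightarrow> nat \<Rightarrow> (nat \<times> nat) set set" where
  "subsets_lvl k n = {S. S \<subseteq> {1..k (n-1)} \<times> {1..k (n-1)} \<and> card S = k n}"

text \<open>Given the dictionary (Y^(n-1)_1,...,Y^(n-1)_k) as a list and the chosen subset,
  the new dictionary Y^n_j = Y^(n-1)_(L_nj) Y^(n-1)_(R_nj), with (L_nj,R_nj) the
  lexicographically sorted enumeration of the subset (indices are 1-based).\<close>
definition new_dict :: "nat list list \<Rightarrow> (nat \<times> nat) set \<Rightarrow> nat list list" where
  "new_dict D S = map (\<lambda>(l, r). D ! (l - 1) @ D ! (r - 1))
     [(l, r). l \<leftarrow> [1..<length D + 1], r \<leftarrow> [1..<length D + 1], (l, r) \<in> S]"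

text \<open>Joint law of (dictionary at level n, prefix Y^0_(C_0) ... Y^n_(C_n)).\<close>
fun rha_state :: "(nat \<Rightarrow> nat) \<Rightarrow> nat \<Rightarrow> (nat list list \<times> nat list) pmf" where
  "rha_state k 0 =
     map_pmf (\<lambda>c. (map (\<lambda>j. [j]) [1..<k 0 + 1], [c])) (pmf_of_set {1..k 0})"
| "rha_state k (Suc n) =
     bind_pmf (rha_state k n) (\<lambda>(D, w).
       bind_pmf (pmf_of_set (subsets_lvl k (Suc n))) (\<lambda>S.
         map_pmf (\<lambda>c. (new_dict D S, w @ new_dict D S ! (c - 1)))
                 (pmf_of_set {1..k (Suc n)})))"

text \<open>P(X_(i:i+m-1) = x), i \<ge> 1 (1-based positions). Level i + length x suffices,
  since the prefix there has length 2^(i+length x+1) - 1.\<close>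
definition rha_prob :: "(nat \<Rightarrow> nat) \<Rightarrow> nat \<Rightarrow> nat list \<Rightarrow> real" where
  "rha_prob k i x = measure_pmf.prob (rha_state k (i + length x))
      {p. take (length x) (drop (i - 1) (snd p)) = x}"

text \<open>Coordinate i (0-based) of \<omega> is \<xi>_(i+1).\<close>
definition seq_space :: "(nat \<Rightarrow> nat) measure" where
  "seq_space = Pi\<^sub>M UNIV (\<lambda>_. count_space UNIV)"

definition cyl :: "nat list \<Rightarrow> (nat \<Rightarrow> nat) set" where
  "cyl x = {\<omega>. \<forall>i<length x. \<omega> i = x ! i}"

definition shift :: "(nat \<Rightarrow> nat) \<Rightarrow> (nat \<Rightarrow> nat)" where
  "shift \<omega> = (\<lambda>i. \<omega> (Suc i))"

definition prefix :: "nat \<Rightarrow> (nat \<Rightarrow> nat) \<Rightarrow> nat list" where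
  "prefix m \<omega> = map \<omega> [0..<m]"

definition stationary :: "(nat \<Rightarrow> nat) measure \<Rightarrow> bool" where
  "stationary M \<longleftrightarrow> shift \<in> M \<rightarrow>\<^sub>M M \<and> distr M M shift = M"

definition invariant_sets :: "(nat \<Rightarrow> nat) measure \<Rightarrow> (nat \<Rightarrow> nat) set set" where
  "invariant_sets M = {A \<in> sets M. shift -` A \<inter> space M = A}"

definition inv_alg :: "(nat \<Rightarrow> nat) measure \<Rightarrow> (nat \<Rightarrow> nat) measure" where
  "inv_alg M = sigma (space M) (invariant_sets M)"

definition ergodic :: "(nat \<Rightarrow> nat) measure \<Rightarrow> bool" where
  "ergodic M \<longleftrightarrow> (\<forall>A\<in>invariant_sets M. measure M A = 0 \<or> measure M A = 1)"

definition H_mu :: "(nat \<Rightarrow> nat) measure \<Rightarrow> nat \<Rightarrow> real" where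
  "H_mu M m = (\<integral>\<omega>. - ln (measure M (cyl (prefix m \<omega>))) \<partial>M)"

text \<open>F(x)(\<omega>) = \<mu>(\<xi>_(1:m) = x | \<I>)(\<omega>), and
  E_\<mu> H_F(m) = E_\<mu>[\<Sum>_x - F(x) log F(x)], the sum over strings of length m over the
  alphabet {1..k0} (F is a.s. supported on that alphabet).\<close>
definition cond_cyl :: "(nat \<Rightarrow> nat) measure \<Rightarrow> nat list \<Rightarrow> (nat \<Rightarrow> nat) \<Rightarrow> real" where
  "cond_cyl M x = real_cond_exp M (inv_alg M) (indicator (cyl x))"

definition EH_F :: "(nat \<Rightarrow> nat) measure \<Rightarrow> nat \<Rightarrow> nat \<Rightarrow> real" where
  "EH_F M k0 m = (\<integral>\<omega>. (\<Sum>x\<in>{x. length x = m \<and> set x \<subseteq> {1..k0}}.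
       - (cond_cyl M x \<omega> * ln (cond_cyl M x \<omega>))) \<partial>M)"

definition L_rep :: "nat list \<Rightarrow> nat" where
  "L_rep w = Max {l. \<exists>i j. i \<noteq> j \<and> i + l \<le> length w \<and> j + l \<le> length w \<and>
                          take l (drop i w) = take l (drop j w)}"

definition H_top :: "nat \<Rightarrow> (nat \<Rightarrow> nat) \<Rightarrow> real" where
  "H_top m x = ln (real (card {map (\<lambda>j. x (i + j)) [0..<m] | i. True}))"

definition regular_hilberg :: "(nat \<Rightarrow> nat) measure \<Rightarrow> real \<Rightarrow> bool" where
  "regular_hilberg M \<beta> \<longleftrightarrow> stationary M \<and>
     (\<exists>c>0. \<exists>C. \<exists>m0. AE x in M. \<forall>m\<ge>m0.
        real (L_rep (prefix m x)) \<ge> c * ln (real m) powr (1 / \<beta>) \<and>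
        H_top m x \<le> C * real m powr \<beta>) \<and>
     (AE x in M. \<exists>c'>0. \<exists>C'. \<forall>\<^sub>F m in sequentially.
        real (L_rep (prefix m x)) \<le> C' * ln (real m) powr (1 / \<beta>) \<and>
        H_top m x \<ge> c' * real m powr \<beta>)"

end

theory Submission
  imports Defs "HOL-Combinatorics.Permutations" "HOL-Real_Asymp.Real_Asymp"
begin

text \<open>A uniformly random element of the level-\<open>n\<close> dictionary is, for every \<open>q \<le> n\<close>, a concatenation of
  level-\<open>q\<close> words whose labels are an exchangeable list independent of the level-\<open>q\<close> dictionary, and the
  label pairs of distinct level-\<open>(q + 1)\<close> words are given by a uniformly random injection. So two
  labels collide with probability of order \<open>1 / k q\<close>, and a fixed repetition of length \<open>4 * 2 ^ q\<close> has
  probability of the same order, because a block repeating earlier text is a function of at most two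
  other blocks. With \<open>ln (k q)\<close> of order \<open>ln m\<close>, Borel--Cantelli bounds the maximal repetition from
  above, which forces many distinct subwords. On repetition-free strings the injections bound the
  likelihood of \<open>J\<close> blocks by roughly \<open>(k q) powr (- 2 * J)\<close>, which gives the lower entropy bound. The
  opposite bounds (repetitions from below, subwords and entropy from above) only count concatenations
  of \<open>k q\<close> words. Finally, by recurrence an ergodic component charges only subwords of the sequence
  itself, so its block entropy is at most of order \<open>m powr \<beta>\<close>, far below that of the mean.\<close>

text \<open>The exponent comes from one identity: \<open>ln (k q)\<close> is comparable to
  \<open>lk q = 2 powr (\<beta> * q)\<close>, whose power \<open>1 / \<beta>\<close> is
  \<open>2 ^ q\<close>. So a level with \<open>ln (k q)\<close> of order \<open>ln m\<close> has
  words of length of order \<open>ln m powr (1 / \<beta>)\<close>. Pigeonhole arguments take a level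
  with \<open>k q \<le> sqrt m\<close>; bounds against repetition take one with
  \<open>lk q \<ge> 4 * ln m\<close>, so that a union over \<open>m ^ 2\<close> pairs of positions
  still leaves the summable \<open>1 / m ^ 2\<close>. The obstacle is dependence: the labels in a
  word are correlated through all higher levels. Fixing the dictionary and the labels one level up
  leaves one source of randomness, an injection, for which probabilities are counts. The cost of
  coinciding labels adds up over the levels to a series dominated by its first term.
  \<open>M\<close> is given only by limits of averages over cylinders. Hence each estimate is proved
  uniformly over the windows of a random word and then passed to the limit; windows near the end of
  the word have vanishing frequency. Non-ergodicity comes last, from the divergence in (iv): an
  ergodic measure has redundancy zero.\<close>

declare One_nat_def [simp del]

section \<open>Random injections\<close>

text \<open>Extensional functions make the set finite, so that it carries a uniform distribution;
  this is why compositions are wrapped in \<open>restrict\<close> below.\<close>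

definition injections :: "nat \<Rightarrow> 'a set \<Rightarrow> (nat \<Rightarrow> 'a) set" where
  "injections m A = {f \<in> {1..m} \<rightarrow>\<^sub>E A. inj_on f {1..m}}"

text \<open>The symmetry concerns the values of the labels, not their positions in the list.\<close>

definition invariant_lists :: "nat \<Rightarrow> nat list pmf \<Rightarrow> bool" where
  "invariant_lists m \<nu> \<longleftrightarrow> set_pmf \<nu> \<subseteq> lists {1..m} \<and>
     (\<forall>\<sigma>. \<sigma> permutes {1..m} \<longrightarrow> map_pmf (map \<sigma>) \<nu> = \<nu>)"

lemma finite_injections: "finite A \<Longrightarrow> finite (injections m A)"
  unfolding injections_def by (rule finite_subset[of _ "{1..m} \<rightarrow>\<^sub>E A"]) (auto intro: finite_PiE)

lemma injections_outside: "f \<in> injections m A \<Longrightarrow> x \<notin> {1..m} \<Longrightarrow> f x = undefined"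
  unfolding injections_def by (blast intro: PiE_arb)

lemma restrict_injections:
  assumes "inj_on g {1..m}" "g ` {1..m} \<subseteq> A"
  shows "restrict g {1..m} \<in> injections m A"
  using assms unfolding injections_def
  by (auto simp: image_subset_iff PiE_iff inj_on_restrict_eq simp del: atLeastAtMost_iff)

lemma injections_nonempty:
  assumes "finite A" "m \<le> card A"
  shows "injections m A \<noteq> {}"
proof -
  have "card {1..m} \<le> card A" using assms by simp
  then obtain f where f: "inj_on f {1..m}" "f ` {1..m} \<subseteq> A"
    using card_le_inj[of "{1..m}" A] assms(1) by blast
  then show ?thesis using restrict_injections by blast
qed

lemma injections_comp:
  assumes "f \<in> injections m A" "bij_betw t A A"
  shows "restrict (t \<circ> f) {1..m} \<in> injections m A"
proof -
  have "inj_on f {1..m}" "f ` {1..m} \<subseteq> A" using assms by (auto simp: injections_def)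
  moreover have "inj_on t A" "t ` A \<subseteq> A" using assms by (auto simp: bij_betw_def)
  ultimately have "inj_on (t \<circ> f) {1..m}" by (meson comp_inj_on inj_on_subset)
  moreover have "(t \<circ> f) ` {1..m} \<subseteq> A" using \<open>f ` {1..m} \<subseteq> A\<close> \<open>t ` A \<subseteq> A\<close> by auto
  ultimately show ?thesis by (rule restrict_injections)
qed

lemma map_pmf_injections:
  assumes "finite A" "m \<le> card A" "bij_betw t A A"
  shows "map_pmf (\<lambda>f. restrict (t \<circ> f) {1..m}) (pmf_of_set (injections m A)) =
         pmf_of_set (injections m A)"
proof -
  have inj: "inj_on (\<lambda>f. restrict (t \<circ> f) {1..m}) (injections m A)"
  proof (rule inj_onI)
    fix f g assume fg: "f \<in> injections m A" "g \<in> injections m A"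
      and eq: "restrict (t \<circ> f) {1..m} = restrict (t \<circ> g) {1..m}"
    show "f = g"
    proof
      fix x show "f x = g x"
      proof (cases "x \<in> {1..m}")
        case True
        then have "t (f x) = t (g x)" using fun_cong[OF eq, of x] by simp
        moreover have "f x \<in> A" "g x \<in> A" using fg True by (auto simp: injections_def)
        ultimately show ?thesis using assms(3) by (auto simp: bij_betw_def dest: inj_onD)
      next
        case False then show ?thesis using fg by (metis injections_outside)
      qed
    qed
  qed
  have "(\<lambda>f. restrict (t \<circ> f) {1..m}) ` injections m A \<subseteq> injections m A"
    using injections_comp[OF _ assms(3)] by auto
  then have "bij_betw (\<lambda>f. restrict (t \<circ> f) {1..m}) (injections m A) (injections m A)"
    using inj finite_injections[OF assms(1)] by (simp add: bij_betw_def card_image endo_inj_surj)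
  then show ?thesis
    by (intro map_pmf_of_set_bij_betw finite_injections injections_nonempty assms)
qed

lemma pmf_of_set_Times:
  assumes "finite A" "finite B" "A \<noteq> {}" "B \<noteq> {}"
  shows "pmf_of_set (A \<times> B) = pair_pmf (pmf_of_set A) (pmf_of_set B)"
proof (rule pmf_eqI)
  fix x :: "'a \<times> 'b"
  obtain a b where "x = (a, b)" by (cases x)
  then show "pmf (pmf_of_set (A \<times> B)) x = pmf (pair_pmf (pmf_of_set A) (pmf_of_set B)) x"
    using assms by (simp add: pmf_pair card_cartesian_product indicator_def)
qed

text \<open>An injection factors uniquely into a permutation of \<open>{1..m}\<close> followed by
  the prescribed enumeration of its image, so the product of the two uniform laws is carried
  bijectively to the uniform law on injections.\<close>

lemma pmf_of_set_injections:
  fixes en :: "'a set \<Rightarrow> nat \<Rightarrow> 'a"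
  assumes A: "finite A" "m \<le> card A"
    and en: "\<And>S. S \<subseteq> A \<Longrightarrow> card S = m \<Longrightarrow> bij_betw (en S) {1..m} S"
  shows "pmf_of_set (injections m A) =
    bind_pmf (pmf_of_set {S. S \<subseteq> A \<and> card S = m}) (\<lambda>S.
      map_pmf (\<lambda>\<sigma>. restrict (en S \<circ> \<sigma>) {1..m}) (pmf_of_set {\<sigma>. \<sigma> permutes {1..m}}))"
proof -
  let ?Sub = "{S. S \<subseteq> A \<and> card S = m}" and ?P = "{\<sigma>. \<sigma> permutes {1..m}}"
  let ?g = "\<lambda>(S, \<sigma>). restrict (en S \<circ> \<sigma>) {1..m}"
  have fS: "finite ?Sub" using A by simp
  have fP: "finite ?P" by (simp add: finite_permutations)
  have nS: "?Sub \<noteq> {}" using obtain_subset_with_card_n[OF A(2)] by blast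
  have nP: "?P \<noteq> {}" using permutes_id by blast
  have "bij_betw (en S \<circ> \<sigma>) {1..m} S" if "S \<in> ?Sub" "\<sigma> \<in> ?P" for S \<sigma>
    using that en[of S] by (intro bij_betw_trans[of \<sigma> _ "{1..m}"] permutes_imp_bij) auto
  then have im: "(en S \<circ> \<sigma>) ` {1..m} = S" "inj_on (en S \<circ> \<sigma>) {1..m}"
    if "S \<in> ?Sub" "\<sigma> \<in> ?P" for S \<sigma>
    using that unfolding bij_betw_def by blast+
  have "bij_betw ?g (?Sub \<times> ?P) (injections m A)"
  proof (rule bij_betwI')
    fix x y assume x: "x \<in> ?Sub \<times> ?P" and y: "y \<in> ?Sub \<times> ?P"
    obtain S \<sigma> T \<tau> where xy: "x = (S, \<sigma>)" "y = (T, \<tau>)" by (cases x, cases y)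
    show "?g x = ?g y \<longleftrightarrow> x = y"
    proof
      assume eq: "?g x = ?g y"
      have eq': "(en S \<circ> \<sigma>) i = (en T \<circ> \<tau>) i" if "i \<in> {1..m}" for i
        using fun_cong[OF eq, of i] that xy by simp
      then have "(en S \<circ> \<sigma>) ` {1..m} = (en T \<circ> \<tau>) ` {1..m}" by (intro image_cong) auto
      then have ST: "S = T" using im x y xy by auto
      have "\<sigma> i = \<tau> i" for i
      proof (cases "i \<in> {1..m}")
        case True
        then have e: "en S (\<sigma> i) = en S (\<tau> i)" using eq' ST by simp
        have i: "\<sigma> i \<in> {1..m}" "\<tau> i \<in> {1..m}"
          using x y xy True by (auto simp: permutes_in_image simp del: atLeastAtMost_iff)
        have "inj_on (en S) {1..m}" using x xy en[of S] by (auto simp: bij_betw_def)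
        then show ?thesis using e i by (rule inj_onD)
      next
        case False
        then show ?thesis using x y xy by (auto simp: permutes_not_in)
      qed
      then show "x = y" using ST xy by auto
    qed simp
  next
    fix x assume x: "x \<in> ?Sub \<times> ?P"
    obtain S \<sigma> where xy: "x = (S, \<sigma>)" by (cases x)
    have "inj_on (en S \<circ> \<sigma>) {1..m}" "(en S \<circ> \<sigma>) ` {1..m} \<subseteq> A" using im x xy by auto
    then have "restrict (en S \<circ> \<sigma>) {1..m} \<in> injections m A" by (rule restrict_injections)
    then show "?g x \<in> injections m A" by (simp add: xy)
  next
    fix f assume f: "f \<in> injections m A"
    define S where "S = f ` {1..m}"
    have S: "S \<in> ?Sub" using f by (auto simp: S_def injections_def card_image)
    have b: "bij_betw (en S) {1..m} S" using en S by auto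
    define \<sigma> where "\<sigma> = (\<lambda>i. if i \<in> {1..m} then inv_into {1..m} (en S) (f i) else i)"
    have bf: "bij_betw f {1..m} S" using f by (auto simp: S_def injections_def bij_betw_def)
    have "bij_betw (inv_into {1..m} (en S) \<circ> f) {1..m} {1..m}"
      using bij_betw_trans[OF bf bij_betw_inv_into[OF b]] .
    then have "bij_betw \<sigma> {1..m} {1..m}" by (rule bij_betw_cong[THEN iffD1, rotated]) (auto simp: \<sigma>_def)
    moreover have "\<And>i. i \<notin> {1..m} \<Longrightarrow> \<sigma> i = i" unfolding \<sigma>_def by (simp only: if_False)
    ultimately have p: "\<sigma> \<in> ?P" by (simp add: bij_imp_permutes del: atLeastAtMost_iff)
    have "?g (S, \<sigma>) = f"
    proof
      fix i
      have "en S (inv_into {1..m} (en S) (f i)) = f i" if "i \<in> {1..m}"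
        using that b bf by (intro f_inv_into_f) (auto simp: bij_betw_def)
      then show "?g (S, \<sigma>) i = f i"
        using injections_outside[OF f, of i] by (auto simp: \<sigma>_def restrict_def)
    qed
    then show "\<exists>x\<in>?Sub \<times> ?P. f = ?g x" using S p by (intro bexI[of _ "(S, \<sigma>)"]) auto
  qed
  then have "map_pmf ?g (pmf_of_set (?Sub \<times> ?P)) = pmf_of_set (injections m A)"
    using nS nP fS fP by (intro map_pmf_of_set_bij_betw) auto
  moreover have "pmf_of_set (?Sub \<times> ?P) = pair_pmf (pmf_of_set ?Sub) (pmf_of_set ?P)"
    by (rule pmf_of_set_Times[OF fS fP nS nP])
  ultimately show ?thesis
    unfolding pair_pmf_def map_pmf_def by (simp add: bind_assoc_pmf bind_return_pmf)
qed

text \<open>An exchangeable list of labels does not notice in which order the chosen subset is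
  enumerated, so the sorted enumeration may be replaced by a uniformly random injection.\<close>

lemma enumeration_eq_random_injection:
  fixes en :: "'a set \<Rightarrow> nat \<Rightarrow> 'a"
  assumes A: "finite A" "m \<le> card A"
    and en: "\<And>S. S \<subseteq> A \<Longrightarrow> card S = m \<Longrightarrow> bij_betw (en S) {1..m} S"
    and \<nu>: "invariant_lists m \<nu>"
  shows "bind_pmf (pmf_of_set {S. S \<subseteq> A \<and> card S = m}) (\<lambda>S. map_pmf (map (en S)) \<nu>) =
         bind_pmf (pmf_of_set (injections m A)) (\<lambda>f. map_pmf (map f) \<nu>)"
proof -
  have *: "map_pmf (map (restrict (en S \<circ> \<sigma>) {1..m})) \<nu> = map_pmf (map (en S)) \<nu>"
    if "\<sigma> permutes {1..m}" for S \<sigma>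
  proof -
    have "map_pmf (map (restrict (en S \<circ> \<sigma>) {1..m})) \<nu> = map_pmf (map (en S) \<circ> map \<sigma>) \<nu>"
      using \<nu> by (intro map_pmf_cong) (auto simp: invariant_lists_def restrict_def)
    also have "\<dots> = map_pmf (map (en S)) (map_pmf (map \<sigma>) \<nu>)" by (simp add: pmf.map_comp)
    finally show ?thesis using \<nu> that by (simp add: invariant_lists_def)
  qed
  have P: "set_pmf (pmf_of_set {\<sigma>. \<sigma> permutes {1..m}}) = {\<sigma>. \<sigma> permutes {1..m}}"
    using permutes_id by (intro set_pmf_of_set) (blast, simp add: finite_permutations)
  have "bind_pmf (pmf_of_set (injections m A)) (\<lambda>f. map_pmf (map f) \<nu>) =
     bind_pmf (pmf_of_set {S. S \<subseteq> A \<and> card S = m}) (\<lambda>S.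
       bind_pmf (pmf_of_set {\<sigma>. \<sigma> permutes {1..m}}) (\<lambda>\<sigma>. map_pmf (map (restrict (en S \<circ> \<sigma>) {1..m})) \<nu>))"
    by (subst pmf_of_set_injections[OF A en]) (simp_all add: bind_assoc_pmf bind_map_pmf)
  also have "\<dots> = bind_pmf (pmf_of_set {S. S \<subseteq> A \<and> card S = m}) (\<lambda>S.
       bind_pmf (pmf_of_set {\<sigma>. \<sigma> permutes {1..m}}) (\<lambda>\<sigma>. map_pmf (map (en S)) \<nu>))"
    by (intro bind_pmf_cong refl * ) (simp add: P)
  finally show ?thesis by simp
qed

text \<open>Each prescribed value costs a factor of at least \<open>card A - length as\<close>: in
  an injection with \<open>f a = b\<close>, the value \<open>b\<close> may be swapped with any
  \<open>c\<close> outside the remaining prescribed values. This keeps the other constraints, and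
  both \<open>f\<close> and \<open>c\<close> can be recovered from the result.\<close>

lemma card_injections_extending:
  assumes A: "finite A" and "distinct as" "set as \<subseteq> {1..m}"
  shows "card {f \<in> injections m A. map f as = bs} * (card A - length as) ^ length as
           \<le> card (injections m A)"
  using assms(2,3)
proof (induction as arbitrary: bs)
  case Nil
  show ?case by (auto intro!: card_mono finite_injections A)
next
  case (Cons a as)
  note fin = finite_injections[OF A, of m]
  show ?case
  proof (cases "{f \<in> injections m A. map f (a # as) = bs} = {}")
    case True then show ?thesis by (metis card.empty mult_0 le0)
  next
    case False
    then obtain b bs' where bs: "bs = b # bs'" by (cases bs) auto
    let ?Eb = "{f \<in> injections m A. map f (a # as) = b # bs'}"
    let ?E = "{f \<in> injections m A. map f as = bs'}"
    obtain f0 where "f0 \<in> ?Eb" using False bs by auto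
    then have f0: "f0 \<in> injections m A" "f0 a = b" "map f0 as = bs'" by auto
    have f0': "inj_on f0 {1..m}" "f0 ` {1..m} \<subseteq> A" using f0 by (auto simp: injections_def)
    have bs': "length bs' = length as" "set bs' = f0 ` set as" using f0(3) by auto
    have "f0 a \<notin> f0 ` set as"
      using inj_on_image_mem_iff[OF f0'(1), of a "set as"] Cons.prems by simp
    then have b: "b \<in> A" "b \<notin> set bs'" "length bs' = length as" "set bs' \<subseteq> A"
      using f0(2) f0'(2) bs' Cons.prems by (auto simp: image_subset_iff subset_iff)
    let ?h = "\<lambda>(f, c). restrict (Transposition.transpose b c \<circ> f) {1..m}"
    have "inj_on ?h (?Eb \<times> (A - set bs'))"
    proof (rule inj_onI)
      fix x y assume x: "x \<in> ?Eb \<times> (A - set bs')" and y: "y \<in> ?Eb \<times> (A - set bs')" and e: "?h x = ?h y"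
      obtain f c g d where xy: "x = (f, c)" "y = (g, d)" by (cases x, cases y)
      have pw: "Transposition.transpose b c (f i) = Transposition.transpose b d (g i)" if "i \<in> {1..m}" for i
        using fun_cong[OF e, of i] that xy by simp
      \<comment> \<open>Since \<open>f a = g a = b\<close>, the composed functions take the values
        \<open>c\<close> and \<open>d\<close> at \<open>a\<close>.\<close>
      have "c = d" using pw[of a] x y xy Cons.prems by (auto simp: Transposition.transpose_def split: if_splits)
      have "f i = g i" for i
      proof (cases "i \<in> {1..m}")
        case True
        then show ?thesis using pw[OF True] \<open>c = d\<close> by (metis Transposition.transpose_involutory)
      next
        case False
        moreover have "f \<in> injections m A" "g \<in> injections m A" using x y xy by auto
        ultimately show ?thesis using injections_outside by metis
      qed
      then show "x = y" using xy \<open>c = d\<close> by auto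
    qed
    moreover have "?h ` (?Eb \<times> (A - set bs')) \<subseteq> ?E"
    proof (rule image_subsetI)
      fix x assume x: "x \<in> ?Eb \<times> (A - set bs')"
      obtain f c where fc: "x = (f, c)" by (cases x)
      have f: "f \<in> injections m A" "map f (a # as) = b # bs'" and c: "c \<in> A" "c \<notin> set bs'"
        using x fc by auto
      have "bij_betw (Transposition.transpose b c) A A"
        by (rule permutes_imp_bij[OF permutes_swap_id[OF b(1) c(1)]])
      then have "restrict (Transposition.transpose b c \<circ> f) {1..m} \<in> injections m A" using f injections_comp by blast
      moreover have "map (restrict (Transposition.transpose b c \<circ> f) {1..m}) as = bs'"
      proof -
        have "map (restrict (Transposition.transpose b c \<circ> f) {1..m}) as = map f as"
        proof (rule map_cong[OF refl])
          fix i assume i: "i \<in> set as"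
          then have "f i \<in> set bs'" using f by auto
          then have "f i \<noteq> b" "f i \<noteq> c" using b c by auto
          then show "restrict (Transposition.transpose b c \<circ> f) {1..m} i = f i" using i Cons.prems by auto
        qed
        also have "\<dots> = bs'" using f by simp
        finally show ?thesis .
      qed
      ultimately show "?h x \<in> ?E" unfolding fc by simp
    qed
    ultimately have c: "card (?Eb \<times> (A - set bs')) \<le> card ?E"
      by (rule card_inj_on_le) (use fin in simp)
    have "card A - length as \<le> card (A - set bs')"
      using b A by (metis card_Diff_subset card_length diff_le_mono2 finite_set)
    then have "card ?Eb * (card A - length as) \<le> card ?Eb * card (A - set bs')"
      by (rule mult_le_mono2)
    with c have 1: "card ?Eb * (card A - length as) \<le> card ?E"
      unfolding card_cartesian_product by (rule order_trans[rotated])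
    have "card ?Eb * (card A - length (a # as)) ^ length (a # as)
        \<le> card ?Eb * ((card A - length as) * (card A - length as) ^ length as)"
      unfolding length_Cons power_Suc by (intro mult_le_mono le_refl power_mono) auto
    also have "\<dots> \<le> card ?E * (card A - length as) ^ length as"
      using mult_le_mono1[OF 1, of "(card A - length as) ^ length as"] by (simp only: mult.assoc)
    also have "\<dots> \<le> card (injections m A)"
      by (rule Cons.IH) (use Cons.prems in simp_all)
    finally show ?thesis unfolding bs .
  qed
qed

text \<open>Up to the loss of \<open>length as\<close> in the base, the values at distinct arguments
  obey the bound of independent uniform elements of \<open>A\<close>.\<close>

lemma prob_injections_le:
  assumes A: "finite A" "m \<le> card A" and as: "distinct as" "set as \<subseteq> {1..m}" "length as < card A"
    and T: "finite T"
  shows "measure_pmf.prob (pmf_of_set (injections m A)) {f. map f as \<in> T}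
           \<le> card T / (real (card A) - length as) ^ length as"
proof -
  let ?I = "injections m A" and ?d = "(real (card A) - length as) ^ length as"
  note I = finite_injections[OF A(1), of m] injections_nonempty[OF A]
  have d: "?d > 0" using as by simp
  have c: "card ?I > 0" using I by (simp add: card_gt_0_iff)
  have "{f. map f as \<in> T} = (\<Union>bs\<in>T. {f. map f as = bs})" by auto
  then have "measure_pmf.prob (pmf_of_set ?I) {f. map f as \<in> T}
      \<le> (\<Sum>bs\<in>T. measure_pmf.prob (pmf_of_set ?I) {f. map f as = bs})"
    using T by (simp add: measure_pmf.finite_measure_subadditive_finite)
  also have "\<dots> \<le> (\<Sum>bs\<in>T. 1 / ?d)"
  proof (rule sum_mono)
    fix bs
    have "real (card {f \<in> ?I. map f as = bs}) * ?d = real (card {f \<in> ?I. map f as = bs} * (card A - length as) ^ length as)"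
      using as by (simp add: of_nat_diff)
    also have "\<dots> \<le> card ?I" using card_injections_extending[OF A(1) as(1,2), of bs] by linarith
    finally have "real (card {f \<in> ?I. map f as = bs}) / card ?I \<le> 1 / ?d"
      using d c by (simp add: field_simps)
    moreover have "?I \<inter> {f. map f as = bs} = {f \<in> ?I. map f as = bs}" by auto
    ultimately show "measure_pmf.prob (pmf_of_set ?I) {f. map f as = bs} \<le> 1 / ?d"
      using I by (simp add: measure_pmf_of_set)
  qed
  finally show ?thesis by simp
qed

section \<open>Hierarchical decomposition of a random word\<close>

definition pair_list :: "nat \<Rightarrow> (nat \<times> nat) set \<Rightarrow> (nat \<times> nat) list" where
  "pair_list K S = [(l, r). l \<leftarrow> [1..<K + 1], r \<leftarrow> [1..<K + 1], (l, r) \<in> S]"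

definition pair_enum :: "nat \<Rightarrow> (nat \<times> nat) set \<Rightarrow> nat \<Rightarrow> nat \<times> nat" where
  "pair_enum K S c = pair_list K S ! (c - 1)"

definition flat :: "(nat \<times> nat) list \<Rightarrow> nat list" where
  "flat ps = concat (map (\<lambda>(l, r). [l, r]) ps)"

definition decode :: "nat list list \<Rightarrow> nat list \<Rightarrow> nat list" where
  "decode D is = concat (map (\<lambda>a. D ! (a - 1)) is)"

lemma new_dict_eq: "new_dict D S = map (\<lambda>(l, r). D ! (l - 1) @ D ! (r - 1)) (pair_list (length D) S)"
  by (simp only: new_dict_def pair_list_def)

lemma pair_list:
  assumes "S \<subseteq> {1..K} \<times> {1..K}"
  shows "set (pair_list K S) = S" "distinct (pair_list K S)" "length (pair_list K S) = card S"
proof -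
  have e: "pair_list K S = filter (\<lambda>p. p \<in> S) (List.product [1..<K + 1] [1..<K + 1])"
  proof -
    have "[(l, r). r \<leftarrow> ys, (l, r) \<in> S] = filter (\<lambda>p. p \<in> S) (map (Pair l) ys)" for l ys
      by (induction ys) auto
    then have "[(l, r). l \<leftarrow> xs, r \<leftarrow> ys, (l, r) \<in> S] = filter (\<lambda>p. p \<in> S) (List.product xs ys)"
      for xs ys by (induction xs) (auto)
    then show ?thesis unfolding pair_list_def .
  qed
  have "set (filter (\<lambda>p. p \<in> S) (List.product [1..<K + 1] [1..<K + 1])) = S \<inter> {1..<K+1} \<times> {1..<K+1}"
    by auto
  also have "{1..<K+1} = {1..K}" by auto
  finally show s: "set (pair_list K S) = S" unfolding e using assms by (simp add: Int_absorb2)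
  show d: "distinct (pair_list K S)"
    unfolding e by (intro distinct_filter distinct_product) auto
  show "length (pair_list K S) = card S" using distinct_card[OF d] s by simp
qed

lemma bij_betw_pair_enum:
  assumes "S \<subseteq> {1..K} \<times> {1..K}" "card S = m"
  shows "bij_betw (pair_enum K S) {1..m} S"
proof -
  note p = pair_list[OF assms(1)]
  have "bij_betw ((!) (pair_list K S)) {..<m} S"
    using bij_betw_nth[OF p(2), of "{..<m}" S] p assms(2) by simp
  moreover have "bij_betw (\<lambda>c. c - 1) {1..m} {..<m}"
    by (rule bij_betw_byWitness[where f' = Suc]) (auto simp: One_nat_def)
  ultimately have "bij_betw ((!) (pair_list K S) \<circ> (\<lambda>c. c - 1)) {1..m} S"
    by (rule bij_betw_trans[rotated])
  then show ?thesis by (simp add: pair_enum_def[abs_def] o_def)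
qed

lemma new_dict_nth:
  assumes "S \<subseteq> {1..length D} \<times> {1..length D}" "c \<in> {1..card S}"
  shows "new_dict D S ! (c - 1) =
    D ! (fst (pair_enum (length D) S c) - 1) @ D ! (snd (pair_enum (length D) S c) - 1)"
  using pair_list[OF assms(1)] assms(2) unfolding new_dict_eq pair_enum_def
  by (subst nth_map) (auto simp: case_prod_beta)

lemma length_new_dict:
  assumes "S \<subseteq> {1..length D} \<times> {1..length D}"
  shows "length (new_dict D S) = card S"
  using pair_list[OF assms] by (simp add: new_dict_eq)

text \<open>Moves the decoding one level down; iterated, it expresses a word of high level over a
  dictionary of low level.\<close>

lemma decode_new_dict:
  assumes "S \<subseteq> {1..length D} \<times> {1..length D}" "set is \<subseteq> {1..card S}"
  shows "decode (new_dict D S) is = decode D (flat (map (pair_enum (length D) S) is))"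
  using assms(2)
  by (induction "is") (auto simp: decode_def flat_def new_dict_nth[OF assms(1)] case_prod_beta)

lemma map_flat: "map \<pi> (flat ps) = flat (map (map_prod \<pi> \<pi>) ps)"
  by (induction ps) (auto simp: flat_def)

lemma length_flat [simp]: "length (flat ps) = 2 * length ps"
  by (induction ps) (auto simp: flat_def)

lemma set_flat: "set (flat ps) = fst ` set ps \<union> snd ` set ps"
  by (induction ps) (auto simp: flat_def)

lemma flat_nth:
  assumes "j < 2 * length ps"
  shows "flat ps ! j = (if even j then fst (ps ! (j div 2)) else snd (ps ! (j div 2)))"
  using assms
proof (induction ps arbitrary: j)
  case (Cons p ps)
  show ?case
  proof (cases "j < 2")
    case True
    then have "j = 0 \<or> j = 1" by auto
    then show ?thesis by (auto simp: flat_def case_prod_beta)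
  next
    case False
    then obtain i where i: "j = Suc (Suc i)" by (metis add_2_eq_Suc le_add_diff_inverse not_less)
    have "flat (p # ps) ! j = flat ps ! i" unfolding i by (simp add: flat_def case_prod_beta)
    then show ?thesis using Cons.IH[of i] Cons.prems i by simp
  qed
qed simp

definition wf_dict :: "nat \<Rightarrow> nat \<Rightarrow> nat \<Rightarrow> nat list list \<Rightarrow> bool" where
  "wf_dict K n kn D \<longleftrightarrow> length D = kn \<and> distinct D \<and> (\<forall>w\<in>set D. length w = 2 ^ n \<and> set w \<subseteq> {1..K})"

text \<open>Distinctness survives because all words of one level have the same length, so that a
  concatenation splits in only one way.\<close>

lemma wf_new_dict:
  assumes D: "wf_dict K n kn D" and S: "S \<subseteq> {1..kn} \<times> {1..kn}"
  shows "wf_dict K (Suc n) (card S) (new_dict D S)"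
proof -
  have l: "length D = kn" "distinct D" "\<And>w. w \<in> set D \<Longrightarrow> length w = 2 ^ n \<and> set w \<subseteq> {1..K}"
    using D by (auto simp: wf_dict_def)
  note p = pair_list[OF S]
  have mem: "D ! (i - 1) \<in> set D" if "i \<in> {1..kn}" for i using that l(1) by (auto intro!: nth_mem)
  have "inj_on (\<lambda>(l, r). D ! (l - 1) @ D ! (r - 1)) S"
  proof (rule inj_onI, clarify)
    fix a b c d assume s: "(a, b) \<in> S" "(c, d) \<in> S" and e: "D ! (a - 1) @ D ! (b - 1) = D ! (c - 1) @ D ! (d - 1)"
    have r: "a \<in> {1..kn}" "b \<in> {1..kn}" "c \<in> {1..kn}" "d \<in> {1..kn}" using s S by auto
    have "length (D ! (a - 1)) = length (D ! (c - 1))" using r l(3) mem by metis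
    then have "D ! (a - 1) = D ! (c - 1)" "D ! (b - 1) = D ! (d - 1)" using e by auto
    then have "a - 1 = c - 1" "b - 1 = d - 1"
      using r nth_eq_iff_index_eq[OF l(2)] l(1) by (auto simp: Suc_le_eq One_nat_def)
    then show "a = c \<and> b = d" using r by auto
  qed
  then have "distinct (new_dict D S)"
    unfolding new_dict_eq l(1) distinct_map p(1) using p(2) by blast
  moreover have "length w = 2 ^ Suc n \<and> set w \<subseteq> {1..K}" if "w \<in> set (new_dict D S)" for w
  proof -
    have "w \<in> (\<lambda>(l, r). D ! (l - 1) @ D ! (r - 1)) ` S"
      using that unfolding new_dict_eq l(1) set_map p(1) .
    then obtain a b where ab: "(a, b) \<in> S" "w = D ! (a - 1) @ D ! (b - 1)" by auto
    have "a \<in> {1..kn}" "b \<in> {1..kn}" using ab S by auto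
    then show ?thesis using l(3)[OF mem, of a] l(3)[OF mem, of b] ab by auto
  qed
  ultimately show ?thesis unfolding wf_dict_def using length_new_dict[of S D] S l(1) by auto
qed

lemma map_pmf_of_set_permutes:
  assumes "\<pi> permutes A" "finite A" "A \<noteq> {}"
  shows "map_pmf \<pi> (pmf_of_set A) = pmf_of_set A"
  by (rule map_pmf_of_set_bij_betw[OF permutes_imp_bij]) (use assms in auto)

text \<open>The bound \<open>2 \<le> k 0\<close> yields \<open>(k q)\<^sup>2 \<ge> 4\<close>, which
  keeps the denominators positive when up to three values of a random injection are
  prescribed.\<close>

locale rha =
  fixes k :: "nat \<Rightarrow> nat"
  assumes k_ge2: "2 \<le> k 0"
    and k_mono1: "k n \<le> k (Suc n)"
    and k_sq: "k (Suc n) \<le> (k n)\<^sup>2"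
begin

definition box :: "nat \<Rightarrow> (nat \<times> nat) set" where
  "box n = {1..k n} \<times> {1..k n}"

fun dict :: "nat \<Rightarrow> nat list list pmf" where
  "dict 0 = return_pmf (map (\<lambda>j. [j]) [1..<k 0 + 1])"
| "dict (Suc n) = bind_pmf (dict n) (\<lambda>D. map_pmf (new_dict D) (pmf_of_set (subsets_lvl k (Suc n))))"

text \<open>The law of the block \<open>Y^n_(C_n)\<close>; \<open>map_last_block_rha_state\<close>
  identifies it with the end of the simulated prefix.\<close>

definition word :: "nat \<Rightarrow> nat list pmf" where
  "word n = bind_pmf (dict n) (\<lambda>D. map_pmf (\<lambda>c. D ! (c - 1)) (pmf_of_set {1..k n}))"

abbreviation inj_lvl :: "nat \<Rightarrow> (nat \<Rightarrow> nat \<times> nat) set" where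
  "inj_lvl q \<equiv> injections (k (Suc q)) (box q)"

text \<open>Labels at level \<open>q\<close> of the \<open>2 ^ h\<close> blocks composing a uniformly chosen word
  of level \<open>q + h\<close>.\<close>

fun idx :: "nat \<Rightarrow> nat \<Rightarrow> nat list pmf" where
  "idx q 0 = map_pmf (\<lambda>c. [c]) (pmf_of_set {1..k q})"
| "idx q (Suc h) = bind_pmf (pmf_of_set (inj_lvl q)) (\<lambda>f. map_pmf (\<lambda>is. flat (map f is)) (idx (Suc q) h))"

lemma k_mono: "m \<le> n \<Longrightarrow> k m \<le> k n"
  using lift_Suc_mono_le[of k m n] k_mono1 by blast

lemma k_ge_2: "2 \<le> k n"
  using k_mono[of 0 n] k_ge2 by linarith

lemma range_nonempty: "{1..k n} \<noteq> {}" "finite {1..k n}"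
  using k_ge_2[of n] by auto

lemma finite_box: "finite (box n)" and card_box: "card (box n) = (k n)\<^sup>2"
  by (auto simp: box_def card_cartesian_product power2_eq_square)

lemma k_le_card_box: "k (Suc q) \<le> card (box q)"
  by (simp only: card_box k_sq)

lemma inj_lvl: "finite (inj_lvl q)" "inj_lvl q \<noteq> {}"
  by (rule finite_injections[OF finite_box], rule injections_nonempty[OF finite_box k_le_card_box])

lemma subsets_lvl: "subsets_lvl k (Suc q) = {S. S \<subseteq> box q \<and> card S = k (Suc q)}"
  by (simp add: subsets_lvl_def box_def)

lemma subsets_lvl_fin: "finite (subsets_lvl k (Suc q))" "subsets_lvl k (Suc q) \<noteq> {}"
proof -
  show "finite (subsets_lvl k (Suc q))" unfolding subsets_lvl
    by (rule finite_subset[of _ "Pow (box q)"]) (auto simp: finite_box)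
  obtain S where "S \<subseteq> box q" "card S = k (Suc q)"
    using obtain_subset_with_card_n[OF k_le_card_box] by blast
  then show "subsets_lvl k (Suc q) \<noteq> {}" unfolding subsets_lvl by blast
qed

lemma set_dict: "D \<in> set_pmf (dict n) \<Longrightarrow> wf_dict (k 0) n (k n) D"
proof (induction n arbitrary: D)
  case 0
  then show ?case by (auto simp: wf_dict_def distinct_map inj_on_def)
next
  case (Suc n)
  then obtain D0 S where D0: "D0 \<in> set_pmf (dict n)" and S: "S \<in> subsets_lvl k (Suc n)"
    and D: "D = new_dict D0 S" using subsets_lvl_fin[of n] by auto
  have "S \<subseteq> {1..k n} \<times> {1..k n}" "card S = k (Suc n)" using S by (auto simp: subsets_lvl box_def)
  then show ?case using wf_new_dict[OF Suc.IH[OF D0], of S] D by simp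
qed

lemma set_idx: "is \<in> set_pmf (idx q h) \<Longrightarrow> length is = 2 ^ h \<and> set is \<subseteq> {1..k q}"
proof (induction h arbitrary: q "is")
  case 0
  then show ?case using range_nonempty by auto
next
  case (Suc h)
  then obtain f js where f: "f \<in> inj_lvl q" and js: "js \<in> set_pmf (idx (Suc q) h)"
    and e: "is = flat (map f js)" using inj_lvl by auto
  have "f a \<in> box q" if "a \<in> {1..k (Suc q)}" for a
    using f that unfolding injections_def by (blast dest: PiE_mem)
  then have "f ` set js \<subseteq> box q" using Suc.IH[OF js] by blast
  then have "fst (f x) \<in> {1..k q} \<and> snd (f x) \<in> {1..k q}" if "x \<in> set js" for x
    using that by (auto simp: box_def mem_Times_iff image_subset_iff)
  then show ?case using Suc.IH[OF js] e
    by (auto simp: set_flat simp del: atLeastAtMost_iff)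
qed

text \<open>A permutation of the level-\<open>q\<close> labels acts on the values of the random
  injection through a bijection of \<open>box q\<close>, and a uniform injection composed with a
  bijection is again uniform. So a case distinction suffices in place of an induction.\<close>

lemma invariant_idx: "invariant_lists (k q) (idx q h)"
proof -
  have "map_pmf (map \<pi>) (idx q h) = idx q h" if \<pi>: "\<pi> permutes {1..k q}" for \<pi>
  proof (cases h)
    case 0
    have "map_pmf (map \<pi>) (idx q h) = map_pmf (\<lambda>c. [c]) (map_pmf \<pi> (pmf_of_set {1..k q}))"
      by (simp add: 0 pmf.map_comp o_def)
    then show ?thesis using map_pmf_of_set_permutes[OF \<pi>] range_nonempty 0 by simp
  next
    case (Suc h')
    let ?t = "map_prod \<pi> \<pi>"
    have b: "bij_betw ?t (box q) (box q)"
      unfolding box_def by (intro bij_betw_map_prod permutes_imp_bij \<pi>)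
    have "map_pmf (map \<pi>) (idx q h) =
       bind_pmf (pmf_of_set (inj_lvl q)) (\<lambda>f. map_pmf (\<lambda>is. flat (map (?t \<circ> f) is)) (idx (Suc q) h'))"
      by (simp add: Suc map_bind_pmf pmf.map_comp o_def map_flat)
    also have "\<dots> = bind_pmf (pmf_of_set (inj_lvl q))
        (\<lambda>f. map_pmf (\<lambda>is. flat (map (restrict (?t \<circ> f) {1..k (Suc q)}) is)) (idx (Suc q) h'))"
    proof (intro bind_pmf_cong map_pmf_cong refl arg_cong[of _ _ flat] map_cong)
      fix f "is" a assume "is \<in> set_pmf (idx (Suc q) h')" "a \<in> set is"
      then have "a \<in> {1..k (Suc q)}" using set_idx by blast
      then show "(?t \<circ> f) a = restrict (?t \<circ> f) {1..k (Suc q)} a" by simp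
    qed
    also have "\<dots> = bind_pmf (map_pmf (\<lambda>f. restrict (?t \<circ> f) {1..k (Suc q)}) (pmf_of_set (inj_lvl q)))
        (\<lambda>f. map_pmf (\<lambda>is. flat (map f is)) (idx (Suc q) h'))"
      by (simp add: bind_map_pmf)
    also have "\<dots> = idx q h"
      using map_pmf_injections[OF finite_box k_le_card_box b] by (simp add: Suc)
    finally show ?thesis .
  qed
  then show ?thesis unfolding invariant_lists_def using set_idx by blast
qed

text \<open>The content is independence: the labels are drawn without reference to the
  level-\<open>q\<close> dictionary. The induction raises \<open>q\<close> while \<open>h\<close>
  decreases, so each step has only one new dictionary to expand.\<close>

lemma word_eq_decode_idx:
  "word (q + h) = bind_pmf (dict q) (\<lambda>D. map_pmf (decode D) (idx q h))"
proof (induction h arbitrary: q)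
  case 0
  show ?case by (simp add: word_def pmf.map_comp o_def decode_def)
next
  case (Suc h)
  let ?\<nu> = "idx (Suc q) h"
  have "word (q + Suc h) = bind_pmf (dict (Suc q)) (\<lambda>D. map_pmf (decode D) ?\<nu>)"
    using Suc.IH[of "Suc q"] by simp
  also have "\<dots> = bind_pmf (dict q) (\<lambda>D. bind_pmf (pmf_of_set (subsets_lvl k (Suc q)))
      (\<lambda>S. map_pmf (decode (new_dict D S)) ?\<nu>))"
    by (simp add: bind_assoc_pmf bind_map_pmf)
  also have "\<dots> = bind_pmf (dict q) (\<lambda>D. map_pmf (\<lambda>ps. decode D (flat ps))
      (bind_pmf (pmf_of_set {S. S \<subseteq> box q \<and> card S = k (Suc q)})
        (\<lambda>S. map_pmf (map (pair_enum (k q) S)) ?\<nu>)))"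
    unfolding map_bind_pmf pmf.map_comp o_def subsets_lvl[symmetric]
  proof (intro bind_pmf_cong map_pmf_cong refl)
    fix D S "is" assume D: "D \<in> set_pmf (dict q)"
      and S: "S \<in> set_pmf (pmf_of_set (subsets_lvl k (Suc q)))" and js: "is \<in> set_pmf ?\<nu>"
    have "length D = k q" using set_dict[OF D] by (simp add: wf_dict_def)
    moreover have "S \<subseteq> {1..k q} \<times> {1..k q}" "card S = k (Suc q)"
      using S subsets_lvl_fin[of q] by (auto simp: subsets_lvl box_def)
    ultimately show "decode (new_dict D S) is = decode D (flat (map (pair_enum (k q) S) is))"
      using decode_new_dict[of S D "is"] set_idx[OF js] by auto
  qed
  \<comment> \<open>Here the sorted enumeration is exchanged for a random injection, as the labels
    above are exchangeable.\<close>
  also have "bind_pmf (pmf_of_set {S. S \<subseteq> box q \<and> card S = k (Suc q)})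
        (\<lambda>S. map_pmf (map (pair_enum (k q) S)) ?\<nu>) =
      bind_pmf (pmf_of_set (inj_lvl q)) (\<lambda>f. map_pmf (map f) ?\<nu>)"
    by (intro enumeration_eq_random_injection finite_box invariant_idx k_le_card_box bij_betw_pair_enum)
      (auto simp: box_def)
  finally show ?case by (simp add: map_bind_pmf pmf.map_comp o_def)
qed

end

section \<open>Collisions and repetitions\<close>

lemma prob_pmf_mono:
  assumes "\<And>x. x \<in> set_pmf p \<Longrightarrow> x \<in> A \<Longrightarrow> x \<in> B"
  shows "measure_pmf.prob p A \<le> measure_pmf.prob p B"
  using assms by (intro measure_pmf.finite_measure_mono_AE) (auto simp: AE_measure_pmf_iff)

text \<open>Bad outcomes \<open>E\<close> of the first stage are charged in full, all others at most
  \<open>b\<close>. With \<open>E = {}\<close> this is a plain uniform bound.\<close>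

lemma prob_bind_pmf_le:
  assumes "\<And>x. x \<in> set_pmf p \<Longrightarrow> x \<notin> E \<Longrightarrow> measure_pmf.prob (f x) A \<le> b" "0 \<le> b"
  shows "measure_pmf.prob (bind_pmf p f) A \<le> measure_pmf.prob p E + b"
proof -
  have "ennreal (measure_pmf.prob (bind_pmf p f) A) = (\<integral>\<^sup>+x. emeasure (f x) A \<partial>p)"
    by (simp flip: measure_pmf.emeasure_eq_measure)
  also have "\<dots> \<le> (\<integral>\<^sup>+x. indicator E x + ennreal b \<partial>p)"
  proof (intro nn_integral_mono_AE AE_pmfI)
    fix x assume x: "x \<in> set_pmf p"
    have "ennreal (measure_pmf.prob (f x) A) \<le> indicator E x + ennreal b"
    proof (cases "x \<in> E")
      case True
      have "ennreal (measure_pmf.prob (f x) A) \<le> 1" by (simp add: ennreal_le_1)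
      also have "\<dots> \<le> indicator E x + ennreal b" using True by simp
      finally show ?thesis .
    next
      case False
      then show ?thesis using assms(1)[OF x False] by (simp add: ennreal_leI)
    qed
    then show "emeasure (f x) A \<le> indicator E x + ennreal b"
      by (simp add: measure_pmf.emeasure_eq_measure)
  qed
  also have "\<dots> = emeasure p E + ennreal b" by (subst nn_integral_add) auto
  also have "\<dots> = ennreal (measure_pmf.prob p E + b)"
    using assms(2) by (simp add: measure_pmf.emeasure_eq_measure)
  finally show ?thesis using assms(2) by (subst (asm) ennreal_le_iff) auto
qed

lemma length_concat_map:
  "(\<And>a. a \<in> set xs \<Longrightarrow> length (g a) = L) \<Longrightarrow> length (concat (map g xs)) = L * length xs"
  by (induction xs) auto

lemma concat_map_nth:
  assumes "\<And>a. a \<in> set xs \<Longrightarrow> length (g a) = L" "j < length xs" "t < L"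
  shows "concat (map g xs) ! (j * L + t) = g (xs ! j) ! t"
  using assms
proof (induction xs arbitrary: j)
  case (Cons a xs)
  show ?case
  proof (cases j)
    case 0 then show ?thesis using Cons.prems by (auto simp: nth_append)
  next
    case (Suc i)
    have "length (g a) = L" using Cons.prems by auto
    moreover have "concat (map g xs) ! (i * L + t) = g (xs ! i) ! t"
      using Cons.prems Suc by (intro Cons.IH) auto
    ultimately show ?thesis using Suc by (simp add: nth_append algebra_simps)
  qed
qed simp

lemma block_of_window:
  assumes g: "\<And>a. a \<in> set xs \<Longrightarrow> length (g a) = L"
    and x: "x = take m (drop i (concat (map g xs)))" and m: "i + m \<le> L * length xs"
    and j: "i \<le> j * L" "j * L + L \<le> i + m" "j < length xs"
  shows "take L (drop (j * L - i) x) = g (xs ! j)"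
proof (rule nth_equalityI)
  have l: "length x = m" using x m length_concat_map[of xs g L, OF g] by auto
  show "length (take L (drop (j * L - i) x)) = length (g (xs ! j))" using l j g[of "xs ! j"] by auto
  fix t assume "t < length (take L (drop (j * L - i) x))"
  then have t: "t < L" by simp
  have "take L (drop (j * L - i) x) ! t = x ! (j * L - i + t)" using l j t by simp
  also have "\<dots> = concat (map g xs) ! (i + (j * L - i + t))"
    unfolding x using m j t length_concat_map[of xs g L, OF g] by simp
  also have "i + (j * L - i + t) = j * L + t" using j by simp
  finally show "take L (drop (j * L - i) x) ! t = g (xs ! j) ! t"
    using concat_map_nth[of xs g L j t] g j t by simp
qed

text \<open>The two occurrences may overlap. For nonempty lists this says that \<open>L_rep\<close>
  is at least \<open>l\<close>, see \<open>le_L_rep_iff_has_rep\<close>.\<close>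

definition has_rep :: "nat \<Rightarrow> 'a list \<Rightarrow> bool" where
  "has_rep l x \<longleftrightarrow> (\<exists>i j. i < j \<and> j + l \<le> length x \<and> take l (drop i x) = take l (drop j x))"

context rha
begin

text \<open>Defined for every pair of the box, chosen or not: the injection decides which pairs
  become words of level \<open>q + 1\<close>.\<close>

definition pair_word :: "nat list list \<Rightarrow> nat \<times> nat \<Rightarrow> nat list" where
  "pair_word D b = D ! (fst b - 1) @ D ! (snd b - 1)"

lemma decode_flat: "decode D (flat ps) = concat (map (pair_word D) ps)"
  by (induction ps) (auto simp: decode_def flat_def pair_word_def)

lemma pair_word:
  assumes D: "wf_dict (k 0) q (k q) D"
  shows "b \<in> box q \<Longrightarrow> length (pair_word D b) = 2 ^ Suc q" "inj_on (pair_word D) (box q)"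
proof -
  have l: "length D = k q" "distinct D" "\<And>w. w \<in> set D \<Longrightarrow> length w = 2 ^ q"
    using D by (auto simp: wf_dict_def)
  have len: "length (D ! (i - 1)) = 2 ^ q" if "i \<in> {1..k q}" for i
    using that l(1) by (intro l(3) nth_mem) auto
  show "b \<in> box q \<Longrightarrow> length (pair_word D b) = 2 ^ Suc q"
    using len[of "fst b"] len[of "snd b"] by (auto simp: pair_word_def box_def)
  have inj: "i = j" if "i \<in> {1..k q}" "j \<in> {1..k q}" "D ! (i - 1) = D ! (j - 1)" for i j
  proof -
    have "i - 1 = j - 1" using that l(1) nth_eq_iff_index_eq[OF l(2), of "i - 1" "j - 1"] by auto
    then show ?thesis using that by auto
  qed
  show "inj_on (pair_word D) (box q)"
  proof (rule inj_onI)
    fix b c assume b: "b \<in> box q" and c: "c \<in> box q" and e: "pair_word D b = pair_word D c"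
    have r: "fst b \<in> {1..k q}" "snd b \<in> {1..k q}" "fst c \<in> {1..k q}" "snd c \<in> {1..k q}"
      using b c by (auto simp: box_def)
    have "D ! (fst b - 1) = D ! (fst c - 1)" "D ! (snd b - 1) = D ! (snd c - 1)"
      using e len[OF r(1)] len[OF r(3)] by (auto simp: pair_word_def)
    then show "b = c" using inj r by (intro prod_eqI) blast+
  qed
qed

lemma inj_lvl_mem: "f \<in> inj_lvl q \<Longrightarrow> a \<in> {1..k (Suc q)} \<Longrightarrow> f a \<in> box q"
  unfolding injections_def by (blast dest: PiE_mem)

lemma set_inj_lvl: "set_pmf (pmf_of_set (inj_lvl q)) = inj_lvl q"
  by (rule set_pmf_of_set[OF inj_lvl(2,1)])

text \<open>The order of sampling is exchanged, so that the labels one level up can be held fixed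
  while the injection is still random.\<close>

lemma idx_Suc:
  "idx q (Suc h) = bind_pmf (idx (Suc q) h) (\<lambda>is. map_pmf (\<lambda>f. flat (map f is)) (pmf_of_set (inj_lvl q)))"
  unfolding idx.simps map_pmf_def by (rule bind_commute_pmf)

lemma word_Suc:
  "word (Suc q + h) = bind_pmf (dict q) (\<lambda>D. bind_pmf (idx (Suc q) h) (\<lambda>is.
     map_pmf (\<lambda>f. concat (map (pair_word D) (map f is))) (pmf_of_set (inj_lvl q))))"
  using word_eq_decode_idx[of q "Suc h"]
  by (simp del: idx.simps add: idx_Suc map_bind_pmf pmf.map_comp o_def decode_flat)

section \<open>Coinciding labels and blocks determined by other blocks\<close>

lemma k_sq_ge_4: "4 \<le> (k q)\<^sup>2"
  using power_mono[OF k_ge_2[of q], of 2] by simp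

lemma prob_inj_lvl:
  assumes "distinct as" "set as \<subseteq> {1..k (Suc q)}" "length as < (k q)\<^sup>2" "finite T"
  shows "measure_pmf.prob (pmf_of_set (inj_lvl q)) {f. map f as \<in> T}
     \<le> card T / ((real (k q))\<^sup>2 - length as) ^ length as"
  using prob_injections_le[OF finite_box k_le_card_box assms(1,2) _ assms(4)] assms(3)
  by (simp add: card_box)

text \<open>Only the \<open>k q\<close> diagonal pairs are favourable out of
  \<open>(k q)\<^sup>2\<close>. The constant 4 is generous here and matches the case of two
  different pairs.\<close>

lemma prob_sibling_collision:
  assumes a: "a \<in> {1..k (Suc q)}"
  shows "measure_pmf.prob (pmf_of_set (inj_lvl q)) {f. fst (f a) = snd (f a)} \<le> 4 / k q"
proof -
  let ?T = "(\<lambda>l. [(l, l)]) ` {1..k q}"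
  have "measure_pmf.prob (pmf_of_set (inj_lvl q)) {f. fst (f a) = snd (f a)}
      \<le> measure_pmf.prob (pmf_of_set (inj_lvl q)) {f. map f [a] \<in> ?T}"
  proof (rule prob_pmf_mono)
    fix f assume "f \<in> set_pmf (pmf_of_set (inj_lvl q))" and e: "f \<in> {f. fst (f a) = snd (f a)}"
    then have "f a \<in> box q" using a inj_lvl_mem set_inj_lvl by blast
    then have "f a = (fst (f a), fst (f a))" "fst (f a) \<in> {1..k q}"
      using e by (auto simp: box_def prod_eq_iff)
    then show "f \<in> {f. map f [a] \<in> ?T}" by auto
  qed
  also have "\<dots> \<le> card ?T / ((real (k q))\<^sup>2 - length [a]) ^ length [a]"
    by (rule prob_inj_lvl) (use a k_sq_ge_4[of q] in auto)
  also have "card ?T = k q" by (subst card_image) (auto simp: inj_on_def)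
  also have "k q / ((real (k q))\<^sup>2 - length [a]) ^ length [a] \<le> 4 / k q"
  proof -
    define r where "r = real (k q)"
    have "r \<ge> 2" using k_ge_2[of q] by (simp add: r_def)
    then have "r\<^sup>2 \<ge> 4" using power_mono[of 2 r 2] by simp
    then have "r / (r\<^sup>2 - 1) \<le> 4 / r"
      using \<open>r \<ge> 2\<close> by (simp add: divide_simps) (simp add: power2_eq_square algebra_simps)
    then show ?thesis by (simp add: r_def)
  qed
  finally show ?thesis .
qed

text \<open>The first pair is free and one coordinate of the second is forced, which leaves
  \<open>(k q)\<^sup>2 * k q\<close> favourable values out of about
  \<open>(k q) ^ 4\<close>.\<close>

lemma prob_cousin_collision:
  assumes a: "a \<in> {1..k (Suc q)}" "a' \<in> {1..k (Suc q)}" "a \<noteq> a'"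
    and c: "c \<in> {fst, snd}" "c' \<in> {fst, snd}"
  shows "measure_pmf.prob (pmf_of_set (inj_lvl q)) {f. c (f a) = c' (f a')} \<le> 4 / k q"
proof -
  let ?g = "\<lambda>(b, x). [b, if c' = fst then (c b, x) else (x, c b)]"
  let ?T = "?g ` (box q \<times> {1..k q})"
  have fT: "finite ?T" using finite_box by auto
  have "measure_pmf.prob (pmf_of_set (inj_lvl q)) {f. c (f a) = c' (f a')}
      \<le> measure_pmf.prob (pmf_of_set (inj_lvl q)) {f. map f [a, a'] \<in> ?T}"
  proof (rule prob_pmf_mono)
    fix f assume "f \<in> set_pmf (pmf_of_set (inj_lvl q))" and e: "f \<in> {f. c (f a) = c' (f a')}"
    then have b: "f a \<in> box q" "f a' \<in> box q" using a inj_lvl_mem set_inj_lvl by blast+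
    define x where "x = (if c' = fst then snd (f a') else fst (f a'))"
    have "x \<in> {1..k q}" using b by (auto simp: box_def x_def)
    moreover have "[f a, f a'] = ?g (f a, x)" using e c by (auto simp: x_def prod_eq_iff)
    ultimately have "[f a, f a'] \<in> ?T" using b(1) by blast
    then show "f \<in> {f. map f [a, a'] \<in> ?T}" by simp
  qed
  also have "\<dots> \<le> card ?T / ((real (k q))\<^sup>2 - length [a, a']) ^ length [a, a']"
    by (rule prob_inj_lvl[OF _ _ _ fT]) (use a k_sq_ge_4[of q] in auto)
  also have "\<dots> \<le> real ((k q)\<^sup>2 * k q) / ((real (k q))\<^sup>2 - 2) ^ 2"
  proof -
    have "card ?T \<le> card (box q \<times> {1..k q})" by (rule card_image_le) (use finite_box in auto)
    then have "card ?T \<le> (k q)\<^sup>2 * k q" by (simp add: card_cartesian_product card_box)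
    then have "real (card ?T) \<le> real ((k q)\<^sup>2 * k q)" by (rule of_nat_mono)
    moreover have "length [a, a'] = 2" by simp
    ultimately show ?thesis by (simp only: of_nat_numeral) (intro divide_right_mono, auto)
  qed
  also have "\<dots> \<le> 4 / k q"
  proof -
    define r where "r = real (k q)"
    have "r \<ge> 2" using k_ge_2[of q] by (simp add: r_def)
    then have r2: "r\<^sup>2 \<ge> 4" using power_mono[of 2 r 2] by simp
    \<comment> \<open>Squaring this inequality produces the constant 4, which is attained at
      \<open>r = 2\<close>.\<close>
    then have "r\<^sup>2 \<le> 2 * (r\<^sup>2 - 2)" by simp
    then have "(r\<^sup>2)\<^sup>2 \<le> (2 * (r\<^sup>2 - 2))\<^sup>2" using r2 by (intro power_mono) auto
    then have "r\<^sup>2 * r * r \<le> 4 * (r\<^sup>2 - 2)\<^sup>2" by (simp add: power2_eq_square algebra_simps)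
    moreover have "(r\<^sup>2 - 2)\<^sup>2 > 0" using r2 by auto
    ultimately have "r\<^sup>2 * r / (r\<^sup>2 - 2)\<^sup>2 \<le> 4 / r"
      using \<open>r \<ge> 2\<close> by (simp add: divide_simps)
    then show ?thesis by (simp add: r_def)
  qed
  finally show ?thesis .
qed

text \<open>Positions \<open>j\<close> and \<open>j'\<close> descend from \<open>j div 2\<close> and
  \<open>j' div 2\<close> one level up. Either distinct parents already carry the same label, which
  the induction bounds, or the children collide through the random injection at level
  \<open>q\<close>, at cost \<open>4 / k q\<close>. Positions with a common parent have no
  exceptional event.\<close>

lemma prob_collision:
  assumes "j < 2 ^ h" "j' < 2 ^ h" "j \<noteq> j'"
  shows "measure_pmf.prob (idx q h) {is. is ! j = is ! j'} \<le> (\<Sum>i<h. 4 / k (q + i))"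
  using assms
proof (induction h arbitrary: q j j')
  case 0 then show ?case by simp
next
  case (Suc h)
  let ?i = "j div 2" and ?i' = "j' div 2" and ?\<nu> = "idx (Suc q) h"
  let ?E = "if ?i = ?i' then {} else {is. is ! ?i = is ! ?i'}"
  have ii: "?i < 2 ^ h" "?i' < 2 ^ h" using Suc.prems by auto
  have E: "measure_pmf.prob ?\<nu> ?E \<le> (\<Sum>i<h. 4 / k (Suc q + i))"
    using Suc.IH[OF ii, of "Suc q"] by (cases "?i = ?i'") (auto intro!: sum_nonneg)
  have "measure_pmf.prob (idx q (Suc h)) {is. is ! j = is ! j'} \<le> measure_pmf.prob ?\<nu> ?E + 4 / k q"
    unfolding idx_Suc
  proof (rule prob_bind_pmf_le)
    fix js assume js: "js \<in> set_pmf ?\<nu>" "js \<notin> ?E"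
    have l: "length js = 2 ^ h" "set js \<subseteq> {1..k (Suc q)}" using set_idx[OF js(1)] by auto
    have mem: "js ! ?i \<in> {1..k (Suc q)}" "js ! ?i' \<in> {1..k (Suc q)}"
      using subsetD[OF l(2) nth_mem] l(1) ii by simp_all
    define c c' :: "nat \<times> nat \<Rightarrow> nat" where "c = (if even j then fst else snd)"
      and "c' = (if even j' then fst else snd)"
    have n: "flat (map f js) ! j = c (f (js ! ?i))" "flat (map f js) ! j' = c' (f (js ! ?i'))" for f
      using Suc.prems ii l(1) by (auto simp: flat_nth c_def c'_def)
    have "measure_pmf.prob (pmf_of_set (inj_lvl q)) {f. c (f (js ! ?i)) = c' (f (js ! ?i'))} \<le> 4 / k q"
    proof (cases "?i = ?i'")
      case True
      then have "(c, c') \<in> {(fst, snd), (snd, fst)}"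
        using Suc.prems(3) unfolding c_def c'_def by (auto elim!: evenE oddE)
      then have "{f. c (f (js ! ?i)) = c' (f (js ! ?i'))} = {f. fst (f (js ! ?i)) = snd (f (js ! ?i))}"
        using True by auto
      then show ?thesis using prob_sibling_collision[OF mem(1)] by simp
    next
      case False
      then show ?thesis using js(2) mem by (intro prob_cousin_collision) (auto simp: c_def c'_def)
    qed
    then show "measure_pmf.prob (map_pmf (\<lambda>f. flat (map f js)) (pmf_of_set (inj_lvl q))) {is. is ! j = is ! j'} \<le> 4 / k q"
      unfolding measure_map_pmf vimage_def mem_Collect_eq n .
  qed simp
  then show ?case using E by (simp add: sum.lessThan_Suc_shift del: sum.lessThan_Suc)
qed

text \<open>\<open>R\<close> leaves at most one value of \<open>f a\<close> for given values at
  \<open>as\<close>, which removes one factor \<open>(k q)\<^sup>2\<close> from the number of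
  favourable tuples.\<close>

lemma prob_relation:
  assumes a: "distinct (a # as)" "set (a # as) \<subseteq> {1..k (Suc q)}" "length as \<in> {1, 2}"
    and R: "\<And>b b' bs. b \<in> box q \<Longrightarrow> b' \<in> box q \<Longrightarrow> set bs \<subseteq> box q \<Longrightarrow> length bs = length as
              \<Longrightarrow> R b bs \<Longrightarrow> R b' bs \<Longrightarrow> b = b'"
  shows "measure_pmf.prob (pmf_of_set (inj_lvl q)) {f. R (f a) (map f as)} \<le> 64 / (real (k q))\<^sup>2"
proof -
  let ?J = "length as"
  let ?Bs = "{bs. set bs \<subseteq> box q \<and> length bs = ?J}"
  let ?T = "{b # bs | b bs. b \<in> box q \<and> bs \<in> ?Bs \<and> R b bs}"
  have fB: "finite ?Bs" using finite_lists_length_eq[OF finite_box] by simp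
  have inj: "inj_on tl ?T" using R by (auto simp: inj_on_def)
  have im: "tl ` ?T \<subseteq> ?Bs" by auto
  have fT: "finite ?T" using inj_on_finite[OF inj im fB] .
  have cT: "card ?T \<le> ((k q)\<^sup>2) ^ ?J"
    using card_inj_on_le[OF inj im fB] card_lists_length_eq[OF finite_box, of q ?J] by (simp add: card_box)
  have "measure_pmf.prob (pmf_of_set (inj_lvl q)) {f. R (f a) (map f as)}
      \<le> measure_pmf.prob (pmf_of_set (inj_lvl q)) {f. map f (a # as) \<in> ?T}"
  proof (rule prob_pmf_mono)
    fix f assume "f \<in> set_pmf (pmf_of_set (inj_lvl q))" and e: "f \<in> {f. R (f a) (map f as)}"
    then have "f b \<in> box q" if "b \<in> set (a # as)" for b
      using a(2) that inj_lvl_mem set_inj_lvl by blast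
    then have "f a \<in> box q" "map f as \<in> ?Bs" by auto
    then have "f a # map f as \<in> ?T" using e by blast
    then show "f \<in> {f. map f (a # as) \<in> ?T}" by simp
  qed
  also have "\<dots> \<le> card ?T / ((real (k q))\<^sup>2 - length (a # as)) ^ length (a # as)"
    by (rule prob_inj_lvl[OF a(1,2) _ fT]) (use a(3) k_sq_ge_4[of q] in auto)
  also have "\<dots> \<le> ((real (k q))\<^sup>2) ^ ?J / ((real (k q))\<^sup>2 - length (a # as)) ^ length (a # as)"
  proof (rule divide_right_mono)
    show "real (card ?T) \<le> ((real (k q))\<^sup>2) ^ ?J" using of_nat_mono[OF cT, where 'a=real] by simp
    have "real (length (a # as)) \<le> real ((k q)\<^sup>2)"
      using a(3) k_sq_ge_4[of q] by (intro of_nat_mono) auto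
    then show "0 \<le> ((real (k q))\<^sup>2 - length (a # as)) ^ length (a # as)" by simp
  qed
  also have "\<dots> \<le> 64 / (real (k q))\<^sup>2"
  proof -
    define N where "N = (real (k q))\<^sup>2"
    have N: "N \<ge> 4" using of_nat_mono[OF k_sq_ge_4[of q], where 'a=real] by (simp add: N_def)
    have "N ^ ?J / (N - (?J + 1)) ^ (?J + 1) \<le> 64 / N"
    proof -
      \<comment> \<open>Uses \<open>N \<ge> 4\<close> and at most three arguments; the third power
        of 4 is the constant 64.\<close>
      have "N \<le> 4 * (N - (?J + 1))" using a(3) N by auto
      then have "N ^ (?J + 1) \<le> (4 * (N - (?J + 1))) ^ (?J + 1)" using N by (intro power_mono) auto
      also have "\<dots> = 4 ^ (?J + 1) * (N - (?J + 1)) ^ (?J + 1)" by (rule power_mult_distrib)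
      also have "\<dots> \<le> 64 * (N - (?J + 1)) ^ (?J + 1)" using a(3) N by (intro mult_right_mono) auto
      finally have "N ^ ?J * N \<le> 64 * (N - (?J + 1)) ^ (?J + 1)" by (simp only: power_add power_one_right)
      moreover have "(N - (?J + 1)) ^ (?J + 1) > 0" using a(3) N by (intro zero_less_power) auto
      ultimately show ?thesis using N by (simp add: divide_simps)
    qed
    moreover have "real (length (a # as)) = real ?J + 1" "length (a # as) = ?J + 1" by simp_all
    ultimately show ?thesis by (simp only: N_def)
  qed
  finally show ?thesis .
qed

text \<open>A block that repeats earlier text at distance \<open>d\<close> is determined by at most two other blocks:
  those covering its translate, or (if \<open>d\<close> is smaller than the block length) by its predecessor and
  periodicity.\<close>

lemma prob_shifted_block:
  fixes h q :: nat
  defines "L \<equiv> 2 ^ Suc q"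
  assumes j: "j < 2 ^ h" and d: "1 \<le> d" "d \<le> j * L"
  shows "measure_pmf.prob (word (Suc q + h)) {u. \<forall>t<L. u ! (j * L + t) = u ! (j * L + t - d)}
     \<le> 2 * (\<Sum>i<h. 4 / k (Suc q + i)) + 64 / (real (k q))\<^sup>2"
proof -
  \<comment> \<open>The text at distance \<open>d\<close> to the left of block \<open>j\<close>
    starts at offset \<open>s\<close> of block \<open>j1\<close> and may run into block
    \<open>j1 + 1\<close>. If the latter is block \<open>j\<close> itself (case \<open>p\<close>),
    the copy may overlap its source, and \<open>j2\<close> falls back to \<open>j1\<close>.\<close>
  define j1 where "j1 = (j * L - d) div L"
  define s where "s = (j * L - d) mod L"
  define p where "p \<longleftrightarrow> j1 + 1 = j"
  define j2 where "j2 = (if p then j1 else j1 + 1)"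
  have L: "L > 0" by (simp add: L_def)
  have e: "j * L - d = j1 * L + s" and s: "s < L" using L by (auto simp: j1_def s_def)
  have "j1 * L < j * L" using e d L by linarith
  then have j1: "j1 < j" by simp
  then have j2: "j2 < j" by (auto simp: j2_def p_def)
  let ?P = "measure_pmf.prob"
  let ?S = "(\<Sum>i<h. 4 / k (Suc q + i))"
  \<comment> \<open>Off these two events the label of block \<open>j\<close> differs from those of
    its source blocks, as \<open>prob_relation\<close> requires.\<close>
  let ?E = "{is. is ! j = is ! j1} \<union> {is. is ! j = is ! j2}"
  have EE: "?P (idx (Suc q) h) ?E \<le> ?S + ?S"
    by (rule order_trans[OF measure_Un_le], simp, simp)
       (intro add_mono prob_collision, use j j1 j2 in auto)
  have "?P (word (Suc q + h)) {u. \<forall>t<L. u ! (j * L + t) = u ! (j * L + t - d)}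
    \<le> ?P (dict q) {} + (?S + ?S + 64 / (real (k q))\<^sup>2)"
    unfolding word_Suc
  proof (rule prob_bind_pmf_le)
    fix D assume D: "D \<in> set_pmf (dict q)"
    note pw = pair_word[OF set_dict[OF D], folded L_def]
    have "?P (bind_pmf (idx (Suc q) h) (\<lambda>is. map_pmf (\<lambda>f. concat (map (pair_word D) (map f is))) (pmf_of_set (inj_lvl q))))
       {u. \<forall>t<L. u ! (j * L + t) = u ! (j * L + t - d)} \<le> ?P (idx (Suc q) h) ?E + 64 / (real (k q))\<^sup>2"
    proof (rule prob_bind_pmf_le)
      fix js assume js: "js \<in> set_pmf (idx (Suc q) h)" "js \<notin> ?E"
      have l: "length js = 2 ^ h" "set js \<subseteq> {1..k (Suc q)}" using set_idx[OF js(1)] by auto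
      have mem: "js ! i \<in> {1..k (Suc q)}" if "i \<le> j" for i
        using subsetD[OF l(2) nth_mem[of i js]] l(1) that j by simp
      \<comment> \<open>The two source labels may coincide, and then impose only one argument of the
        injection.\<close>
      let ?as = "remdups [js ! j1, js ! j2]"
      define R where "R b bs \<longleftrightarrow> (\<forall>t<L. pair_word D b ! t =
          (pair_word D (hd bs) @ (if p then pair_word D b else pair_word D (last bs))) ! (s + t))" for b bs
      have "?P (pmf_of_set (inj_lvl q)) {f. R (f (js ! j)) (map f ?as)} \<le> 64 / (real (k q))\<^sup>2"
      proof (rule prob_relation)
        show "distinct (js ! j # ?as)" using js(2) by auto
        show "set (js ! j # ?as) \<subseteq> {1..k (Suc q)}" using mem j1 j2 by auto
        show "length ?as \<in> {1, 2}" by auto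
        fix b b' bs assume b: "b \<in> box q" "b' \<in> box q" and bs: "set bs \<subseteq> box q" "length bs = length ?as"
          and Rb: "R b bs" "R b' bs"
        have "bs \<noteq> []" using bs(2) by (auto split: if_splits)
        then have h: "length (pair_word D (hd bs)) = L" using bs(1) pw(1) by (cases bs) auto
        have lb: "length (pair_word D b) = L" "length (pair_word D b') = L" using pw(1) b by auto
        \<comment> \<open>In the overlapping case the letter \<open>t\<close> of the block copies
          its own letter \<open>s + t - L\<close>, an earlier one since \<open>s < L\<close>. So
          strong induction on \<open>t\<close> recovers the whole block.\<close>
        have "pair_word D b ! t = pair_word D b' ! t" if "t < L" for t
          using that
        proof (induction t rule: less_induct)
          case (less t)
          show ?case
          proof (cases "p \<and> L \<le> s + t")
            case True
            have "pair_word D b ! t = pair_word D b ! (s + t - L)"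
              using Rb(1) less.prems True h by (auto simp: R_def nth_append)
            moreover have "pair_word D b' ! t = pair_word D b' ! (s + t - L)"
              using Rb(2) less.prems True h by (auto simp: R_def nth_append)
            moreover have "s + t - L < t" using s True less.prems by linarith
            ultimately show ?thesis using less.IH[of "s + t - L"] less.prems by simp
          next
            case False
            then show ?thesis using Rb less.prems h lb by (auto simp: R_def nth_append)
          qed
        qed
        then have "pair_word D b = pair_word D b'" using lb by (intro nth_equalityI) auto
        then show "b = b'" using inj_onD[OF pw(2)] b by blast
      qed
      moreover have "?P (map_pmf (\<lambda>f. concat (map (pair_word D) (map f js))) (pmf_of_set (inj_lvl q)))
          {u. \<forall>t<L. u ! (j * L + t) = u ! (j * L + t - d)} \<le>
         ?P (pmf_of_set (inj_lvl q)) {f. R (f (js ! j)) (map f ?as)}"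
        unfolding measure_map_pmf
      proof (rule prob_pmf_mono)
        fix f assume "f \<in> set_pmf (pmf_of_set (inj_lvl q))"
          and f: "f \<in> (\<lambda>f. concat (map (pair_word D) (map f js))) -` {u. \<forall>t<L. u ! (j * L + t) = u ! (j * L + t - d)}"
        then have fi: "f \<in> inj_lvl q" using set_inj_lvl by blast
        let ?u = "concat (map (pair_word D) (map f js))"
        have len: "length (pair_word D a) = L" if "a \<in> set (map f js)" for a
          using that pw(1)[OF inj_lvl_mem[OF fi subsetD[OF l(2)]]] by (auto simp only: set_map)
        have nth: "?u ! (i * L + t) = pair_word D (f (js ! i)) ! t" if "i \<le> j" "t < L" for i t
          using concat_map_nth[of "map f js" "pair_word D" L i t] len that l(1) j by auto
        have hd: "hd (map f ?as) = f (js ! j1)" and la: "last (map f ?as) = f (js ! j2)" by auto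
        have lj: "length (pair_word D (f (js ! i))) = L" if "i \<le> j" for i
          using l(1) that j by (intro len) auto
        have "R (f (js ! j)) (map f ?as)"
          unfolding R_def hd la
        proof (intro allI impI)
          fix t assume t: "t < L"
          have "pair_word D (f (js ! j)) ! t = ?u ! (j * L + t)" using nth[of j t] t by simp
          also have "\<dots> = ?u ! (j * L + t - d)" using f t by blast
          also have "j * L + t - d = j1 * L + (s + t)" using e d by linarith
          also have "?u ! (j1 * L + (s + t)) = (pair_word D (f (js ! j1)) @ (if p then pair_word D (f (js ! j)) else pair_word D (f (js ! j2)))) ! (s + t)"
          proof (cases "s + t < L")
            case True
            then show ?thesis using nth[of j1 "s + t"] j1 lj[of j1] by (simp add: nth_append)
          next
            case False
            have "j1 * L + (s + t) = (j1 + 1) * L + (s + t - L)" using False by (simp add: algebra_simps)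
            moreover have "?u ! ((j1 + 1) * L + (s + t - L)) = pair_word D (f (js ! (j1 + 1))) ! (s + t - L)"
              using j1 s t by (intro nth) auto
            ultimately show ?thesis using False lj[of j1] j1 by (auto simp: nth_append j2_def p_def)
          qed
          finally show "pair_word D (f (js ! j)) ! t = \<dots>" .
        qed
        then show "f \<in> {f. R (f (js ! j)) (map f ?as)}" by simp
      qed
      ultimately show "?P (map_pmf (\<lambda>f. concat (map (pair_word D) (map f js))) (pmf_of_set (inj_lvl q)))
          {u. \<forall>t<L. u ! (j * L + t) = u ! (j * L + t - d)} \<le> 64 / (real (k q))\<^sup>2" by linarith
    qed simp
    then show "?P (bind_pmf (idx (Suc q) h) (\<lambda>is. map_pmf (\<lambda>f. concat (map (pair_word D) (map f is))) (pmf_of_set (inj_lvl q))))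
       {u. \<forall>t<L. u ! (j * L + t) = u ! (j * L + t - d)} \<le> ?S + ?S + 64 / (real (k q))\<^sup>2" using EE by linarith
  qed (auto intro!: add_nonneg_nonneg sum_nonneg)
  then show ?thesis by simp
qed

section \<open>Repetitions and likelihoods of windows in a random word\<close>

lemma length_word: "u \<in> set_pmf (word n) \<Longrightarrow> length u = 2 ^ n \<and> set u \<subseteq> {1..k 0}"
  using range_nonempty set_dict by (fastforce simp: word_def wf_dict_def)

text \<open>A repeated stretch of length at least \<open>2 * L\<close> contains a complete aligned
  block, which therefore copies the text at distance \<open>b - a\<close>. The factor
  \<open>m\<close> squared is the union over the pairs of positions.\<close>

lemma prob_has_rep:
  fixes h q :: nat
  defines "L \<equiv> 2 ^ Suc q"
  assumes m: "i + m \<le> 2 ^ (Suc q + h)" and l: "2 * L \<le> l"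
  shows "measure_pmf.prob (word (Suc q + h)) {u. has_rep l (take m (drop i u))}
     \<le> (real m)\<^sup>2 * (2 * (\<Sum>i<h. 4 / k (Suc q + i)) + 64 / (real (k q))\<^sup>2)"
proof -
  let ?P = "measure_pmf.prob (word (Suc q + h))"
  let ?b = "2 * (\<Sum>i<h. 4 / k (Suc q + i)) + 64 / (real (k q))\<^sup>2"
  \<comment> \<open>Rounding up: the first block that starts at or after position
    \<open>i + b\<close>.\<close>
  define J where "J b = (i + b + L - 1) div L" for b
  define A where "A = (\<lambda>(a, b). {u. \<forall>t<L. u ! (J b * L + t) = (u ! (J b * L + t - (b - a)) :: nat)})"
  let ?I = "{(a, b). a < b \<and> b + l \<le> m}"
  have L: "L > 0" by (simp add: L_def)
  have J: "i + b \<le> J b * L" "J b * L + L \<le> i + b + 2 * L" for b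
  proof -
    have "J b * L + (i + b + L - 1) mod L = i + b + L - 1" by (simp add: J_def)
    moreover have "(i + b + L - 1) mod L < L" using L by simp
    ultimately show "i + b \<le> J b * L" "J b * L + L \<le> i + b + 2 * L" by linarith+
  qed
  have sub: "?I \<subseteq> {..<m} \<times> {..<m}" using L l by auto
  then have fI: "finite ?I" by (rule finite_subset) auto
  have cI: "card ?I \<le> m * m" using card_mono[OF _ sub] by (simp add: card_cartesian_product)
  have "?P {u. has_rep l (take m (drop i u))} \<le> ?P (\<Union>x\<in>?I. A x)"
  proof (rule prob_pmf_mono)
    fix u assume u: "u \<in> set_pmf (word (Suc q + h))" "u \<in> {u. has_rep l (take m (drop i u))}"
    let ?x = "take m (drop i u)"
    have "length u = 2 ^ (Suc q + h)" using length_word[OF u(1)] by simp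
    then have lx: "length ?x = m" using m by simp
    obtain a b where ab: "a < b" "b + l \<le> m" "take l (drop a ?x) = take l (drop b ?x)"
      using u(2) lx by (auto simp: has_rep_def)
    have "u ! (J b * L + t) = u ! (J b * L + t - (b - a))" if t: "t < L" for t
    proof -
      define r where "r = J b * L + t - (i + b)"
      have r: "r < l" using J[of b] t l by (simp add: r_def)
      have "u ! (i + (b + r)) = take l (drop b ?x) ! r" using r ab(1,2) lx by (simp add: add.assoc)
      also have "\<dots> = take l (drop a ?x) ! r" using ab(3) by simp
      also have "\<dots> = u ! (i + (a + r))" using r ab(1,2) lx by (simp add: add.assoc)
      also have "i + (b + r) = J b * L + t" using J[of b] by (simp add: r_def)
      also have "i + (a + r) = J b * L + t - (b - a)" using J[of b] ab(1) by (simp add: r_def)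
      finally show ?thesis .
    qed
    then have "u \<in> A (a, b)" by (simp add: A_def)
    then show "u \<in> (\<Union>x\<in>?I. A x)" using ab by blast
  qed
  also have "\<dots> \<le> (\<Sum>x\<in>?I. ?P (A x))"
    by (rule measure_pmf.finite_measure_subadditive_finite[OF fI]) simp
  also have "\<dots> \<le> (\<Sum>x\<in>?I. ?b)"
  proof (rule sum_mono)
    fix x assume "x \<in> ?I"
    then obtain a b where x: "x = (a, b)" "a < b" "b + l \<le> m" by auto
    have "J b * L + L \<le> L * 2 ^ h" using J[of b] x l m by (simp add: L_def power_add)
    then have "J b * L < 2 ^ h * L" using L unfolding mult.commute[of L] by linarith
    then have "J b < 2 ^ h" by simp
    moreover have "b - a \<le> J b * L" using J[of b] by linarith
    ultimately show "?P (A x) \<le> ?b"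
      using prob_shifted_block[of "J b" h "b - a" q] x unfolding A_def L_def by simp
  qed
  also have "\<dots> = card ?I * ?b" by simp
  also have "\<dots> \<le> (real m)\<^sup>2 * ?b"
  proof (rule mult_right_mono)
    show "real (card ?I) \<le> (real m)\<^sup>2"
      using of_nat_mono[OF cI, where 'a=real] by (simp add: power2_eq_square)
    show "0 \<le> ?b" by (intro add_nonneg_nonneg mult_nonneg_nonneg sum_nonneg) auto
  qed
  finally show ?thesis .
qed

text \<open>The window contains \<open>J\<close> complete consecutive blocks; one unit is subtracted
  for the partial block at its start. If their labels one level up are distinct, \<open>x\<close>
  dictates the injection at \<open>J\<close> different arguments. If two labels agree, equal blocks
  would form a repetition in \<open>x\<close>, so the event is empty.\<close>

lemma prob_nonrepetitive_window:
  fixes h q m :: nat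
  defines "L \<equiv> 2 ^ Suc q"
  defines "J \<equiv> m div L - 1"
  assumes x: "length x = m" "\<not> has_rep L x" and m: "i + m \<le> 2 ^ (Suc q + h)" and J: "J < (k q)\<^sup>2"
  shows "measure_pmf.prob (word (Suc q + h)) {u. take m (drop i u) = x} \<le> 1 / ((real (k q))\<^sup>2 - J) ^ J"
proof (cases "J = 0")
  case True then show ?thesis by simp
next
  case False
  let ?P = "measure_pmf.prob" and ?b = "1 / ((real (k q))\<^sup>2 - J) ^ J"
  have L: "L > 0" by (simp add: L_def)
  have b0: "?b \<ge> 0" using J of_nat_mono[of J "(k q)\<^sup>2", where 'a=real] by simp
  define j0 where "j0 = (i + L - 1) div L"
  have "j0 * L + (i + L - 1) mod L = i + L - 1" by (simp add: j0_def)
  moreover have "(i + L - 1) mod L < L" using L by simp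
  ultimately have j0: "i \<le> j0 * L" "j0 * L < i + L" by linarith+
  have "(J + 1) * L \<le> m" using False by (simp add: J_def)
  then have jm: "(j0 + t) * L + L \<le> i + m" if "t < J" for t
  proof -
    have "(t + 1) * L \<le> J * L" using that by (intro mult_le_mono1) simp
    then have "t * L + L \<le> J * L" by (simp only: add_mult_distrib nat_mult_1)
    moreover have "J * L + L \<le> m" using \<open>(J + 1) * L \<le> m\<close> by (simp only: add_mult_distrib nat_mult_1)
    ultimately show ?thesis using j0 by (simp add: add_mult_distrib)
  qed
  have ij: "i \<le> (j0 + t) * L" for t using j0 by (simp add: add_mult_distrib)
  have jh: "j0 + t < 2 ^ h" if "t < J" for t
  proof -
    have "(j0 + t) * L + L \<le> 2 ^ h * L" using jm[OF that] m by (simp add: L_def power_add mult.commute)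
    then have "(j0 + t) * L < 2 ^ h * L" using L by linarith
    then show ?thesis by simp
  qed
  have "?P (word (Suc q + h)) {u. take m (drop i u) = x} \<le> ?P (dict q) {} + ?b"
    unfolding word_Suc
  proof (rule prob_bind_pmf_le[OF _ b0])
    fix D assume D: "D \<in> set_pmf (dict q)"
    note pw = pair_word[OF set_dict[OF D], folded L_def]
    have "?P (bind_pmf (idx (Suc q) h) (\<lambda>is. map_pmf (\<lambda>f. concat (map (pair_word D) (map f is))) (pmf_of_set (inj_lvl q))))
       {u. take m (drop i u) = x} \<le> ?P (idx (Suc q) h) {} + ?b"
    proof (rule prob_bind_pmf_le[OF _ b0])
      fix js assume js: "js \<in> set_pmf (idx (Suc q) h)"
      have l: "length js = 2 ^ h" "set js \<subseteq> {1..k (Suc q)}" using set_idx[OF js] by auto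
      define as where "as = map (\<lambda>t. js ! (j0 + t)) [0..<J]"
      have mem: "set as \<subseteq> {1..k (Suc q)}"
      proof
        fix a assume "a \<in> set as"
        then obtain t where "t < J" "a = js ! (j0 + t)" by (auto simp: as_def)
        then show "a \<in> {1..k (Suc q)}" using subsetD[OF l(2) nth_mem[of "j0 + t" js]] l(1) jh by simp
      qed
      let ?w = "\<lambda>t. take L (drop ((j0 + t) * L - i) x)"
      have blk: "pair_word D (f (js ! (j0 + t))) = ?w t"
        if "f \<in> inj_lvl q" "take m (drop i (concat (map (pair_word D) (map f js)))) = x" "t < J" for f t
      proof -
        have len: "length (pair_word D a) = L" if "a \<in> set (map f js)" for a
          using that pw(1)[OF inj_lvl_mem[OF \<open>f \<in> inj_lvl q\<close> subsetD[OF l(2)]]]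
          by (auto simp only: set_map)
        have "?w t = pair_word D (map f js ! (j0 + t))"
          by (rule block_of_window[OF len that(2)[symmetric]])
            (use m ij jm[OF that(3)] jh[OF that(3)] l(1) in \<open>auto simp: L_def power_add\<close>)
        then show ?thesis using l(1) jh[OF that(3)] by simp
      qed
      have "?P (pmf_of_set (inj_lvl q)) {f. take m (drop i (concat (map (pair_word D) (map f js)))) = x} \<le> ?b"
      proof (cases "distinct as")
        case True
        let ?T = "{bs. set bs \<subseteq> box q \<and> length bs = J \<and> map (pair_word D) bs = map ?w [0..<J]}"
        have T1: "bs = bs'" if "bs \<in> ?T" "bs' \<in> ?T" for bs bs'
        proof -
          have "map (pair_word D) bs = map (pair_word D) bs'" using that by simp
          moreover have "inj_on (pair_word D) (set bs \<union> set bs')"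
            using that by (intro inj_on_subset[OF pw(2)]) auto
          ultimately show ?thesis by (rule map_inj_on)
        qed
        have fT: "finite ?T"           by (rule finite_subset[OF _ finite_lists_length_eq[OF finite_box, of q J]]) auto
        have cT: "card ?T \<le> 1" using T1 by (intro card_le_Suc0_iff_eq[OF fT, THEN iffD2, folded One_nat_def]) blast
        have "?P (pmf_of_set (inj_lvl q)) {f. take m (drop i (concat (map (pair_word D) (map f js)))) = x}
            \<le> ?P (pmf_of_set (inj_lvl q)) {f. map f as \<in> ?T}"
        proof (rule prob_pmf_mono)
          fix f assume "f \<in> set_pmf (pmf_of_set (inj_lvl q))"
            and f: "f \<in> {f. take m (drop i (concat (map (pair_word D) (map f js)))) = x}"
          then have fi: "f \<in> inj_lvl q" using set_inj_lvl by blast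
          have "map (pair_word D) (map f as) = map ?w [0..<J]"
            using blk[OF fi] f by (simp add: as_def)
          moreover have "set (map f as) \<subseteq> box q" using mem inj_lvl_mem[OF fi] by auto
          ultimately show "f \<in> {f. map f as \<in> ?T}" by (simp add: as_def)
        qed
        also have "\<dots> \<le> card ?T / ((real (k q))\<^sup>2 - length as) ^ length as"
          using prob_inj_lvl[OF True mem _ fT] J by (simp add: as_def)
        also have "\<dots> = card ?T * ?b" by (simp add: as_def)
        also have "\<dots> \<le> 1 * ?b" using cT by (intro mult_right_mono b0) simp
        finally show ?thesis by simp
      next
        case False
        then obtain t t' where t: "t < t'" "t' < J" "js ! (j0 + t) = js ! (j0 + t')"
          by (auto simp: as_def distinct_conv_nth linorder_neq_iff)
        have "?P (pmf_of_set (inj_lvl q)) {f. take m (drop i (concat (map (pair_word D) (map f js)))) = x}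
            \<le> ?P (pmf_of_set (inj_lvl q)) {}"
        proof (rule prob_pmf_mono)
          fix f assume "f \<in> set_pmf (pmf_of_set (inj_lvl q))"
            and f: "f \<in> {f. take m (drop i (concat (map (pair_word D) (map f js)))) = x}"
          then have fi: "f \<in> inj_lvl q" using set_inj_lvl by blast
          have "?w t = ?w t'" using blk[OF fi, of t] blk[OF fi, of t'] f t by simp
          moreover have "(j0 + t) * L - i < (j0 + t') * L - i"
          proof -
            have "(j0 + t) * L < (j0 + t') * L" using t L by simp
            then show ?thesis using ij[of t] by linarith
          qed
          moreover have "(j0 + t') * L - i + L \<le> length x" using jm[OF t(2)] ij[of t'] x by linarith
          ultimately have "has_rep L x" unfolding has_rep_def by blast
          then show "f \<in> {}" using x by simp
        qed
        also have "\<dots> \<le> ?b" using b0 by (simp only: measure_empty)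
        finally show ?thesis .
      qed
      then show "?P (map_pmf (\<lambda>f. concat (map (pair_word D) (map f js))) (pmf_of_set (inj_lvl q)))
          {u. take m (drop i u) = x} \<le> ?b"
        unfolding measure_map_pmf vimage_def by simp
    qed
    then show "?P (bind_pmf (idx (Suc q) h) (\<lambda>is. map_pmf (\<lambda>f. concat (map (pair_word D) (map f is))) (pmf_of_set (inj_lvl q))))
       {u. take m (drop i u) = x} \<le> ?b" by simp
  qed
  then show ?thesis by simp
qed

end

section \<open>The stationary mean as a limit over random words\<close>

lemma length_prefix [simp]: "length (prefix m \<omega>) = m"
  by (simp add: prefix_def)

lemma prefix_eq_iff: "prefix m \<omega> = x \<longleftrightarrow> length x = m \<and> (\<forall>i<m. \<omega> i = x ! i)"
proof
  assume "prefix m \<omega> = x"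
  then show "length x = m \<and> (\<forall>i<m. \<omega> i = x ! i)" by (auto simp: prefix_def)
next
  assume "length x = m \<and> (\<forall>i<m. \<omega> i = x ! i)"
  then show "prefix m \<omega> = x" by (intro nth_equalityI) (auto simp: prefix_def)
qed

lemma cyl_iff: "\<omega> \<in> cyl x \<longleftrightarrow> prefix (length x) \<omega> = x"
  by (simp add: cyl_def prefix_eq_iff)

lemma prefix_mem_cyl: "\<omega> \<in> cyl (prefix m \<omega>)"
  by (simp add: cyl_iff)

context rha
begin

lemma map_fst_rha_state: "map_pmf fst (rha_state k n) = dict n"
proof (induction n)
  case 0
  show ?case by (simp add: pmf.map_comp o_def)
next
  case (Suc n)
  have "map_pmf fst (rha_state k (Suc n)) =
     bind_pmf (rha_state k n) (\<lambda>p. map_pmf (new_dict (fst p)) (pmf_of_set (subsets_lvl k (Suc n))))"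
    by (simp add: map_bind_pmf pmf.map_comp o_def case_prod_beta map_pmf_def[symmetric])
  also have "\<dots> = dict (Suc n)" by (simp add: Suc[symmetric] bind_map_pmf)
  finally show ?case .
qed

lemma length_rha_state: "p \<in> set_pmf (rha_state k n) \<Longrightarrow> length (snd p) = 2 ^ Suc n - 1"
proof (induction n arbitrary: p)
  case 0
  then show ?case by auto
next
  case (Suc n)
  obtain p0 S c where p0: "p0 \<in> set_pmf (rha_state k n)" and S: "S \<in> subsets_lvl k (Suc n)"
    and c: "c \<in> {1..k (Suc n)}" and p': "p = (new_dict (fst p0) S, snd p0 @ new_dict (fst p0) S ! (c - 1))"
    using Suc.prems unfolding rha_state.simps set_bind_pmf set_map_pmf case_prod_beta
      set_pmf_of_set[OF subsets_lvl_fin(2,1)] set_pmf_of_set[OF range_nonempty] by blast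
  obtain D w where Dw: "(D, w) \<in> set_pmf (rha_state k n)" and p: "p = (new_dict D S, w @ new_dict D S ! (c - 1))"
    using p0 p' by (metis prod.collapse)
  have "D \<in> set_pmf (dict n)" unfolding map_fst_rha_state[symmetric] using Dw by force
  then have "new_dict D S \<in> set_pmf (dict (Suc n))"
    using S subsets_lvl_fin[of n] by auto
  then have "wf_dict (k 0) (Suc n) (k (Suc n)) (new_dict D S)" by (rule set_dict)
  then have "length (new_dict D S ! (c - 1)) = 2 ^ Suc n"
    using c by (auto simp: wf_dict_def)
  then show ?case using Suc.IH[OF Dw] by (simp add: p)
qed

text \<open>The blocks of levels below \<open>n\<close> have total length
  \<open>2 ^ n - 1\<close>.\<close>

lemma map_last_block_rha_state:
  "map_pmf (\<lambda>p. drop (2 ^ n - 1) (snd p)) (rha_state k n) = word n"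
proof (cases n)
  case 0
  have "map_pmf (\<lambda>c. [c]) (pmf_of_set {1..k 0}) =
     map_pmf (\<lambda>c. map (\<lambda>j. [j]) [1..<k 0 + 1] ! (c - 1)) (pmf_of_set {1..k 0})"
    using range_nonempty[of 0] by (intro map_pmf_cong refl) auto
  then show ?thesis by (simp add: 0 word_def pmf.map_comp o_def bind_return_pmf)
next
  case (Suc n')
  let ?S = "pmf_of_set (subsets_lvl k (Suc n'))" and ?C = "pmf_of_set {1..k (Suc n')}"
  have "map_pmf (\<lambda>p. drop (2 ^ n - 1) (snd p)) (rha_state k n) =
     bind_pmf (rha_state k n') (\<lambda>p. bind_pmf ?S (\<lambda>S. map_pmf (\<lambda>c. drop (2 ^ n - 1) (snd p @ new_dict (fst p) S ! (c - 1))) ?C))"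
    by (simp add: Suc map_bind_pmf pmf.map_comp o_def case_prod_beta)
  also have "\<dots> = bind_pmf (rha_state k n') (\<lambda>p. bind_pmf ?S (\<lambda>S. map_pmf (\<lambda>c. new_dict (fst p) S ! (c - 1)) ?C))"
    by (intro bind_pmf_cong map_pmf_cong refl) (simp add: length_rha_state Suc)
  also have "\<dots> = bind_pmf (map_pmf fst (rha_state k n')) (\<lambda>D. bind_pmf ?S (\<lambda>S. map_pmf (\<lambda>c. new_dict D S ! (c - 1)) ?C))"
    by (simp add: bind_map_pmf)
  also have "\<dots> = word n"
    unfolding map_fst_rha_state by (simp add: Suc word_def bind_assoc_pmf bind_map_pmf)
  finally show ?thesis .
qed

text \<open>Consistency of the finite levels: deeper levels only append letters, so a window inside
  the first \<open>2 ^ Suc n - 1\<close> letters can be evaluated at level \<open>n\<close>.\<close>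

lemma map_take_rha_state:
  "map_pmf (\<lambda>p. take (2 ^ Suc n - 1) (snd p)) (rha_state k (n + d)) = map_pmf snd (rha_state k n)"
proof (induction d)
  case 0
  show ?case by (intro map_pmf_cong) (simp_all only: add_0_right length_rha_state take_all order_refl)
next
  case (Suc d)
  let ?t = "2 ^ Suc n - 1 :: nat"
  have *: "take ?t (snd p @ v) = take ?t (snd p)" if "p \<in> set_pmf (rha_state k (n + d))" for p and v :: "nat list"
  proof -
    have "(2::nat) ^ Suc n \<le> 2 ^ Suc (n + d)" by (intro power_increasing) auto
    then have "?t - length (snd p) = 0" unfolding length_rha_state[OF that] by linarith
    then show ?thesis by (simp only: take_append take_0 append_Nil2)
  qed
  have "map_pmf (\<lambda>p. take ?t (snd p)) (rha_state k (n + Suc d)) =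
     bind_pmf (rha_state k (n + d)) (\<lambda>p. bind_pmf (pmf_of_set (subsets_lvl k (Suc (n + d))))
       (\<lambda>S. map_pmf (\<lambda>c. take ?t (snd p @ new_dict (fst p) S ! (c - 1))) (pmf_of_set {1..k (Suc (n + d))})))"
    by (simp add: map_bind_pmf pmf.map_comp o_def case_prod_beta)
  also have "\<dots> = bind_pmf (rha_state k (n + d)) (\<lambda>p. return_pmf (take ?t (snd p)))"
    by (intro bind_pmf_cong refl) (simp only: * map_pmf_const bind_pmf_const)
  also have "\<dots> = map_pmf (\<lambda>p. take ?t (snd p)) (rha_state k (n + d))" by (simp only: map_pmf_def)
  finally show ?case using Suc.IH by (rule trans)
qed

definition window_prob :: "nat \<Rightarrow> nat \<Rightarrow> nat list \<Rightarrow> real" where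
  "window_prob n i x = measure_pmf.prob (word n) {u. take (length x) (drop i u) = x}"

lemma take_drop_second_half:
  fixes P :: nat
  assumes "i + m \<le> P" "1 \<le> P"
  shows "take m (drop (P + i - 1) w) = take m (drop i (drop (P - 1) (take (2 * P - 1) w)))"
proof -
  have "i + (P - 1) = P + i - 1" "2 * P - 1 - (P - 1) - i = P - i" "m \<le> P - i" using assms by auto
  then show ?thesis by (simp only: drop_take drop_drop take_take min.absorb1)
qed

text \<open>As \<open>2 ^ n - 1\<close> letters precede the block of level \<open>n\<close>, the
  1-based position \<open>2 ^ n + i\<close> is the 0-based offset \<open>i\<close> in that
  block.\<close>

lemma rha_prob_eq_window_prob:
  assumes "i + length x \<le> 2 ^ n"
  shows "rha_prob k (2 ^ n + i) x = window_prob n i x"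
proof -
  let ?m = "length x" and ?N = "2 ^ n + i + length x" and ?t = "2 ^ Suc n - 1 :: nat"
  have "n \<le> ?N" using less_exp[of n] by linarith
  then obtain d where d: "?N = n + d" using le_Suc_ex by blast
  have "rha_prob k (2 ^ n + i) x =
      measure_pmf.prob (rha_state k (n + d)) {p. take ?m (drop (2 ^ n + i - 1) (snd p)) = x}"
    unfolding rha_prob_def d[symmetric] ..
  also have "{p. take ?m (drop (2 ^ n + i - 1) (snd p)) = x} =
      (\<lambda>p. take ?t (snd p)) -` {w. take ?m (drop i (drop (2 ^ n - 1) w)) = x}"
  proof -
    have "take ?m (drop (2 ^ n + i - 1) w) = take ?m (drop i (drop (2 ^ n - 1) (take ?t w)))" for w :: "nat list"
      unfolding power_Suc by (rule take_drop_second_half[OF assms]) simp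
    then show ?thesis by auto
  qed
  also have "measure_pmf.prob (rha_state k (n + d)) \<dots> =
      measure_pmf.prob (map_pmf snd (rha_state k n)) {w. take ?m (drop i (drop (2 ^ n - 1) w)) = x}"
    by (simp only: measure_map_pmf[symmetric] map_take_rha_state)
  also have "\<dots> = window_prob n i x"
    unfolding window_prob_def map_last_block_rha_state[symmetric] measure_map_pmf vimage_def by simp
  finally show ?thesis .
qed

end

locale rha_mean = rha k + prob_space M for k and M :: "(nat \<Rightarrow> nat) measure" +
  assumes sets_M: "sets M = sets seq_space"
    and mean: "(\<lambda>N. (\<Sum>i=1..N. rha_prob k i x) / real N) \<longlonglongrightarrow> measure M (cyl x)"
begin

lemma space_M: "space M = UNIV"
  using sets_eq_imp_space_eq[OF sets_M] by (simp add: seq_space_def space_PiM)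

lemma measurable_coord: "(\<lambda>\<omega>. \<omega> i) \<in> measurable M (count_space UNIV)"
  unfolding measurable_cong_sets[OF sets_M refl] seq_space_def by (rule measurable_component_singleton) simp

lemma measurable_prefix: "prefix m \<in> measurable M (count_space UNIV)"
proof -
  have "prefix m -` {x} \<inter> space M \<in> sets M" for x
  proof -
    have "prefix m -` {x} \<inter> space M = (if length x = m then {\<omega> \<in> space M. \<forall>i\<in>{..<m}. \<omega> i = x ! i} else {})"
      by (simp add: vimage_def prefix_eq_iff space_M Ball_def)
    moreover have "{\<omega> \<in> space M. \<forall>i\<in>{..<m}. \<omega> i = x ! i} \<in> sets M"
    proof (rule sets.sets_Collect_finite_All)
      fix i
      have "{\<omega> \<in> space M. \<omega> i = x ! i} = (\<lambda>\<omega>. \<omega> i) -` {x ! i} \<inter> space M" by auto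
      then show "{\<omega> \<in> space M. \<omega> i = x ! i} \<in> sets M"
        using measurable_sets[OF measurable_coord, of "{x ! i}" i] by simp
    qed simp
    ultimately show ?thesis by (cases "length x = m") simp_all
  qed
  then show ?thesis by (intro measurable_count_space_eq2_countable[THEN iffD2]) auto
qed

lemma prefix_sets [measurable]: "{\<omega>. prefix m \<omega> \<in> B} \<in> sets M"
  using measurable_sets[OF measurable_prefix, of B m] by (simp add: space_M vimage_def)

lemma cyl_sets [measurable]: "cyl x \<in> sets M"
proof -
  have "cyl x = {\<omega>. prefix (length x) \<omega> \<in> {x}}" by (auto simp: cyl_iff)
  then show ?thesis using prefix_sets[of "length x" "{x}"] by simp
qed

text \<open>The average over all positions is localized to the single block of level
  \<open>n\<close>, whose law is explicit. Windows that cross the end of the block change the sum by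
  at most \<open>length x\<close>.\<close>

lemma window_mean: "(\<lambda>n. (\<Sum>i<2 ^ n. window_prob n i x) / 2 ^ n) \<longlonglongrightarrow> measure M (cyl x)"
proof -
  define S where "S N = (\<Sum>i=1..N. rha_prob k i x)" for N
  define a where "a = measure M (cyl x)"
  let ?m = "length x"
  have lim: "(\<lambda>N. S N / real N) \<longlonglongrightarrow> a" using mean[of x] by (simp add: S_def a_def)
  have at_top: "filterlim (\<lambda>n. 2 ^ n - 1 :: nat) at_top sequentially"
  proof (rule filterlim_at_top_mono[OF filterlim_ident])
    have "n \<le> 2 ^ n - 1" for n :: nat using less_exp[of n] by linarith
    then show "\<forall>\<^sub>F n in sequentially. n \<le> 2 ^ n - (1::nat)" by simp
  qed
  have r: "(\<lambda>n. real (2 ^ n - 1) / 2 ^ n) \<longlonglongrightarrow> 1"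
  proof -
    have "(\<lambda>n. 1 - (1/2) ^ n :: real) \<longlonglongrightarrow> 1 - 0" by (intro tendsto_intros) auto
    moreover have "real (2 ^ n - 1) / 2 ^ n = 1 - (1/2) ^ n" for n
      by (simp add: of_nat_diff diff_divide_distrib power_divide)
    ultimately show ?thesis by simp
  qed
  have S1: "(\<lambda>n. S (2 ^ n - 1) / 2 ^ n) \<longlonglongrightarrow> a"
  proof -
    have "(\<lambda>n. S (2 ^ n - 1) / real (2 ^ n - 1) * (real (2 ^ n - 1) / 2 ^ n)) \<longlonglongrightarrow> a * 1"
      by (intro tendsto_mult r filterlim_compose[OF lim at_top])
    moreover have "S (2 ^ n - 1) / real (2 ^ n - 1) * (real (2 ^ n - 1) / 2 ^ n) = S (2 ^ n - 1) / 2 ^ n" for n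
    proof (cases "n = 0")
      case False
      then have "(2::nat) ^ 1 \<le> 2 ^ n" by (intro power_increasing) auto
      then have "2 ^ n - 1 \<noteq> (0 :: nat)" unfolding power_one_right by linarith
      then have "real (2 ^ n - 1) \<noteq> 0" unfolding of_nat_eq_0_iff .
      then show ?thesis by simp
    qed (simp add: S_def)
    ultimately show ?thesis by simp
  qed
  \<comment> \<open>The block of level \<open>n\<close> fills about the second half of the first
    \<open>2 ^ Suc n - 1\<close> positions, so its average is twice the longer average minus the
    shorter one.\<close>
  have "(\<lambda>n. 2 * (S (2 ^ Suc n - 1) / 2 ^ Suc n) - S (2 ^ n - 1) / 2 ^ n) \<longlonglongrightarrow> 2 * a - a"
    by (intro tendsto_intros S1 LIMSEQ_Suc[OF S1])
  then have S2: "(\<lambda>n. (S (2 ^ Suc n - 1) - S (2 ^ n - 1)) / 2 ^ n) \<longlonglongrightarrow> a"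
    by (simp add: diff_divide_distrib)
  have D: "S (2 ^ Suc n - 1) - S (2 ^ n - 1) = (\<Sum>i<2 ^ n. rha_prob k (2 ^ n + i) x)" for n
  proof -
    have "{1..2 ^ Suc n - 1} = {1..2 ^ n - 1} \<union> {2 ^ n..<2 ^ Suc n :: nat}" by auto
    moreover have "{1..2 ^ n - 1} \<inter> {2 ^ n..<2 ^ Suc n :: nat} = {}" by auto
    ultimately have "S (2 ^ Suc n - 1) = S (2 ^ n - 1) + (\<Sum>i\<in>{2 ^ n..<2 ^ Suc n}. rha_prob k i x)"
      unfolding S_def by (simp add: sum.union_disjoint)
    also have "(\<Sum>i\<in>{2 ^ n..<2 ^ Suc n}. rha_prob k i x) = (\<Sum>i<2 ^ n. rha_prob k (2 ^ n + i) x)"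
      by (rule sum.reindex_bij_witness[of _ "\<lambda>i. 2 ^ n + i" "\<lambda>i. i - 2 ^ n"]) auto
    finally show ?thesis by simp
  qed
  have p01: "\<bar>rha_prob k (2 ^ n + i) x - window_prob n i x\<bar> \<le> 1" for n i
  proof -
    have "\<bar>a - b\<bar> \<le> 1" if "0 \<le> a" "a \<le> 1" "0 \<le> b" "b \<le> 1" for a b :: real using that by linarith
    then show ?thesis by (simp add: rha_prob_def window_prob_def)
  qed
  have close: "\<bar>(S (2 ^ Suc n - 1) - S (2 ^ n - 1)) - (\<Sum>i<2 ^ n. window_prob n i x)\<bar> \<le> ?m" for n
  proof -
    have "\<bar>(S (2 ^ Suc n - 1) - S (2 ^ n - 1)) - (\<Sum>i<2 ^ n. window_prob n i x)\<bar> =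
       \<bar>\<Sum>i<2 ^ n. rha_prob k (2 ^ n + i) x - window_prob n i x\<bar>"
      unfolding D by (simp add: sum_subtractf)
    also have "\<dots> \<le> (\<Sum>i<2 ^ n. \<bar>rha_prob k (2 ^ n + i) x - window_prob n i x\<bar>)" by (rule sum_abs)
    also have "\<dots> \<le> (\<Sum>i<2 ^ n. if 2 ^ n < i + ?m then 1 else 0)"
      using p01 rha_prob_eq_window_prob by (intro sum_mono) (auto simp: not_less)
    also have "\<dots> = real (card {i. i < 2 ^ n \<and> 2 ^ n < i + ?m})"
      by (simp add: sum.If_cases Int_def)
    also have "\<dots> \<le> real (card {2 ^ n - ?m..<2 ^ n})" by (intro of_nat_mono card_mono) auto
    also have "\<dots> \<le> ?m" by (subst card_atLeastLessThan, rule of_nat_mono) arith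
    finally show ?thesis .
  qed
  have z: "(\<lambda>n. real ?m / 2 ^ n) \<longlonglongrightarrow> 0"
    using tendsto_mult[OF tendsto_const[of "real ?m"] LIMSEQ_power_zero[of "1/2 :: real"]]
    by (simp add: power_divide)
  have "(\<lambda>n. (S (2 ^ Suc n - 1) - S (2 ^ n - 1)) / 2 ^ n - (\<Sum>i<2 ^ n. window_prob n i x) / 2 ^ n) \<longlonglongrightarrow> 0"
  proof (rule Lim_null_comparison[OF always_eventually z], rule allI)
    fix n show "norm ((S (2 ^ Suc n - 1) - S (2 ^ n - 1)) / 2 ^ n - (\<Sum>i<2 ^ n. window_prob n i x) / 2 ^ n) \<le> real ?m / 2 ^ n"
      using divide_right_mono[OF close[of n], of "2 ^ n"] by (simp add: diff_divide_distrib[symmetric] abs_divide)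
  qed
  from tendsto_diff[OF S2 this] show ?thesis by (simp add: a_def)
qed

lemma cyl_alphabet: assumes "\<not> set x \<subseteq> {1..k 0}" shows "measure M (cyl x) = 0"
proof -
  have "window_prob n i x = 0" for n i
  proof -
    have "window_prob n i x \<le> measure_pmf.prob (word n) {}" unfolding window_prob_def
    proof (rule prob_pmf_mono)
      fix u assume u: "u \<in> set_pmf (word n)" "u \<in> {u. take (length x) (drop i u) = x}"
      have "set (take (length x) (drop i u)) \<subseteq> set u"
        by (rule order_trans[OF set_take_subset set_drop_subset])
      then have "set x \<subseteq> set u" using u(2) by simp
      then show "u \<in> {}" using length_word[OF u(1)] assms by blast
    qed
    then show ?thesis by (simp add: window_prob_def measure_le_0_iff)
  qed
  then have "(\<lambda>n::nat. 0::real) \<longlonglongrightarrow> measure M (cyl x)" using window_mean[of x] by simp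
  then show ?thesis using LIMSEQ_unique tendsto_const by blast
qed

lemma AE_alphabet: "AE \<omega> in M. \<forall>i. \<omega> i \<in> {1..k 0}"
proof -
  have "AE \<omega> in M. \<forall>x\<in>{x. \<not> set x \<subseteq> {1..k 0}}. \<omega> \<notin> cyl x"
  proof (subst AE_ball_countable)
    show "\<forall>x\<in>{x. \<not> set x \<subseteq> {1..k 0}}. AE \<omega> in M. \<omega> \<notin> cyl x"
    proof
      fix x assume "x \<in> {x. \<not> set x \<subseteq> {1..k 0}}"
      then have "measure M (cyl x) = 0" by (intro cyl_alphabet) simp
      then show "AE \<omega> in M. \<omega> \<notin> cyl x"
        using cyl_sets by (intro AE_not_in) (simp add: null_sets_def emeasure_eq_measure)
    qed
  qed auto
  then show ?thesis
  proof (rule AE_mp, intro AE_I2 impI allI)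
    fix \<omega> i assume "\<forall>x\<in>{x. \<not> set x \<subseteq> {1..k 0}}. \<omega> \<notin> cyl x"
    then have "set (prefix (Suc i) \<omega>) \<subseteq> {1..k 0}" using prefix_mem_cyl by blast
    then show "\<omega> i \<in> {1..k 0}" by (auto simp: prefix_def)
  qed
qed

lemma AE_prefix_alphabet: "AE \<omega> in M. \<forall>m. set (prefix m \<omega>) \<subseteq> {1..k 0}"
  using AE_alphabet by (rule AE_mp) (auto simp: prefix_def)

lemma finite_words: "finite {x. set x \<subseteq> {1..k 0} \<and> length x = m}"
  by (rule finite_lists_length_eq) simp

lemma measure_prefix:
  assumes "finite B" "\<And>x. x \<in> B \<Longrightarrow> length x = m"
  shows "measure M {\<omega>. prefix m \<omega> \<in> B} = (\<Sum>x\<in>B. measure M (cyl x))"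
proof -
  have "{\<omega>. prefix m \<omega> \<in> B} = (\<Union>x\<in>B. cyl x)" using assms(2) by (auto simp: cyl_iff)
  moreover have "disjoint_family_on cyl B"
    using assms(2) by (auto simp: disjoint_family_on_def cyl_iff)
  ultimately show ?thesis using assms(1) cyl_sets by (simp add: finite_measure_finite_Union image_subset_iff)
qed

text \<open>The transfer principle for all estimates: a bound uniform over windows of random words
  passes to \<open>M\<close>. The margin \<open>c\<close> allows a hypothesis that fails near the
  end of the word; these offsets contribute at most \<open>c / 2 ^ n\<close>.\<close>

lemma measure_prefix_le:
  assumes bd: "\<And>n i. n0 \<le> n \<Longrightarrow> i + c \<le> 2 ^ n \<Longrightarrow> measure_pmf.prob (word n) {u. take m (drop i u) \<in> B} \<le> b"
    and b: "0 \<le> b"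
  shows "measure M {\<omega>. prefix m \<omega> \<in> B} \<le> b"
proof -
  let ?B = "{x \<in> B. set x \<subseteq> {1..k 0} \<and> length x = m}"
  have fB: "finite ?B" by (rule finite_subset[OF _ finite_words[of m]]) auto
  have "measure M {\<omega>. prefix m \<omega> \<in> B} = measure M {\<omega>. prefix m \<omega> \<in> ?B}"
    by (rule measure_eq_AE[OF _ prefix_sets prefix_sets]) (use AE_prefix_alphabet in auto)
  also have "\<dots> = (\<Sum>x\<in>?B. measure M (cyl x))" by (rule measure_prefix[OF fB]) auto
  also have "\<dots> \<le> b"
  proof (rule LIMSEQ_le)
    show "(\<lambda>n. \<Sum>x\<in>?B. (\<Sum>i<2 ^ n. window_prob n i x) / 2 ^ n) \<longlonglongrightarrow> (\<Sum>x\<in>?B. measure M (cyl x))"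
      by (intro tendsto_sum window_mean)
    have "(\<lambda>n. b + real c * (1 / 2) ^ n) \<longlonglongrightarrow> b + real c * 0"
      by (intro tendsto_intros) auto
    then show "(\<lambda>n. b + real c / 2 ^ n) \<longlonglongrightarrow> b" by (simp add: power_divide)
    have "(\<Sum>x\<in>?B. (\<Sum>i<2 ^ n. window_prob n i x) / 2 ^ n) \<le> b + real c / 2 ^ n" if n: "n0 \<le> n" for n
    proof -
      let ?P = "measure_pmf.prob (word n)"
      have le: "(\<Sum>x\<in>?B. window_prob n i x) \<le> ?P {u. take m (drop i u) \<in> B}" for i
      proof -
        have "(\<Sum>x\<in>?B. window_prob n i x) = (\<Sum>x\<in>?B. ?P {u. take m (drop i u) = x})"
          unfolding window_prob_def by (intro sum.cong) auto
        also have "\<dots> = ?P (\<Union>x\<in>?B. {u. take m (drop i u) = x})"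
          by (rule measure_pmf.finite_measure_finite_Union[symmetric, OF fB])
            (auto simp: disjoint_family_on_def)
        also have "\<dots> \<le> ?P {u. take m (drop i u) \<in> B}" by (rule prob_pmf_mono) auto
        finally show ?thesis .
      qed
      have "(\<Sum>x\<in>?B. \<Sum>i<2 ^ n. window_prob n i x) = (\<Sum>i<2 ^ n. \<Sum>x\<in>?B. window_prob n i x)"
        by (rule sum.swap)
      also have "\<dots> \<le> (\<Sum>i<2 ^ n. b + (if 2 ^ n < i + c then 1 else 0))"
      proof (rule sum_mono)
        fix i show "(\<Sum>x\<in>?B. window_prob n i x) \<le> b + (if 2 ^ n < i + c then 1 else 0)"
          using le[of i] bd[OF n, of i] b order_trans[OF le[of i] measure_pmf.prob_le_1] by (cases "2 ^ n < i + c") auto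
      qed
      also have "\<dots> = 2 ^ n * b + real (card {i. i < 2 ^ n \<and> 2 ^ n < i + c})"
        by (simp add: sum.distrib sum.If_cases Int_def)
      also have "real (card {i. i < 2 ^ n \<and> 2 ^ n < i + c}) \<le> real (card {2 ^ n - c..<2 ^ n})"
        by (intro of_nat_mono card_mono) auto
      also have "\<dots> \<le> c" by (subst card_atLeastLessThan, rule of_nat_mono) arith
      finally show ?thesis by (simp add: sum_divide_distrib[symmetric] field_simps)
    qed
    then show "\<exists>N. \<forall>n\<ge>N. (\<Sum>x\<in>?B. (\<Sum>i<2 ^ n. window_prob n i x) / 2 ^ n) \<le> b + real c / 2 ^ n" by blast
  qed
  finally show ?thesis .
qed

section \<open>Stationarity\<close>

lemma measurable_shift: "shift \<in> measurable M M"
  unfolding measurable_cong_sets[OF sets_M sets_M] seq_space_def shift_def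
  by (rule measurable_PiM_single') (auto intro!: measurable_component_singleton)

text \<open>Summing the windows \<open>a # x\<close> over the letter \<open>a\<close> gives the
  windows \<open>x\<close> one offset later, so the two averages differ only by two boundary terms
  divided by \<open>2 ^ n\<close>.\<close>

lemma measure_shift_cyl: "measure M (shift -` cyl x) = measure M (cyl x)"
proof -
  have *: "\<omega> \<in> shift -` cyl x \<longleftrightarrow> (\<exists>a. \<omega> \<in> cyl (a # x))" for \<omega> :: "nat \<Rightarrow> nat"
    by (auto simp: cyl_def shift_def nth_Cons split: nat.splits)
  have "shift -` cyl x \<in> sets M" using measurable_sets[OF measurable_shift cyl_sets] by (simp add: space_M)
  moreover have "AE \<omega> in M. \<omega> \<in> shift -` cyl x \<longleftrightarrow> \<omega> \<in> (\<Union>a\<in>{1..k 0}. cyl (a # x))"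
    using AE_alphabet
  proof (rule AE_mp, intro AE_I2 impI)
    fix \<omega> :: "nat \<Rightarrow> nat" assume "\<forall>i. \<omega> i \<in> {1..k 0}"
    then have "\<omega> \<in> cyl (a # x) \<Longrightarrow> a \<in> {1..k 0}" for a by (force simp: cyl_def)
    then show "\<omega> \<in> shift -` cyl x \<longleftrightarrow> \<omega> \<in> (\<Union>a\<in>{1..k 0}. cyl (a # x))" unfolding * by blast
  qed
  ultimately have "measure M (shift -` cyl x) = measure M (\<Union>a\<in>{1..k 0}. cyl (a # x))"
    by (intro measure_eq_AE) auto
  also have "\<dots> = (\<Sum>a\<in>{1..k 0}. measure M (cyl (a # x)))"
    by (rule finite_measure_finite_Union) (auto simp: disjoint_family_on_def cyl_iff)
  finally have 1: "measure M (shift -` cyl x) = (\<Sum>a\<in>{1..k 0}. measure M (cyl (a # x)))" .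
  have "(\<lambda>n. (\<Sum>a\<in>{1..k 0}. (\<Sum>i<2 ^ n. window_prob n i (a # x)) / 2 ^ n)) \<longlonglongrightarrow> measure M (shift -` cyl x)"
    unfolding 1 by (intro tendsto_sum window_mean)
  moreover have "(\<Sum>a\<in>{1..k 0}. (\<Sum>i<2 ^ n. window_prob n i (a # x)) / 2 ^ n) =
     (\<Sum>i<2 ^ n. window_prob n i x) / 2 ^ n + (window_prob n (2 ^ n) x - window_prob n 0 x) * (1 / 2) ^ n" for n
  proof -
    have w: "(\<Sum>a\<in>{1..k 0}. window_prob n i (a # x)) = window_prob n (Suc i) x" if "i < 2 ^ n" for i
    proof -
      let ?A = "\<lambda>a. {u. take (length (a # x)) (drop i u) = a # x}"
      have "(\<Sum>a\<in>{1..k 0}. window_prob n i (a # x)) = measure_pmf.prob (word n) (\<Union>a\<in>{1..k 0}. ?A a)"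
        unfolding window_prob_def
        by (rule measure_pmf.finite_measure_finite_Union[symmetric]) (auto simp: disjoint_family_on_def)
      also have "\<dots> = window_prob n (Suc i) x"
        unfolding window_prob_def
      proof (rule antisym; rule prob_pmf_mono)
        fix u assume u: "u \<in> set_pmf (word n)"
        have l: "i < length u" "set u \<subseteq> {1..k 0}" using length_word[OF u] that by auto
        then have e: "drop i u = u ! i # drop (Suc i) u" by (simp add: Cons_nth_drop_Suc)
        have "u ! i \<in> {1..k 0}" using l nth_mem by blast
        then show "u \<in> (\<Union>a\<in>{1..k 0}. ?A a)" if "u \<in> {u. take (length x) (drop (Suc i) u) = x}"
          using e that by auto
        show "u \<in> {u. take (length x) (drop (Suc i) u) = x}" if "u \<in> (\<Union>a\<in>{1..k 0}. ?A a)"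
          using e that by auto
      qed
      finally show ?thesis .
    qed
    have "(\<Sum>a\<in>{1..k 0}. \<Sum>i<2 ^ n. window_prob n i (a # x)) = (\<Sum>i<2 ^ n. window_prob n (Suc i) x)"
      by (subst sum.swap) (simp add: w)
    also have "\<dots> = (\<Sum>i<2 ^ n. window_prob n i x) + (window_prob n (2 ^ n) x - window_prob n 0 x)"
      using sum.lessThan_Suc_shift[of "\<lambda>i. window_prob n i x" "2 ^ n"] by simp
    finally have f: "(\<Sum>a\<in>{1..k 0}. \<Sum>i<2 ^ n. window_prob n i (a # x)) = \<dots>" .
    show ?thesis unfolding sum_divide_distrib[symmetric] f
      by (simp only: add_divide_distrib power_divide power_one times_divide_eq_right mult_1_right)
  qed
  moreover have "(\<lambda>n. (\<Sum>i<2 ^ n. window_prob n i x) / 2 ^ n + (window_prob n (2 ^ n) x - window_prob n 0 x) * (1 / 2) ^ n)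
      \<longlonglongrightarrow> measure M (cyl x) + 0"
  proof (intro tendsto_add window_mean)
    show "(\<lambda>n. (window_prob n (2 ^ n) x - window_prob n 0 x) * (1 / 2) ^ n) \<longlonglongrightarrow> 0"
    proof (rule Lim_null_comparison[OF always_eventually LIMSEQ_power_zero[of "1/2 :: real"]], rule allI)
      fix n
      have "\<bar>window_prob n (2 ^ n) x - window_prob n 0 x\<bar> \<le> 1"
      proof -
        have "\<bar>a - b\<bar> \<le> 1" if "0 \<le> a" "a \<le> 1" "0 \<le> b" "b \<le> 1" for a b :: real using that by linarith
        then show ?thesis by (simp add: window_prob_def)
      qed
      then show "norm ((window_prob n (2 ^ n) x - window_prob n 0 x) * (1 / 2) ^ n) \<le> (1 / 2 :: real) ^ n"
        by (simp add: abs_mult mult_left_le_one_le)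
    qed simp
  qed
  ultimately show ?thesis using LIMSEQ_unique by fastforce
qed

text \<open>A measure on the product space is determined by its finite-dimensional laws, and each
  finite set of coordinates lies inside a prefix.\<close>

lemma stationary_M: "stationary M"
proof -
  have meas: "(\<lambda>\<omega>. prefix m (shift \<omega>)) \<in> measurable M (count_space UNIV)" for m
    by (rule measurable_compose[OF measurable_shift measurable_prefix])
  have eq: "distr M (count_space UNIV) (\<lambda>\<omega>. prefix m (shift \<omega>)) = distr M (count_space UNIV) (prefix m)" for m
  proof (rule measure_eqI_countable[where A = UNIV])
    fix x
    have "(\<lambda>\<omega>. prefix m (shift \<omega>)) -` {x} = (if length x = m then shift -` cyl x else {})"
      "prefix m -` {x} = (if length x = m then cyl x else {})" by (auto simp: cyl_iff)
    then show "emeasure (distr M (count_space UNIV) (\<lambda>\<omega>. prefix m (shift \<omega>))) {x} =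
        emeasure (distr M (count_space UNIV) (prefix m)) {x}"
      by (cases "length x = m")
        (simp_all add: emeasure_distr[OF meas] emeasure_distr[OF measurable_prefix] space_M
          emeasure_eq_measure measure_shift_cyl)
  qed simp_all
  have "distr M M shift = M"
  proof (rule measure_eqI_PiM_infinite)
    show "sets (distr M M shift) = sets (Pi\<^sub>M UNIV (\<lambda>_. count_space UNIV))"
      "sets M = sets (Pi\<^sub>M UNIV (\<lambda>_. count_space UNIV))" using sets_M by (auto simp: seq_space_def)
    show "finite_measure (distr M M shift)" using finite_measure_distr[OF measurable_shift] .
    fix J :: "nat set" and A :: "nat \<Rightarrow> nat set" assume J: "finite J"
    define m where "m = Suc (Max (insert 0 J))"
    have m: "j < m" if "j \<in> J" for j using that J by (simp add: m_def le_imp_less_Suc)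
    let ?B = "{x. \<forall>j\<in>J. x ! j \<in> A j}"
    have e: "prod_emb UNIV (\<lambda>_. count_space UNIV) J (Pi\<^sub>E J A) = prefix m -` ?B"
      using m by (auto simp: prod_emb_def prefix_def PiE_iff)
    have "emeasure (distr M M shift) (prefix m -` ?B) = emeasure (distr M (count_space UNIV) (\<lambda>\<omega>. prefix m (shift \<omega>))) ?B"
      using prefix_sets[of m ?B] by (simp add: emeasure_distr meas measurable_shift space_M vimage_def)
    also have "\<dots> = emeasure M (prefix m -` ?B)"
      unfolding eq by (simp add: emeasure_distr measurable_prefix space_M)
    finally show "emeasure (distr M M shift) (prod_emb UNIV (\<lambda>_. count_space UNIV) J (Pi\<^sub>E J A)) =
      emeasure M (prod_emb UNIV (\<lambda>_. count_space UNIV) J (Pi\<^sub>E J A))" unfolding e .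
  qed
  then show ?thesis unfolding stationary_def using measurable_shift by blast
qed

end

section \<open>Repetitions, subwords and block entropy\<close>

lemma less_div_add_one_mult: "0 < L \<Longrightarrow> m < (m div L + 1) * (L :: nat)"
  using dividend_less_div_times[of L m] by (simp add: add_mult_distrib add.commute)

lemma entropy_term_nonneg:
  assumes "0 \<le> p" "p \<le> (1 :: real)"
  shows "0 \<le> - (p * ln p)"
proof (cases "p = 0")
  case False
  then have "ln p \<le> 0" using assms by simp
  then show ?thesis using assms(1) by (simp add: mult_nonneg_nonpos)
qed simp

lemma has_rep_mono: "has_rep l x \<Longrightarrow> l' \<le> l \<Longrightarrow> has_rep l' x"
proof -
  assume "has_rep l x" "l' \<le> l"
  then obtain i j where ij: "i < j" "j + l \<le> length x" "take l (drop i x) = take l (drop j x)"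
    by (auto simp: has_rep_def)
  have "take l' (take l (drop i x)) = take l' (take l (drop j x))" using ij(3) by simp
  then have "take l' (drop i x) = take l' (drop j x)" using \<open>l' \<le> l\<close> by (simp add: min_def)
  then show ?thesis using ij \<open>l' \<le> l\<close> unfolding has_rep_def by (intro exI[of _ i] exI[of _ j]) auto
qed

text \<open>For the empty list the set in \<open>L_rep\<close> is empty and its \<open>Max\<close>
  unspecified. Otherwise positions 0 and 1 witness length 0, and \<open>has_rep\<close> is monotone
  in the length.\<close>

lemma le_L_rep_iff_has_rep:
  assumes "x \<noteq> []"
  shows "l \<le> L_rep x \<longleftrightarrow> has_rep l x"
proof -
  let ?S = "{l. \<exists>i j. i \<noteq> j \<and> i + l \<le> length x \<and> j + l \<le> length x \<and> take l (drop i x) = take l (drop j x)}"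
  have fin: "finite ?S" by (rule finite_subset[of _ "{..length x}"]) auto
  have "(0::nat) + 0 \<le> length x \<and> 1 + 0 \<le> length x" using assms by (cases x) auto
  then have "0 \<in> ?S" by (intro CollectI exI[of _ 0] exI[of _ 1]) auto
  then have ne: "?S \<noteq> {}" by blast
  have S: "n \<in> ?S \<longleftrightarrow> has_rep n x" for n
  proof
    assume "n \<in> ?S"
    then obtain i j where "i \<noteq> j" "i + n \<le> length x" "j + n \<le> length x" "take n (drop i x) = take n (drop j x)"
      by blast
    then show "has_rep n x" unfolding has_rep_def
      by (cases "i < j") (metis linorder_neqE_nat)+
  next
    assume "has_rep n x"
    then obtain i j where "i < j" "j + n \<le> length x" "take n (drop i x) = take n (drop j x)"
      by (auto simp: has_rep_def)
    then show "n \<in> ?S" by (intro CollectI exI[of _ i] exI[of _ j]) auto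
  qed
  have L: "L_rep x = Max ?S" by (simp add: L_rep_def)
  show ?thesis
  proof
    assume "l \<le> L_rep x"
    then show "has_rep l x" using S Max_in[OF fin ne] has_rep_mono unfolding L by blast
  next
    assume "has_rep l x"
    then show "l \<le> L_rep x" using S Max_ge[OF fin] unfolding L by blast
  qed
qed

definition subwords :: "nat \<Rightarrow> (nat \<Rightarrow> nat) \<Rightarrow> nat list set" where
  "subwords m \<omega> = {map (\<lambda>j. \<omega> (i + j)) [0..<m] | i. True}"

lemma H_top_subwords: "H_top m \<omega> = ln (real (card (subwords m \<omega>)))"
  by (simp add: H_top_def subwords_def)

lemma subword_of_prefix:
  assumes "i + m \<le> N"
  shows "map (\<lambda>j. \<omega> (i + j)) [0..<m] = take m (drop i (prefix N \<omega>))"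
  using assms by (intro nth_equalityI) (auto simp: prefix_def)

lemma subwords_nonempty: "subwords m \<omega> \<noteq> {}"
  by (auto simp: subwords_def)

text \<open>Without a repetition of length \<open>m\<close>, all windows of that length in the
  prefix differ. Finiteness matters because \<open>card\<close> of an infinite set is 0.\<close>

lemma card_subwords_ge:
  assumes fin: "finite (subwords m \<omega>)" and rep: "\<not> has_rep m (prefix N \<omega>)" and "m \<le> N"
  shows "N - m + 1 \<le> card (subwords m \<omega>)"
proof -
  let ?f = "\<lambda>i. take m (drop i (prefix N \<omega>))"
  have "inj_on ?f {..N - m}"
  proof (rule inj_onI)
    fix i j assume ij: "i \<in> {..N - m}" "j \<in> {..N - m}" "?f i = ?f j"
    have "\<not> a < b" if "b \<le> N - m" "?f a = ?f b" for a b
    proof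
      assume "a < b"
      moreover have "b + m \<le> length (prefix N \<omega>)" using that(1) \<open>m \<le> N\<close> by simp
      ultimately have "has_rep m (prefix N \<omega>)" using that(2) unfolding has_rep_def by blast
      then show False using rep by simp
    qed
    then show "i = j" using ij by (metis atMost_iff linorder_neqE_nat)
  qed
  moreover have "?f ` {..N - m} \<subseteq> subwords m \<omega>"
  proof (rule image_subsetI)
    fix i assume "i \<in> {..N - m}"
    then have "i + m \<le> N" using \<open>m \<le> N\<close> by simp
    then show "?f i \<in> subwords m \<omega>"
      unfolding subword_of_prefix[symmetric, of i m N, OF \<open>i + m \<le> N\<close>] subwords_def by blast
  qed
  ultimately have "card {..N - m} \<le> card (subwords m \<omega>)" by (rule card_inj_on_le[OF _ _ fin])
  then show ?thesis by simp
qed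

text \<open>Gibbs' inequality against the uniform law on \<open>c\<close> points, obtained from
  \<open>ln z \<le> z - 1\<close> at \<open>z = 1 / (p x * c)\<close>.\<close>

lemma entropy_le_ln_card:
  fixes p :: "'a \<Rightarrow> real"
  assumes "finite W" "\<And>x. x \<in> W \<Longrightarrow> 0 \<le> p x" "(\<Sum>x\<in>W. p x) = 1"
    and c: "card {x \<in> W. 0 < p x} \<le> c" "0 < c"
  shows "(\<Sum>x\<in>W. - (p x * ln (p x))) \<le> ln c"
proof -
  let ?A = "{x \<in> W. 0 < p x}"
  have A: "finite ?A" "?A \<subseteq> W" using assms(1) by auto
  have z: "p x = 0" if "x \<in> W - ?A" for x using that assms(2)[of x] by force
  have "(\<Sum>x\<in>?A. p x) = (\<Sum>x\<in>W. p x)"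
    by (rule sum.mono_neutral_left[OF assms(1) A(2)]) (use z in blast)
  then have sA: "(\<Sum>x\<in>?A. p x) = 1" using assms(3) by (rule trans)
  have "(\<Sum>x\<in>W. - (p x * ln (p x))) = (\<Sum>x\<in>?A. - (p x * ln (p x)))"
  proof (rule sum.mono_neutral_right[OF assms(1) A(2)], rule ballI)
    fix x assume "x \<in> W - ?A"
    then have "p x = 0" by (rule z)
    then show "- (p x * ln (p x)) = 0" by simp
  qed
  also have "\<dots> \<le> (\<Sum>x\<in>?A. p x * ln c + (1 / c - p x))"
  proof (rule sum_mono)
    fix x assume x: "x \<in> ?A"
    then have px: "p x > 0" by simp
    have "ln (1 / (p x * c)) \<le> 1 / (p x * c) - 1" using px c by (intro ln_le_minus_one) auto
    then have "p x * ln (1 / (p x * c)) \<le> p x * (1 / (p x * c) - 1)" using px by (intro mult_left_mono) auto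
    moreover have "ln (1 / (p x * c)) = - ln (p x) - ln c" using px c by (simp add: ln_div ln_mult)
    moreover have "p x * (1 / (p x * c) - 1) = 1 / c - p x" using px c by (simp add: field_simps)
    ultimately have "p x * (- ln (p x) - ln c) \<le> 1 / c - p x" by (simp only:)
    then show "- (p x * ln (p x)) \<le> p x * ln c + (1 / c - p x)" by (simp add: right_diff_distrib)
  qed
  also have "\<dots> = ln c + card ?A * (1 / c) - 1"
    by (simp add: sum.distrib sum_subtractf sum_distrib_right[symmetric] sA)
  also have "\<dots> \<le> ln c"
  proof -
    have "real (card ?A) * (1 / c) \<le> c * (1 / c)" using c by (intro mult_right_mono) auto
    then show ?thesis using c by simp
  qed
  finally show ?thesis .
qed

lemma drop_concat_map:
  "(\<And>a. a \<in> set xs \<Longrightarrow> length (g a) = L) \<Longrightarrow> drop (j * L) (concat (map g xs)) = concat (map g (drop j xs))"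
proof (induction xs arbitrary: j)
  case (Cons a xs)
  then show ?case by (cases j) (auto simp: algebra_simps)
qed simp

text \<open>Since \<open>m \<le> L\<close>, the window touches at most the block in which it starts
  and the next one. This makes subwords countable by an offset and two labels.\<close>

lemma two_block_window:
  assumes g: "\<And>a. a \<in> set xs \<Longrightarrow> length (g a) = L" and j: "i div L + 1 < length xs" and m: "m \<le> L" "0 < L"
  shows "take m (drop i (concat (map g xs))) =
    take m (drop (i mod L) (g (xs ! (i div L)) @ g (xs ! (i div L + 1))))"
proof -
  let ?j = "i div L"
  have "drop i (concat (map g xs)) = drop (i mod L) (drop (?j * L) (concat (map g xs)))"
    by (simp add: drop_drop add.commute)
  also have "drop (?j * L) (concat (map g xs)) = concat (map g (drop ?j xs))"
    by (rule drop_concat_map[OF g])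
  also have "drop ?j xs = xs ! ?j # xs ! (?j + 1) # drop (?j + 2) xs"
    using j by (metis Cons_nth_drop_Suc Suc_eq_plus1 add_2_eq_Suc' add_lessD1)
  also have "concat (map g (xs ! ?j # xs ! (?j + 1) # drop (?j + 2) xs)) =
     (g (xs ! ?j) @ g (xs ! (?j + 1))) @ concat (map g (drop (?j + 2) xs))" by simp
  finally have e: "drop i (concat (map g xs)) = drop (i mod L) ((g (xs ! ?j) @ g (xs ! (?j + 1))) @ concat (map g (drop (?j + 2) xs)))" .
  have l: "length (g (xs ! ?j) @ g (xs ! (?j + 1))) = 2 * L" using g j by simp
  have "i mod L < L" using m by simp
  then have "m \<le> length (drop (i mod L) (g (xs ! ?j) @ g (xs ! (?j + 1))))"
    "i mod L \<le> length (g (xs ! ?j) @ g (xs ! (?j + 1)))"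
    using l m unfolding length_drop by linarith+
  then show ?thesis unfolding e by (simp del: append_assoc length_append)
qed

section \<open>Combinatorics of concatenations of level-\<open>q\<close> words\<close>

context rha
begin

text \<open>Keeps only what holds for every outcome: some list of \<open>k q\<close> words, some
  offset, some labels. Because of the offset, \<open>length x div 2 ^ q + 2\<close> labels are
  needed to cover \<open>x\<close>; one more ensures that each block in which a window starts has a
  successor.\<close>

definition aligned :: "nat \<Rightarrow> nat list \<Rightarrow> bool" where
  "aligned q x \<longleftrightarrow> (\<exists>D s is. length D = k q \<and> (\<forall>w\<in>set D. length w = 2 ^ q \<and> set w \<subseteq> {1..k 0}) \<and>
     s < 2 ^ q \<and> length is = length x div 2 ^ q + 3 \<and> set is \<subseteq> {1..k q} \<and>
     x = take (length x) (drop s (decode D is)))"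

text \<open>The margin behind the window leaves room for the extra labels that
  \<open>aligned\<close> demands.\<close>

lemma aligned_window:
  assumes u: "u \<in> set_pmf (word (q + h))" and i: "i + (m + 4 * 2 ^ q) \<le> 2 ^ (q + h)"
  shows "aligned q (take m (drop i u))"
proof -
  let ?L = "2 ^ q :: nat"
  obtain D js where D: "D \<in> set_pmf (dict q)" and js: "js \<in> set_pmf (idx q h)" and ue: "u = decode D js"
    using u unfolding word_eq_decode_idx by auto
  have wf: "length D = k q" "\<forall>w\<in>set D. length w = ?L \<and> set w \<subseteq> {1..k 0}"
    using set_dict[OF D] by (auto simp: wf_dict_def)
  have js': "length js = 2 ^ h" "set js \<subseteq> {1..k q}" using set_idx[OF js] by auto
  have len: "length (D ! (a - 1)) = ?L" if "a \<in> set js" for a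
  proof -
    have "a \<in> {1..k q}" using that js'(2) by blast
    then have "D ! (a - 1) \<in> set D" using wf(1) by (intro nth_mem) auto
    then show ?thesis using wf(2) by blast
  qed
  define j0 where "j0 = i div ?L"
  define s where "s = i mod ?L"
  define r where "r = m div ?L + 3"
  define js1 where "js1 = take r (drop j0 js)"
  have i': "i = j0 * ?L + s" unfolding j0_def s_def by (rule div_mult_mod_eq[symmetric])
  have s: "s < ?L" by (simp add: s_def)
  have m': "m < (m div ?L + 1) * ?L" by (rule less_div_add_one_mult) simp
  have "(j0 + r) * ?L \<le> 2 ^ h * ?L"
  proof -
    have "(j0 + r) * ?L = j0 * ?L + m div ?L * ?L + 3 * ?L" by (simp add: r_def algebra_simps)
    also have "m div ?L * ?L \<le> m" by simp
    finally have "(j0 + r) * ?L \<le> i + m + 3 * ?L" using i' by linarith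
    also have "\<dots> \<le> 2 ^ (q + h)" using i by linarith
    finally show ?thesis by (simp add: power_add mult.commute)
  qed
  then have jr: "j0 + r \<le> 2 ^ h" by simp
  have lj: "length js1 = r" using jr js'(1) by (simp add: js1_def)
  have sj: "set js1 \<subseteq> set js" unfolding js1_def by (rule order_trans[OF set_take_subset set_drop_subset])
  have "drop i u = drop s (drop (j0 * ?L) (decode D js))" by (simp add: ue i' drop_drop add.commute)
  also have "drop (j0 * ?L) (decode D js) = decode D (drop j0 js)"
    unfolding decode_def by (rule drop_concat_map[OF len])
  also have "\<dots> = decode D js1 @ decode D (drop r (drop j0 js))"
    unfolding decode_def js1_def by (metis append_take_drop_id concat_append map_append)
  finally have e: "drop i u = drop s (decode D js1 @ decode D (drop r (drop j0 js)))" .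
  have l1: "length (decode D js1) = ?L * r" unfolding decode_def lj[symmetric]
    by (rule length_concat_map) (use len sj in blast)
  have "s + m \<le> ?L * r"
  proof -
    have "?L * r = (m div ?L + 1) * ?L + 2 * ?L" by (simp add: r_def algebra_simps)
    then show ?thesis using s m' by linarith
  qed
  then have "take m (drop i u) = take m (drop s (decode D js1))" unfolding e using l1 by simp
  moreover have "length (take m (drop i u)) = m" using i length_word[OF u] by simp
  ultimately show ?thesis unfolding aligned_def
    using wf s lj js'(2) sj r_def by (intro exI[of _ D] exI[of _ s] exI[of _ js1]) auto
qed

lemma aligned_lengths:
  assumes D: "length D = k q" "\<forall>w\<in>set D. length w = 2 ^ q \<and> set w \<subseteq> {1..k 0}" and js: "set js \<subseteq> {1..k q}"
    and "a \<in> set js"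
  shows "length (D ! (a - 1)) = 2 ^ q"
proof -
  have "a \<in> {1..k q}" using js assms(4) by blast
  then have "D ! (a - 1) \<in> set D" using D(1) by (intro nth_mem) auto
  then show ?thesis using D(2) by blast
qed

text \<open>Pigeonhole: block 0 may be cut by the offset, but blocks 1 up to
  \<open>length x div 2 ^ q - 1\<close> lie inside \<open>x\<close>, and they outnumber the
  \<open>k q\<close> labels.\<close>

lemma aligned_has_rep:
  assumes "aligned q x" and m: "k q + 1 < length x div 2 ^ q"
  shows "has_rep (2 ^ q) x"
proof -
  let ?L = "2 ^ q :: nat" and ?m = "length x"
  obtain D s js where D: "length D = k q" "\<forall>w\<in>set D. length w = ?L \<and> set w \<subseteq> {1..k 0}"
    and s: "s < ?L" and js: "length js = ?m div ?L + 3" "set js \<subseteq> {1..k q}"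
    and x: "x = take ?m (drop s (decode D js))"
    using assms(1) unfolding aligned_def by blast
  note len = aligned_lengths[OF D js(2)]
  have mL: "?m div ?L * ?L \<le> ?m" by simp
  have m': "?m < (?m div ?L + 1) * ?L" by (rule less_div_add_one_mult) simp
  have sm: "s + ?m \<le> ?L * length js"
  proof -
    have "?L * length js = (?m div ?L + 1) * ?L + 2 * ?L" unfolding js(1) by (simp add: algebra_simps)
    then show ?thesis using s m' by linarith
  qed
  have blk: "take ?L (drop (j * ?L - s) x) = D ! (js ! j - 1)" "s \<le> j * ?L" "j * ?L + ?L \<le> s + ?m"
    if j: "1 \<le> j" "j < ?m div ?L" for j
  proof -
    have "1 * ?L \<le> j * ?L" using j by (intro mult_le_mono1)
    then show 1: "s \<le> j * ?L" using s by linarith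
    have "(j + 1) * ?L \<le> ?m div ?L * ?L" using j by (intro mult_le_mono1) simp
    then have "j * ?L + ?L \<le> ?m" using mL by (simp only: add_mult_distrib nat_mult_1)
    then show 2: "j * ?L + ?L \<le> s + ?m" by linarith
    show "take ?L (drop (j * ?L - s) x) = D ! (js ! j - 1)"
      by (rule block_of_window[OF len x[unfolded decode_def] sm 1 2]) (use j js in auto)
  qed
  have "card ((\<lambda>j. js ! j) ` {1..<?m div ?L}) \<le> card {1..k q}"
  proof (rule card_mono)
    show "(\<lambda>j. js ! j) ` {1..<?m div ?L} \<subseteq> {1..k q}"
    proof (rule image_subsetI)
      fix j assume "j \<in> {1..<?m div ?L}"
      then show "js ! j \<in> {1..k q}" using subsetD[OF js(2) nth_mem[of j js]] js(1) by simp
    qed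
  qed simp
  also have "\<dots> < card {1..<?m div ?L}" using m by simp
  finally have "\<not> inj_on (\<lambda>j. js ! j) {1..<?m div ?L}" by (rule pigeonhole)
  then obtain j j' where "j \<in> {1..<?m div ?L}" "j' \<in> {1..<?m div ?L}" "js ! j = js ! j'" "j \<noteq> j'"
    unfolding inj_on_def by blast
  then obtain j j' where jj: "1 \<le> j" "j < j'" "j' < ?m div ?L" "js ! j = js ! j'"
    by (metis atLeastLessThan_iff linorder_neqE_nat)
  have "take ?L (drop (j * ?L - s) x) = take ?L (drop (j' * ?L - s) x)"
    using blk(1)[of j] blk(1)[of j'] jj by simp
  moreover have "j * ?L < j' * ?L" using jj by simp
  then have "j * ?L - s < j' * ?L - s" using blk(2)[of j] jj by linarith
  moreover have "j' * ?L - s + ?L \<le> ?m" using blk(2,3)[of j'] jj by linarith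
  ultimately show ?thesis unfolding has_rep_def by blast
qed

text \<open>A subword is described by an offset and two labels. The word list behind
  \<open>aligned\<close> may change with the prefix, so the bound is shown for finite sets of
  subwords, each of which fits into one prefix.\<close>

lemma aligned_subwords:
  assumes al: "\<And>N. aligned q (prefix N \<omega>)" and m: "m \<le> 2 ^ q"
  shows "finite (subwords m \<omega>) \<and> card (subwords m \<omega>) \<le> 2 ^ q * (k q)\<^sup>2"
proof (rule finite_if_finite_subsets_card_bdd)
  let ?L = "2 ^ q :: nat"
  let ?sub = "\<lambda>i. map (\<lambda>j. \<omega> (i + j)) [0..<m]"
  fix G assume G: "G \<subseteq> subwords m \<omega>" "finite G"
  have "\<exists>i. w = ?sub i" if "w \<in> G" for w using that G unfolding subwords_def by blast
  then obtain f where f: "\<And>w. w \<in> G \<Longrightarrow> w = ?sub (f w)" by metis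
  define N where "N = Suc (Max (insert 0 (f ` G)))"
  have fN: "f w < N" if "w \<in> G" for w
  proof -
    have "f w \<le> Max (insert 0 (f ` G))" using that G(2) by (intro Max_ge) auto
    then show ?thesis by (simp add: N_def)
  qed
  obtain D s js where D: "length D = k q" "\<forall>w\<in>set D. length w = ?L \<and> set w \<subseteq> {1..k 0}"
    and s: "s < ?L" and js: "length js = (N + m) div ?L + 3" "set js \<subseteq> {1..k q}"
    and x: "prefix (N + m) \<omega> = take (N + m) (drop s (decode D js))"
    using al[of "N + m"] unfolding aligned_def length_prefix by blast
  note len = aligned_lengths[OF D js(2)]
  let ?g = "\<lambda>(t, a, b). take m (drop t (D ! (a - 1) @ D ! (b - 1)))"
  let ?T = "{..<?L} \<times> {1..k q} \<times> {1..k q}"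
  have "G \<subseteq> ?g ` ?T"
  proof
    fix w assume w: "w \<in> G"
    let ?i = "f w + s"
    let ?j = "?i div ?L"
    have "?i < (N div ?L + 2) * ?L"
    proof -
      have "N < (N div ?L + 1) * ?L" by (rule less_div_add_one_mult) simp
      moreover have "(N div ?L + 2) * ?L = (N div ?L + 1) * ?L + ?L" by (simp add: algebra_simps)
      ultimately show ?thesis using fN[OF w] s by linarith
    qed
    then have "?j < N div ?L + 2" by (rule less_mult_imp_div_less)
    moreover have "N div ?L \<le> (N + m) div ?L" by (rule div_le_mono) simp
    ultimately have j: "?j + 1 < length js" using js(1) by linarith
    have "w = take m (drop (f w) (prefix (N + m) \<omega>))"
      using f[OF w] subword_of_prefix[of "f w" m "N + m" \<omega>] fN[OF w] by simp
    also have "\<dots> = take m (drop ?i (decode D js))"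
      unfolding x drop_take drop_drop take_take using fN[OF w] by simp
    also have "\<dots> = ?g (?i mod ?L, js ! ?j, js ! (?j + 1))"
      unfolding decode_def by (simp add: two_block_window[OF len j m])
    finally have "w = ?g (?i mod ?L, js ! ?j, js ! (?j + 1))" .
    moreover have "(?i mod ?L, js ! ?j, js ! (?j + 1)) \<in> ?T"
      using subsetD[OF js(2) nth_mem[of ?j js]] subsetD[OF js(2) nth_mem[of "?j + 1" js]] j by simp
    ultimately show "w \<in> ?g ` ?T" by (rule image_eqI)
  qed
  then have "card G \<le> card (?g ` ?T)" by (rule card_mono[rotated]) simp
  also have "\<dots> \<le> card ?T" by (rule card_image_le) simp
  also have "\<dots> = ?L * (k q)\<^sup>2" by (simp add: card_cartesian_product power2_eq_square)
  finally show "card G \<le> ?L * (k q)\<^sup>2" .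
qed

text \<open>The factors count the possible word lists, the offsets and the label sequences.\<close>

lemma card_aligned:
  "card {x. length x = m \<and> aligned q x} \<le> ((k 0) ^ 2 ^ q) ^ k q * (2 ^ q * k q ^ (m div 2 ^ q + 3))"
proof -
  let ?L = "2 ^ q :: nat"
  let ?W = "{w. set w \<subseteq> {1..k 0} \<and> length w = ?L}"
  let ?Ds = "{D. set D \<subseteq> ?W \<and> length D = k q}"
  let ?Is = "{js. set js \<subseteq> {1..k q} \<and> length js = m div ?L + 3}"
  let ?g = "\<lambda>(D, s, js). take m (drop s (decode D js))"
  have fW: "finite ?W" by (rule finite_lists_length_eq) simp
  have fD: "finite ?Ds" by (rule finite_lists_length_eq[OF fW])
  have fI: "finite ?Is" by (rule finite_lists_length_eq) simp
  have "{x. length x = m \<and> aligned q x} \<subseteq> ?g ` (?Ds \<times> {..<?L} \<times> ?Is)"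
  proof
    fix x assume x: "x \<in> {x. length x = m \<and> aligned q x}"
    then obtain D s js where D: "length D = k q" "\<forall>w\<in>set D. length w = ?L \<and> set w \<subseteq> {1..k 0}"
      and s: "s < ?L" and js: "length js = m div ?L + 3" "set js \<subseteq> {1..k q}"
      and e: "x = take m (drop s (decode D js))"
      unfolding aligned_def by auto
    have "(D, s, js) \<in> ?Ds \<times> {..<?L} \<times> ?Is" using D s js by auto
    then show "x \<in> ?g ` (?Ds \<times> {..<?L} \<times> ?Is)" using e by (intro image_eqI[of _ _ "(D, s, js)"]) auto
  qed
  then have "card {x. length x = m \<and> aligned q x} \<le> card (?g ` (?Ds \<times> {..<?L} \<times> ?Is))"
    by (rule card_mono[rotated]) (use fD fI in auto)
  also have "\<dots> \<le> card (?Ds \<times> {..<?L} \<times> ?Is)" by (rule card_image_le) (use fD fI in auto)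
  also have "\<dots> = ((k 0) ^ ?L) ^ k q * (?L * k q ^ (m div ?L + 3))"
    using card_lists_length_eq[OF fW] card_lists_length_eq[of "{1..k 0}"] card_lists_length_eq[of "{1..k q}"]
    by (simp add: card_cartesian_product)
  finally show ?thesis .
qed

end

section \<open>Transfer to the stationary mean: alignment, block entropy, repetitions\<close>

context rha_mean
begin

lemma AE_prefix_null:
  assumes "measure M {\<omega>. prefix m \<omega> \<in> B} \<le> 0"
  shows "AE \<omega> in M. prefix m \<omega> \<notin> B"
proof -
  have "measure M {\<omega>. prefix m \<omega> \<in> B} = 0" using assms by (simp add: measure_le_0_iff)
  then have "{\<omega>. prefix m \<omega> \<in> B} \<in> null_sets M"
    using prefix_sets by (simp add: null_sets_def emeasure_eq_measure)
  then show ?thesis by (auto dest: AE_not_in)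
qed

text \<open>Every window far enough from the end of a word is aligned, so the exceptional prefixes
  have limiting frequency zero.\<close>

lemma AE_aligned: "AE \<omega> in M. \<forall>q m. aligned q (prefix m \<omega>)"
proof -
  have "AE \<omega> in M. aligned q (prefix m \<omega>)" for q m
  proof -
    let ?B = "{x. \<not> aligned q x}"
    have "measure M {\<omega>. prefix m \<omega> \<in> ?B} \<le> 0"
    proof (rule measure_prefix_le)
      fix n i assume n: "q \<le> n" and i: "i + (m + 4 * 2 ^ q) \<le> 2 ^ n"
      obtain h where h: "n = q + h" using n le_Suc_ex by blast
      have "measure_pmf.prob (word n) {u. take m (drop i u) \<in> ?B} \<le> measure_pmf.prob (word n) {}"
        by (rule prob_pmf_mono) (use aligned_window i h in blast)
      then show "measure_pmf.prob (word n) {u. take m (drop i u) \<in> ?B} \<le> 0" by simp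
    qed simp
    from AE_prefix_null[OF this] show ?thesis by simp
  qed
  then show ?thesis by (simp add: AE_all_countable)
qed

lemma sum_cyl: "(\<Sum>x | set x \<subseteq> {1..k 0} \<and> length x = m. measure M (cyl x)) = 1"
proof -
  let ?W = "{x. set x \<subseteq> {1..k 0} \<and> length x = m}"
  have "measure M {\<omega>. prefix m \<omega> \<in> ?W} = (\<Sum>x\<in>?W. measure M (cyl x))"
    by (rule measure_prefix[OF finite_words]) auto
  moreover have "measure M {\<omega>. prefix m \<omega> \<in> ?W} = 1"
    by (rule prob_eq_1[OF prefix_sets, THEN iffD2]) (use AE_prefix_alphabet in auto)
  ultimately show ?thesis by simp
qed

lemma H_mu_eq_sum:
  "H_mu M m = (\<Sum>x | set x \<subseteq> {1..k 0} \<and> length x = m. - (measure M (cyl x) * ln (measure M (cyl x))))"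
proof -
  let ?W = "{x. set x \<subseteq> {1..k 0} \<and> length x = m}"
  let ?p = "\<lambda>x. measure M (cyl x)"
  have "H_mu M m = (\<integral>\<omega>. (\<Sum>x\<in>?W. - ln (?p x) * indicator (cyl x) \<omega>) \<partial>M)"
    unfolding H_mu_def
  proof (rule integral_cong_AE)
    show "(\<lambda>\<omega>. - ln (?p (prefix m \<omega>))) \<in> borel_measurable M"
      using measurable_compose[OF measurable_prefix, of "\<lambda>x. - ln (?p x)" borel m] by simp
    show "(\<lambda>\<omega>. \<Sum>x\<in>?W. - ln (?p x) * indicator (cyl x) \<omega>) \<in> borel_measurable M"
      using cyl_sets by measurable
    show "AE \<omega> in M. - ln (?p (prefix m \<omega>)) = (\<Sum>x\<in>?W. - ln (?p x) * indicator (cyl x) \<omega>)"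
      using AE_prefix_alphabet
    proof (rule AE_mp, intro AE_I2 impI)
      fix \<omega> assume "\<forall>m. set (prefix m \<omega>) \<subseteq> {1..k 0}"
      then have w: "prefix m \<omega> \<in> ?W" by simp
      have "(\<Sum>x\<in>?W. - ln (?p x) * indicator (cyl x) \<omega>) =
          (\<Sum>x\<in>?W. if x = prefix m \<omega> then - ln (?p x) else 0)"
        by (intro sum.cong refl) (auto simp: indicator_def cyl_iff)
      also have "\<dots> = - ln (?p (prefix m \<omega>))" using w finite_words[of m] by (simp add: sum.delta)
      finally show "- ln (?p (prefix m \<omega>)) = (\<Sum>x\<in>?W. - ln (?p x) * indicator (cyl x) \<omega>)" by simp
    qed
  qed
  also have "\<dots> = (\<Sum>x\<in>?W. \<integral>\<omega>. - ln (?p x) * indicator (cyl x) \<omega> \<partial>M)"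
    by (rule Bochner_Integration.integral_sum) (use cyl_sets in \<open>auto intro!: integrable_mult_right simp: emeasure_eq_measure\<close>)
  also have "\<dots> = (\<Sum>x\<in>?W. - (?p x * ln (?p x)))"
    by (intro sum.cong refl) (simp add: mult.commute cyl_sets)
  finally show ?thesis .
qed

lemma H_mu_nonneg: "0 \<le> H_mu M m"
  unfolding H_mu_eq_sum by (intro sum_nonneg entropy_term_nonneg) auto

lemma H_mu_le_ln_card:
  assumes "AE \<omega> in M. prefix m \<omega> \<in> A" "finite A" "card A \<le> c" "0 < c"
  shows "H_mu M m \<le> ln c"
  unfolding H_mu_eq_sum
proof (rule entropy_le_ln_card[OF finite_words])
  let ?W = "{x. set x \<subseteq> {1..k 0} \<and> length x = m}"
  have "{x \<in> ?W. 0 < measure M (cyl x)} \<subseteq> A"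
  proof
    fix x assume x: "x \<in> {x \<in> ?W. 0 < measure M (cyl x)}"
    show "x \<in> A"
    proof (rule ccontr)
      assume "x \<notin> A"
      then have "AE \<omega> in M. \<omega> \<notin> cyl x" using assms(1) x by (auto simp: cyl_iff)
      then have "measure M (cyl x) = 0" by (simp add: prob_eq_0 cyl_sets)
      then show False using x by simp
    qed
  qed
  then show "card {x \<in> ?W. 0 < measure M (cyl x)} \<le> c"
    using card_mono[OF assms(2)] assms(3) by (meson order_trans)
qed (use assms(4) sum_cyl in auto)

text \<open>A description length: the \<open>k q\<close> words spelled out, the offset, and the
  label sequence.\<close>

lemma H_mu_upper:
  "H_mu M m \<le> real (k q) * 2 ^ q * ln (k 0) + q * ln 2 + (real (m div 2 ^ q) + 3) * ln (k q)"
proof -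
  let ?c = "((k 0) ^ 2 ^ q) ^ k q * (2 ^ q * k q ^ (m div 2 ^ q + 3))"
  let ?A = "{x. set x \<subseteq> {1..k 0} \<and> length x = m \<and> aligned q x}"
  have k0: "0 < k 0" "0 < k q" using k_ge_2[of 0] k_ge_2[of q] by auto
  have c: "0 < ?c" using k0 by simp
  have "H_mu M m \<le> ln (real ?c)"
  proof (rule H_mu_le_ln_card[OF _ _ _ c])
    show "AE \<omega> in M. prefix m \<omega> \<in> ?A" using AE_aligned AE_prefix_alphabet by eventually_elim simp
    show f: "finite ?A" by (rule finite_subset[OF _ finite_words[of m]]) auto
    show "card ?A \<le> ?c"
    proof (cases "finite {x. length x = m \<and> aligned q x}")
      case True
      then have "card ?A \<le> card {x. length x = m \<and> aligned q x}" by (rule card_mono) auto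
      then show ?thesis using card_aligned[of m q] by linarith
    next
      \<comment> \<open>For an infinite set \<open>card\<close> would be 0 and
        \<open>card_aligned\<close> would carry no information. The case is impossible, since the
        letters of an aligned list belong to the alphabet.\<close>
      case False
      have "{x. length x = m \<and> aligned q x} \<subseteq> {x. set x \<subseteq> {1..k 0} \<and> length x = m}"
      proof
        fix x assume x: "x \<in> {x. length x = m \<and> aligned q x}"
        then obtain D s js where D: "length D = k q" "\<forall>w\<in>set D. set w \<subseteq> {1..k 0}"
          and js: "set js \<subseteq> {1..k q}" and e: "x = take (length x) (drop s (decode D js))"
          unfolding aligned_def by blast
        have "set (D ! (a - 1)) \<subseteq> {1..k 0}" if "a \<in> set js" for a
        proof -
          have "a \<in> {1..k q}" using that js by blast
          then have "D ! (a - 1) \<in> set D" using D(1) by (intro nth_mem) auto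
          then show ?thesis using D(2) by blast
        qed
        then have "set (decode D js) \<subseteq> {1..k 0}" unfolding decode_def by (simp only: set_concat set_map) blast
        moreover have "set x \<subseteq> set (decode D js)"
          by (subst e) (rule order_trans[OF set_take_subset set_drop_subset])
        ultimately show "x \<in> {x. set x \<subseteq> {1..k 0} \<and> length x = m}" using x by blast
      qed
      then show ?thesis using False finite_subset finite_words by blast
    qed
  qed
  also have "ln (real ?c) = real (k q) * 2 ^ q * ln (k 0) + q * ln 2 + (real (m div 2 ^ q) + 3) * ln (k q)"
    using k0 by (simp add: ln_mult ln_realpow)
  finally show ?thesis .
qed

text \<open>Only repetition-free words are kept; each carries information at least
  \<open>- ln b\<close>, and the discarded terms are nonnegative.\<close>

lemma H_mu_lower:
  assumes "\<And>x. length x = m \<Longrightarrow> \<not> has_rep l x \<Longrightarrow> measure M (cyl x) \<le> b" and b: "0 < b" "b \<le> 1"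
  shows "measure M {\<omega>. \<not> has_rep l (prefix m \<omega>)} * - ln b \<le> H_mu M m"
proof -
  let ?W = "{x. set x \<subseteq> {1..k 0} \<and> length x = m}"
  let ?G = "{x \<in> ?W. \<not> has_rep l x}"
  let ?p = "\<lambda>x. measure M (cyl x)"
  have fG: "finite ?G" by (rule finite_subset[OF _ finite_words[of m]]) auto
  have "measure M {\<omega>. \<not> has_rep l (prefix m \<omega>)} = measure M {\<omega>. prefix m \<omega> \<in> ?G}"
    using prefix_sets[of m "{x. \<not> has_rep l x}"]
    by (intro measure_eq_AE[OF _ _ prefix_sets]) (use AE_prefix_alphabet in auto)
  also have "\<dots> = (\<Sum>x\<in>?G. ?p x)" by (rule measure_prefix[OF fG]) auto
  finally have "measure M {\<omega>. \<not> has_rep l (prefix m \<omega>)} * - ln b = (\<Sum>x\<in>?G. ?p x * - ln b)"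
    by (simp only: sum_distrib_right)
  also have "\<dots> \<le> (\<Sum>x\<in>?G. - (?p x * ln (?p x)))"
  proof (rule sum_mono)
    fix x assume x: "x \<in> ?G"
    show "?p x * - ln b \<le> - (?p x * ln (?p x))"
    proof (cases "?p x = 0")
      case False
      then have "0 < ?p x" using measure_nonneg[of M "cyl x"] by linarith
      moreover have "?p x \<le> b" using assms(1)[of x] x by simp
      ultimately have "ln (?p x) \<le> ln b" by simp
      then have "?p x * ln (?p x) \<le> ?p x * ln b" using measure_nonneg by (rule mult_left_mono)
      then show ?thesis by simp
    qed simp
  qed
  also have "\<dots> \<le> (\<Sum>x\<in>?W. - (?p x * ln (?p x)))"
    by (rule sum_mono2[OF finite_words]) (blast, intro entropy_term_nonneg, auto)
  finally show ?thesis unfolding H_mu_eq_sum .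
qed

lemma measure_cyl_nonrepetitive:
  assumes "length x = m" "\<not> has_rep (2 ^ Suc q) x" "m div 2 ^ Suc q - 1 < (k q)\<^sup>2"
  shows "measure M (cyl x) \<le> 1 / ((real (k q))\<^sup>2 - real (m div 2 ^ Suc q - 1)) ^ (m div 2 ^ Suc q - 1)"
proof -
  let ?b = "1 / ((real (k q))\<^sup>2 - real (m div 2 ^ Suc q - 1)) ^ (m div 2 ^ Suc q - 1)"
  have "measure M {\<omega>. prefix m \<omega> \<in> {x}} \<le> ?b"
  proof (rule measure_prefix_le)
    fix n i assume n: "Suc q \<le> n" and i: "i + m \<le> 2 ^ n"
    obtain h where h: "n = Suc q + h" using n le_Suc_ex by blast
    show "measure_pmf.prob (word n) {u. take m (drop i u) \<in> {x}} \<le> ?b"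
      using prob_nonrepetitive_window[OF assms(1,2) i[unfolded h] assms(3)] h by simp
  next
    show "0 \<le> ?b" using of_nat_mono[of "m div 2 ^ Suc q - 1" "(k q)\<^sup>2", where 'a=real] assms(3) by simp
  qed
  moreover have "{\<omega>. prefix m \<omega> \<in> {x}} = cyl x" using assms(1) by (auto simp: cyl_iff)
  ultimately show ?thesis by simp
qed

text \<open>\<open>S\<close> must bound the collision sums for all heights \<open>h\<close>, because
  the limit takes words of ever higher level.\<close>

lemma measure_has_rep:
  assumes S: "\<And>h. (\<Sum>i<h. 4 / real (k (Suc q + i))) \<le> S" and l: "2 * 2 ^ Suc q \<le> l"
  shows "measure M {\<omega>. has_rep l (prefix m \<omega>)} \<le> (real m)\<^sup>2 * (2 * S + 64 / (real (k q))\<^sup>2)"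
proof -
  have S0: "0 \<le> S" using S[of 0] by simp
  have "measure M {\<omega>. prefix m \<omega> \<in> {x. has_rep l x}} \<le> (real m)\<^sup>2 * (2 * S + 64 / (real (k q))\<^sup>2)"
  proof (rule measure_prefix_le)
    fix n i assume n: "Suc q \<le> n" and i: "i + m \<le> 2 ^ n"
    obtain h where h: "n = Suc q + h" using n le_Suc_ex by blast
    have "measure_pmf.prob (word n) {u. has_rep l (take m (drop i u))}
       \<le> (real m)\<^sup>2 * (2 * (\<Sum>i<h. 4 / real (k (Suc q + i))) + 64 / (real (k q))\<^sup>2)"
      using prob_has_rep[OF i[unfolded h] l] h by simp
    also have "\<dots> \<le> (real m)\<^sup>2 * (2 * S + 64 / (real (k q))\<^sup>2)"
      using S[of h] by (intro mult_left_mono) auto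
    finally show "measure_pmf.prob (word n) {u. take m (drop i u) \<in> {x. has_rep l x}} \<le> (real m)\<^sup>2 * (2 * S + 64 / (real (k q))\<^sup>2)"
      by simp
  qed (use S0 in simp)
  then show ?thesis by simp
qed

end

section \<open>The ergodic components\<close>

lemma shift_funpow: "(shift ^^ n) \<omega> = (\<lambda>j. \<omega> (n + j))"
  by (induction n) (auto simp: shift_def)

context rha_mean
begin

text \<open>The invariant sets are already closed under complement and countable union, so
  \<open>sigma\<close> adds nothing.\<close>

lemma sets_inv_alg: "sets (inv_alg M) = invariant_sets M"
proof -
  have sub: "invariant_sets M \<subseteq> Pow (space M)" by (auto simp: space_M)
  have "A \<in> invariant_sets M" if "A \<in> sigma_sets (space M) (invariant_sets M)" for A
    using that
  proof induction
    case (Compl a)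
    then show ?case using sets.compl_sets[of a M] by (auto simp: invariant_sets_def space_M)
  next
    case (Union a)
    then have "shift -` (\<Union>i. a i) = (\<Union>i. a i)" by (auto simp: invariant_sets_def space_M)
    then show ?case using Union by (auto simp: invariant_sets_def space_M)
  qed (auto simp: invariant_sets_def)
  then show ?thesis unfolding inv_alg_def sets_measure_of[OF sub] by (auto intro: sigma_sets.Basic)
qed

lemma subalgebra_inv_alg: "finite_measure_subalgebra M (inv_alg M)"
proof
  have "space (inv_alg M) = space M" by (simp add: inv_alg_def space_measure_of_conv)
  then show "subalgebra M (inv_alg M)"
    unfolding subalgebra_def sets_inv_alg by (auto simp: invariant_sets_def)
qed

lemma measurable_shift_funpow: "(shift ^^ n) \<in> measurable M M"
proof (induction n)
  case (Suc n)
  then show ?case unfolding funpow.simps by (rule measurable_comp[OF _ measurable_shift])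
qed (simp add: id_def[symmetric])

lemma measure_shift_funpow:
  assumes "A \<in> sets M"
  shows "measure M ((shift ^^ n) -` A) = measure M A"
proof (induction n)
  case (Suc n)
  have d: "distr M M shift = M" using stationary_M by (simp add: stationary_def)
  have s: "(shift ^^ n) -` A \<in> sets M"
    using measurable_sets[OF measurable_shift_funpow assms, of n] by (simp add: space_M)
  have "measure M ((shift ^^ Suc n) -` A) = measure M (shift -` ((shift ^^ n) -` A) \<inter> space M)"
    by (simp add: space_M funpow_Suc_right vimage_comp del: funpow.simps)
  also have "\<dots> = measure (distr M M shift) ((shift ^^ n) -` A)"
    by (rule measure_distr[OF measurable_shift s, symmetric])
  finally show ?case unfolding d Suc.IH .
qed simp

definition absent :: "nat \<Rightarrow> nat list \<Rightarrow> (nat \<Rightarrow> nat) set" where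
  "absent n x = {\<omega>. \<forall>i\<ge>n. (shift ^^ i) \<omega> \<notin> cyl x}"

lemma absent_sets: "absent n x \<in> sets M"
proof -
  have "absent n x = (\<Inter>i\<in>{n..}. space M - (shift ^^ i) -` cyl x \<inter> space M)"
    by (auto simp: absent_def space_M)
  also have "\<dots> \<in> sets M"
    by (rule sets.countable_INT') (auto intro!: sets.compl_sets measurable_sets[OF measurable_shift_funpow cyl_sets])
  finally show ?thesis .
qed

text \<open>The union over \<open>n\<close> is strictly shift invariant, unlike the a.e. equal set \<open>absent 0 x\<close>.\<close>

lemma absent_invariant: "(\<Union>n. absent n x) \<in> invariant_sets M"
proof -
  have "shift \<omega> \<in> (\<Union>n. absent n x) \<longleftrightarrow> \<omega> \<in> (\<Union>n. absent n x)" for \<omega> :: "nat \<Rightarrow> nat"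
  proof
    assume "shift \<omega> \<in> (\<Union>n. absent n x)"
    then obtain n where n: "\<And>i. i \<ge> n \<Longrightarrow> (shift ^^ i) (shift \<omega>) \<notin> cyl x" by (auto simp: absent_def)
    have "(shift ^^ i) \<omega> \<notin> cyl x" if i: "i \<ge> Suc n" for i
    proof -
      obtain j where "i = Suc j" "j \<ge> n" using i by (cases i) auto
      then show ?thesis using n[of j] by (simp add: funpow_Suc_right del: funpow.simps)
    qed
    then show "\<omega> \<in> (\<Union>n. absent n x)" unfolding absent_def by blast
  next
    assume "\<omega> \<in> (\<Union>n. absent n x)"
    then obtain n where n: "\<And>i. i \<ge> n \<Longrightarrow> (shift ^^ i) \<omega> \<notin> cyl x" by (auto simp: absent_def)
    have "(shift ^^ i) (shift \<omega>) \<notin> cyl x" if i: "i \<ge> n" for i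
      using n[of "Suc i"] i by (simp add: funpow_Suc_right del: funpow.simps)
    then show "shift \<omega> \<in> (\<Union>n. absent n x)" unfolding absent_def by blast
  qed
  then have "shift -` (\<Union>n. absent n x) = (\<Union>n. absent n x)" by blast
  moreover have "(\<Union>n. absent n x) \<in> sets M" using absent_sets by blast
  ultimately show ?thesis by (simp add: invariant_sets_def space_M)
qed

text \<open>Poincare recurrence. Each \<open>absent n x\<close> is the preimage of
  \<open>absent 0 x\<close> under \<open>n\<close> shifts and has the same measure, hence so has
  their increasing union; and \<open>cyl x\<close> is disjoint from
  \<open>absent 0 x\<close>.\<close>

lemma measure_absent: "measure M ((\<Union>n. absent n x) \<inter> cyl x) = 0"
proof -
  have "absent n x = (shift ^^ n) -` absent 0 x" for n
  proof (rule set_eqI)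
    fix \<omega> :: "nat \<Rightarrow> nat"
    have "(\<forall>i\<ge>n. (shift ^^ i) \<omega> \<notin> cyl x) \<longleftrightarrow> (\<forall>i. (shift ^^ (i + n)) \<omega> \<notin> cyl x)"
      by (metis le_add2 le_add_diff_inverse2)
    then show "\<omega> \<in> absent n x \<longleftrightarrow> \<omega> \<in> (shift ^^ n) -` absent 0 x"
      by (simp add: absent_def funpow_add)
  qed
  then have e: "measure M (absent n x) = measure M (absent 0 x)" for n
    using measure_shift_funpow[OF absent_sets] by metis
  have "incseq (\<lambda>n. absent n x)" by (auto simp: incseq_def absent_def)
  then have "(\<lambda>n. measure M (absent n x)) \<longlonglongrightarrow> measure M (\<Union>n. absent n x)"
    using absent_sets by (intro finite_Lim_measure_incseq) auto
  moreover have "(\<lambda>n. measure M (absent n x)) \<longlonglongrightarrow> measure M (absent 0 x)"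
    by (rule tendsto_eventually[OF always_eventually[OF allI[OF e]]])
  ultimately have m: "measure M (\<Union>n. absent n x) = measure M (absent 0 x)" by (rule LIMSEQ_unique)
  have U: "(\<Union>n. absent n x) \<in> sets M" using absent_sets by blast
  have "(\<Union>n. absent n x) \<inter> cyl x \<subseteq> (\<Union>n. absent n x) - absent 0 x"
  proof
    fix \<omega> assume w: "\<omega> \<in> (\<Union>n. absent n x) \<inter> cyl x"
    then have "(shift ^^ 0) \<omega> \<in> cyl x" by simp
    then have "\<omega> \<notin> absent 0 x" unfolding absent_def by blast
    then show "\<omega> \<in> (\<Union>n. absent n x) - absent 0 x" using w by blast
  qed
  then have "measure M ((\<Union>n. absent n x) \<inter> cyl x) \<le> measure M ((\<Union>n. absent n x) - absent 0 x)"
    by (rule finite_measure_mono) (use U absent_sets in blast)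
  also have "\<dots> = measure M (\<Union>n. absent n x) - measure M (absent 0 x)"
    by (rule finite_measure_Diff[OF U absent_sets]) blast
  also have "\<dots> = 0" using m by (simp only: diff_self)
  finally show ?thesis by (simp add: measure_le_0_iff)
qed

section \<open>Conditional cylinder probabilities and their entropy\<close>

lemma integrable_cyl: "integrable M (indicator (cyl x) :: _ \<Rightarrow> real)"
  using cyl_sets by (simp add: emeasure_eq_measure)

lemma cond_cyl_nonneg: "AE \<omega> in M. 0 \<le> cond_cyl M x \<omega>"
proof -
  interpret C: finite_measure_subalgebra M "inv_alg M" by (rule subalgebra_inv_alg)
  show ?thesis unfolding cond_cyl_def
    by (rule C.real_cond_exp_pos) (use cyl_sets in auto)
qed

lemma integrable_cond_cyl: "integrable M (cond_cyl M x)"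
proof -
  interpret C: finite_measure_subalgebra M "inv_alg M" by (rule subalgebra_inv_alg)
  show ?thesis unfolding cond_cyl_def by (rule C.real_cond_exp_int(1)[OF integrable_cyl])
qed

text \<open>Integrating the conditional probability over the invariant set
  \<open>\<Union>n. absent n x\<close> gives the measure of its intersection with
  \<open>cyl x\<close>, which is zero by recurrence. So the conditional probability vanishes there,
  and outside this set \<open>x\<close> occurs in the sequence.\<close>

lemma cond_cyl_subword: "AE \<omega> in M. 0 < cond_cyl M x \<omega> \<longrightarrow> x \<in> subwords (length x) \<omega>"
proof -
  interpret C: finite_measure_subalgebra M "inv_alg M" by (rule subalgebra_inv_alg)
  let ?A = "\<Union>n. absent n x"
  have A: "?A \<in> sets (inv_alg M)" using absent_invariant sets_inv_alg by simp
  have AM: "?A \<in> sets M" using absent_sets by blast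
  have "(\<integral>\<omega>. indicator ?A \<omega> * cond_cyl M x \<omega> \<partial>M) = (LINT \<omega>:?A|M. indicator (cyl x) \<omega>)"
    using C.real_cond_exp_intA[OF integrable_cyl A, of x] by (simp add: cond_cyl_def set_lebesgue_integral_def)
  also have "\<dots> = (\<integral>\<omega>. indicator (?A \<inter> cyl x) \<omega> \<partial>M)"
    unfolding set_lebesgue_integral_def by (simp add: indicator_inter_arith)
  also have "\<dots> = 0" using measure_absent[of x] AM cyl_sets by simp
  finally have i0: "(\<integral>\<omega>. indicator ?A \<omega> * cond_cyl M x \<omega> \<partial>M) = 0" .
  have "integrable M (\<lambda>\<omega>. indicator ?A \<omega> * cond_cyl M x \<omega>)"
    using integrable_mult_indicator[OF AM integrable_cond_cyl, of x] by simp
  moreover have "AE \<omega> in M. 0 \<le> indicator ?A \<omega> * cond_cyl M x \<omega>"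
    using cond_cyl_nonneg[of x] by eventually_elim (simp add: indicator_def)
  ultimately have "AE \<omega> in M. indicator ?A \<omega> * cond_cyl M x \<omega> = 0"
    using integral_nonneg_eq_0_iff_AE i0 by blast
  then show ?thesis
  proof eventually_elim
    case (elim \<omega>)
    show ?case
    proof
      assume "0 < cond_cyl M x \<omega>"
      then have "\<omega> \<notin> ?A" using elim by (auto simp: indicator_def)
      then have "\<omega> \<notin> absent 0 x" by blast
      then obtain i where "(shift ^^ i) \<omega> \<in> cyl x" by (auto simp: absent_def)
      then have "prefix (length x) (\<lambda>j. \<omega> (i + j)) = x" by (simp add: shift_funpow cyl_iff)
      then show "x \<in> subwords (length x) \<omega>" unfolding prefix_def subwords_def
        by (intro CollectI exI[of _ i]) simp
    qed
  qed
qed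

lemma sum_cond_cyl: "AE \<omega> in M. (\<Sum>x | set x \<subseteq> {1..k 0} \<and> length x = m. cond_cyl M x \<omega>) = 1"
proof -
  interpret C: finite_measure_subalgebra M "inv_alg M" by (rule subalgebra_inv_alg)
  let ?W = "{x. set x \<subseteq> {1..k 0} \<and> length x = m}"
  let ?f = "\<lambda>\<omega>. \<Sum>x\<in>?W. indicator (cyl x) \<omega> :: real"
  have 1: "AE \<omega> in M. real_cond_exp M (inv_alg M) ?f \<omega> = (\<Sum>x\<in>?W. cond_cyl M x \<omega>)"
    unfolding cond_cyl_def by (rule C.real_cond_exp_sum) (rule integrable_cyl)
  have "AE \<omega> in M. ?f \<omega> = 1"
    using AE_prefix_alphabet
  proof eventually_elim
    case (elim \<omega>)
    have "?f \<omega> = (\<Sum>x\<in>?W. if x = prefix m \<omega> then 1 else 0)"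
      by (intro sum.cong refl) (auto simp: indicator_def cyl_iff)
    then show ?case using elim finite_words[of m] by (simp add: sum.delta)
  qed
  then have 2: "AE \<omega> in M. real_cond_exp M (inv_alg M) ?f \<omega> = real_cond_exp M (inv_alg M) (\<lambda>_. 1) \<omega>"
    by (rule C.real_cond_exp_cong) (use cyl_sets in auto)
  have "AE \<omega> in M. real_cond_exp M (inv_alg M) (\<lambda>_. 1 :: real) \<omega> = 1"
    by (rule C.real_cond_exp_F_meas) auto
  then show ?thesis using 1 2 by eventually_elim simp
qed

lemma words_commute: "{x. length x = m \<and> set x \<subseteq> {1..k 0}} = {x. set x \<subseteq> {1..k 0} \<and> length x = m}"
  by blast

text \<open>The random ergodic measure charges only subwords of the sequence, so its block entropy
  is at most the logarithm of their number.\<close>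

lemma EH_F_le:
  assumes sub: "AE \<omega> in M. finite (subwords m \<omega>) \<and> card (subwords m \<omega>) \<le> c" and c: "0 < c"
  shows "EH_F M (k 0) m \<le> ln c"
proof -
  let ?W = "{x. set x \<subseteq> {1..k 0} \<and> length x = m}"
  let ?f = "\<lambda>\<omega>. \<Sum>x\<in>?W. - (cond_cyl M x \<omega> * ln (cond_cyl M x \<omega>))"
  have "AE \<omega> in M. \<forall>x\<in>?W. 0 \<le> cond_cyl M x \<omega>"
    using cond_cyl_nonneg finite_words[of m] by (subst AE_ball_countable) (auto intro: countable_finite)
  moreover have "AE \<omega> in M. \<forall>x\<in>?W. 0 < cond_cyl M x \<omega> \<longrightarrow> x \<in> subwords (length x) \<omega>"
    using cond_cyl_subword finite_words[of m] by (subst AE_ball_countable) (auto intro: countable_finite)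
  ultimately have le: "AE \<omega> in M. ?f \<omega> \<le> ln c"
    using sum_cond_cyl[of m] sub
  proof eventually_elim
    case (elim \<omega>)
    have "{x \<in> ?W. 0 < cond_cyl M x \<omega>} \<subseteq> subwords m \<omega>" using elim(2) by auto
    then have "card {x \<in> ?W. 0 < cond_cyl M x \<omega>} \<le> card (subwords m \<omega>)"
      using elim(4) by (intro card_mono) auto
    then have "card {x \<in> ?W. 0 < cond_cyl M x \<omega>} \<le> c" using elim(4) by linarith
    then show ?case using elim(1,3) c by (intro entropy_le_ln_card[OF finite_words]) auto
  qed
  have "EH_F M (k 0) m = (\<integral>\<omega>. ?f \<omega> \<partial>M)" unfolding EH_F_def words_commute ..
  also have "\<dots> \<le> ln c"
  proof (cases "integrable M ?f")
    case True
    then show ?thesis by (rule integral_le_const[OF _ le])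
  next
    \<comment> \<open>The integral then has the default value 0, and \<open>ln c\<close> is
      nonnegative because \<open>c\<close> is a positive natural number.\<close>
    case False
    then have "(\<integral>\<omega>. ?f \<omega> \<partial>M) = 0" by (rule not_integrable_integral_eq)
    then show ?thesis using c by simp
  qed
  finally show ?thesis .
qed

text \<open>For use in a contradiction: if invariant sets are trivial, the constant
  \<open>measure M (cyl x)\<close> satisfies the defining property of the conditional
  probability.\<close>

lemma EH_F_ergodic:
  assumes "ergodic M"
  shows "EH_F M (k 0) m = H_mu M m"
proof -
  interpret C: finite_measure_subalgebra M "inv_alg M" by (rule subalgebra_inv_alg)
  let ?W = "{x. set x \<subseteq> {1..k 0} \<and> length x = m}"
  have "AE \<omega> in M. cond_cyl M x \<omega> = measure M (cyl x)" for x
    unfolding cond_cyl_def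
  proof (rule C.real_cond_exp_charact[OF _ integrable_cyl])
    fix A assume "A \<in> sets (inv_alg M)"
    then have A: "A \<in> invariant_sets M" "A \<in> sets M" unfolding sets_inv_alg by (auto simp: invariant_sets_def)
    have "(LINT \<omega>:A|M. indicator (cyl x) \<omega>) = measure M (A \<inter> cyl x)"
      unfolding set_lebesgue_integral_def using A(2) cyl_sets
      by (simp add: indicator_inter_arith[symmetric])
    also have "\<dots> = measure M A * measure M (cyl x)"
    proof -
      consider "measure M A = 0" | "measure M A = 1" using assms A(1) unfolding ergodic_def by blast
      then show ?thesis
      proof cases
        case 1
        have "measure M (A \<inter> cyl x) \<le> measure M A" by (rule finite_measure_mono) (use A in auto)
        then show ?thesis using 1 by (simp add: measure_le_0_iff)
      next
        case 2
        then have "AE \<omega> in M. \<omega> \<in> A" using A(2) by (simp add: prob_eq_1)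
        then have "measure M (A \<inter> cyl x) = measure M (cyl x)"
          using A(2) cyl_sets by (intro measure_eq_AE) auto
        then show ?thesis using 2 by simp
      qed
    qed
    also have "\<dots> = (LINT \<omega>:A|M. measure M (cyl x))"
      using A(2) by (simp add: set_lebesgue_integral_def)
    finally show "(LINT \<omega>:A|M. indicator (cyl x) \<omega>) = (LINT \<omega>:A|M. measure M (cyl x))" .
  qed auto
  then have "AE \<omega> in M. \<forall>x\<in>?W. cond_cyl M x \<omega> = measure M (cyl x)"
    using finite_words[of m] by (subst AE_ball_countable) (auto intro: countable_finite)
  then have "AE \<omega> in M. (\<Sum>x\<in>?W. - (cond_cyl M x \<omega> * ln (cond_cyl M x \<omega>))) = H_mu M m"
    unfolding H_mu_eq_sum by eventually_elim simp
  moreover have "(\<lambda>\<omega>. \<Sum>x\<in>?W. - (cond_cyl M x \<omega> * ln (cond_cyl M x \<omega>))) \<in> borel_measurable M"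
    using borel_measurable_integrable[OF integrable_cond_cyl] by measurable
  ultimately have "(\<integral>\<omega>. (\<Sum>x\<in>?W. - (cond_cyl M x \<omega> * ln (cond_cyl M x \<omega>))) \<partial>M) = (\<integral>\<omega>. H_mu M m \<partial>M)"
    by (intro integral_cong_AE) auto
  then show ?thesis unfolding EH_F_def words_commute by (simp add: prob_space)
qed

end

section \<open>Stretched exponential perplexities\<close>

locale hilberg = rha_mean k M for k M +
  fixes \<beta> :: real
  assumes k_eq: "k n = nat \<lfloor>exp (2 powr (\<beta> * real n))\<rfloor>"
    and \<beta>: "0 < \<beta>" "\<beta> < 1"
begin

text \<open>The logarithm of \<open>k q\<close> before rounding, comparable to
  \<open>ln (k q)\<close>. By \<open>lk_powr_inverse\<close> its power \<open>1 / \<beta>\<close> is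
  the word length \<open>2 ^ q\<close>.\<close>

definition lk :: "nat \<Rightarrow> real" where
  "lk q = 2 powr (\<beta> * real q)"

lemma lk_ge_1: "1 \<le> lk q"
  unfolding lk_def using \<beta> by (intro ge_one_powr_ge_zero) auto

lemma k_le: "real (k q) \<le> exp (lk q)"
  unfolding k_eq lk_def by (simp add: of_nat_nat)

lemma k_ge: "exp (lk q) / 2 \<le> real (k q)"
proof -
  have "2 \<le> exp (lk q)" using exp_ge_add_one_self[of "lk q"] lk_ge_1[of q] by linarith
  moreover have "exp (lk q) - 1 \<le> real (k q)"
    unfolding k_eq lk_def by (simp add: of_nat_nat)
  ultimately show ?thesis by linarith
qed

lemma ln_k_le: "ln (real (k q)) \<le> lk q"
proof -
  have "ln (real (k q)) \<le> ln (exp (lk q))" using k_le[of q] k_ge_2[of q] by (subst ln_le_cancel_iff) auto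
  then show ?thesis by simp
qed

lemma ln_k_ge: "lk q / 4 \<le> ln (real (k q))"
proof -
  have "ln (exp (lk q) / 2) \<le> ln (real (k q))" using k_ge[of q] k_ge_2[of q] by (subst ln_le_cancel_iff) auto
  moreover have "ln (exp (lk q) / 2) = lk q - ln 2" by (simp add: ln_div)
  moreover have "ln (2::real) \<le> 3 / 4" using ln2_le_25_over_36 by simp
  ultimately show ?thesis using lk_ge_1[of q] by linarith
qed

lemma lk_powr_inverse: "lk q powr (1 / \<beta>) = 2 ^ q"
  using \<beta> by (simp add: lk_def powr_powr powr_realpow)

lemma lk_Suc: "lk (Suc q) \<le> 2 * lk q"
proof -
  have "lk (Suc q) = 2 powr \<beta> * lk q" by (simp add: lk_def powr_add[symmetric] algebra_simps)
  also have "2 powr \<beta> \<le> 2 powr 1" using \<beta> by (intro powr_mono) auto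
  then have "2 powr \<beta> * lk q \<le> 2 * lk q" using lk_ge_1[of q] by (intro mult_right_mono) auto
  finally show ?thesis .
qed

lemma lk_mono: "q \<le> q' \<Longrightarrow> lk q \<le> lk q'"
  unfolding lk_def using \<beta> by (intro powr_mono mult_left_mono) auto

section \<open>Choosing the level for a given scale\<close>

lemma level_bracket:
  assumes t: "1 \<le> t"
  obtains q where "lk q \<le> t" "t < lk (Suc q)"
proof -
  have "filterlim lk at_top sequentially"
    unfolding lk_def using \<beta> by real_asymp
  then have "\<forall>\<^sub>F n in sequentially. t < lk n" by (rule filterlim_at_top_dense[THEN iffD1, rule_format])
  then obtain n where n: "t < lk n" by (metis eventually_sequentially order_refl)
  define r where "r = (LEAST n. t < lk n)"
  have r: "t < lk r" unfolding r_def by (rule LeastI[of "\<lambda>n. t < lk n" n]) (rule n)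
  have "r \<noteq> 0" using r t by (auto simp: lk_def intro!: Nat.gr0I)
  then obtain q where q: "r = Suc q" by (cases r) auto
  then have "\<not> t < lk q" using not_less_Least[of q "\<lambda>n. t < lk n"] r_def by simp
  then show ?thesis using that[of q] r q by simp
qed

text \<open>For arguments that need few labels: pigeonhole and the cost of spelling out the word
  list.\<close>

lemma level_below:
  assumes t: "1 \<le> t"
  obtains q where "lk q \<le> t" "2 ^ q \<le> t powr (1 / \<beta>)" "t powr (1 / \<beta>) \<le> 2 * 2 ^ q"
proof -
  obtain q where q: "lk q \<le> t" "t < lk (Suc q)" using level_bracket[OF t] .
  have "lk q powr (1 / \<beta>) \<le> t powr (1 / \<beta>)" using q \<beta> lk_ge_1[of q] by (intro powr_mono2) auto
  moreover have "t powr (1 / \<beta>) \<le> lk (Suc q) powr (1 / \<beta>)" using q \<beta> t by (intro powr_mono2) auto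
  ultimately show ?thesis using that[of q] q(1) by (simp add: lk_powr_inverse)
qed

text \<open>For arguments that need many labels or long words: improbable repetitions, and subwords
  that fit into two blocks.\<close>

lemma level_above:
  assumes t: "1 \<le> t"
  obtains q where "t \<le> lk q" "lk q \<le> 2 * t" "2 ^ q \<le> 2 * t powr (1 / \<beta>)" "t powr (1 / \<beta>) \<le> 2 ^ q"
proof -
  obtain q where q: "lk q \<le> t" "t < lk (Suc q)" using level_bracket[OF t] .
  have "lk q powr (1 / \<beta>) \<le> t powr (1 / \<beta>)" using q \<beta> lk_ge_1[of q] by (intro powr_mono2) auto
  moreover have "t powr (1 / \<beta>) \<le> lk (Suc q) powr (1 / \<beta>)" using q \<beta> t by (intro powr_mono2) auto
  moreover have "lk (Suc q) \<le> 2 * t" using lk_Suc[of q] q(1) by linarith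
  ultimately show ?thesis using that[of "Suc q"] q(2) by (simp add: lk_powr_inverse)
qed

text \<open>From \<open>exp x \<ge> 1 + x\<close> and \<open>lk q \<ge> 1\<close>, the exponent
  \<open>lk\<close> grows by at least \<open>\<beta> * i * ln 2\<close> over \<open>i\<close>
  levels, so the terms are dominated by a geometric series of ratio \<open>2 powr - \<beta>\<close>.
  The 8 is 4 times the rounding factor 2 of \<open>k_ge\<close>.\<close>

lemma tail_sum_le: "(\<Sum>i<h. 4 / real (k (Suc q + i))) \<le> 8 / (1 - 2 powr - \<beta>) * exp (- lk q)"
proof -
  define r where "r = 2 powr - \<beta>"
  have r: "0 < r" "r < 1" using \<beta> by (auto simp: r_def powr_less_one)
  have "(\<Sum>i<h. 4 / real (k (Suc q + i))) \<le> (\<Sum>i<h. 8 * exp (- lk q) * r ^ i)"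
  proof (rule sum_mono)
    fix i
    let ?a = "lk (Suc q + i)"
    have "1 + \<beta> * real (Suc i) * ln 2 \<le> exp (\<beta> * real (Suc i) * ln 2)" by (rule exp_ge_add_one_self)
    also have "\<dots> = lk (Suc i)" by (simp add: lk_def powr_def mult.commute mult.left_commute)
    finally have "lk q * (1 + \<beta> * real (Suc i) * ln 2) \<le> lk q * lk (Suc i)"
      using lk_ge_1[of q] by (intro mult_left_mono) auto
    also have "\<dots> = ?a" by (simp add: lk_def powr_add[symmetric] algebra_simps)
    finally have "lk q + lk q * (\<beta> * real (Suc i) * ln 2) \<le> ?a" by (simp add: algebra_simps)
    moreover have "1 * (\<beta> * real (Suc i) * ln 2) \<le> lk q * (\<beta> * real (Suc i) * ln 2)"
      using lk_ge_1[of q] \<beta> by (intro mult_right_mono) auto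
    moreover have "\<beta> * real i * ln 2 \<le> \<beta> * real (Suc i) * ln 2" using \<beta> by (intro mult_right_mono mult_left_mono) auto
    ultimately have a: "lk q + \<beta> * real i * ln 2 \<le> ?a" by linarith
    have "4 / real (k (Suc q + i)) \<le> 4 / (exp ?a / 2)"
      using k_ge[of "Suc q + i"] k_ge_2[of "Suc q + i"] by (intro divide_left_mono mult_pos_pos) auto
    also have "\<dots> = 8 * exp (- ?a)" by (simp add: exp_minus field_simps)
    also have "\<dots> \<le> 8 * exp (- lk q - \<beta> * real i * ln 2)" using a by simp
    also have "\<dots> = 8 * exp (- lk q) * r ^ i"
    proof -
      have "r ^ i = exp (- (\<beta> * real i * ln 2))"
        by (simp add: r_def powr_def exp_of_nat_mult[symmetric] algebra_simps)
      then show ?thesis by (simp add: exp_add[symmetric])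
    qed
    finally show "4 / real (k (Suc q + i)) \<le> 8 * exp (- lk q) * r ^ i" .
  qed
  also have "\<dots> = 8 * exp (- lk q) * (\<Sum>i<h. r ^ i)" by (simp add: sum_distrib_left)
  also have "(\<Sum>i<h. r ^ i) \<le> 1 / (1 - r)"
    using sum_le_suminf[of "\<lambda>i. r ^ i" "{..<h}"] r by (simp add: suminf_geometric summable_geometric)
  then have "8 * exp (- lk q) * (\<Sum>i<h. r ^ i) \<le> 8 * exp (- lk q) * (1 / (1 - r))"
    by (intro mult_left_mono) auto
  finally show ?thesis by (simp add: r_def)
qed

text \<open>Twice the constant of \<open>tail_sum_le\<close>, plus 64 times the 4 that comes from
  squaring the rounding factor in \<open>k_ge\<close>.\<close>

definition rep_const :: real where
  "rep_const = 16 / (1 - 2 powr - \<beta>) + 256"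

lemma rep_const_pos: "0 < rep_const"
proof -
  have "2 powr - \<beta> < 1" using \<beta> by (simp add: powr_less_one)
  then show ?thesis unfolding rep_const_def by (intro add_pos_pos) auto
qed

lemma measure_has_rep_le: "measure M {\<omega>. has_rep (4 * 2 ^ q) (prefix m \<omega>)} \<le> (real m)\<^sup>2 * rep_const * exp (- lk q)"
proof -
  let ?S = "8 / (1 - 2 powr - \<beta>) * exp (- lk q)"
  have "measure M {\<omega>. has_rep (4 * 2 ^ q) (prefix m \<omega>)} \<le> (real m)\<^sup>2 * (2 * ?S + 64 / (real (k q))\<^sup>2)"
    by (rule measure_has_rep[OF tail_sum_le]) simp
  also have "\<dots> \<le> (real m)\<^sup>2 * (2 * ?S + 256 * exp (- lk q))"
  proof (intro mult_left_mono add_left_mono)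
    have "(exp (lk q) / 2)\<^sup>2 \<le> (real (k q))\<^sup>2" using k_ge[of q] by (intro power_mono) auto
    then have "64 / (real (k q))\<^sup>2 \<le> 64 / (exp (lk q) / 2)\<^sup>2"
      using k_ge_2[of q] by (intro divide_left_mono mult_pos_pos) auto
    also have "\<dots> = 256 * (exp (- lk q) * exp (- lk q))" by (simp add: exp_minus power2_eq_square field_simps)
    also have "\<dots> \<le> 256 * (exp (- lk q) * 1)" using lk_ge_1[of q] by (intro mult_left_mono) auto
    finally show "64 / (real (k q))\<^sup>2 \<le> 256 * exp (- lk q)" by simp
  qed simp
  also have "\<dots> = (real m)\<^sup>2 * rep_const * exp (- lk q)" by (simp add: rep_const_def algebra_simps)
  finally show ?thesis .
qed

section \<open>Almost sure absence of long repetitions\<close>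

lemma ln_ge_1: "3 \<le> m \<Longrightarrow> 1 \<le> ln (real m)"
  using exp_le ln_le_cancel_iff[of "exp 1" "real m"] by simp

text \<open>The factor 4 makes \<open>exp (- lk q)\<close> at most \<open>m\<close> to the power -4;
  the square from the union over positions then leaves a summable bound.\<close>

lemma rep_level:
  assumes m: "3 \<le> m"
  obtains q where "4 * ln (real m) \<le> lk q" "2 ^ q \<le> 2 * (4 * ln (real m)) powr (1 / \<beta>)"
    "measure M {\<omega>. has_rep (4 * 2 ^ q) (prefix m \<omega>)} \<le> rep_const / (real m)\<^sup>2"
proof -
  have "1 \<le> 4 * ln (real m)" using ln_ge_1[OF m] by linarith
  then obtain q where q: "4 * ln (real m) \<le> lk q" "2 ^ q \<le> 2 * (4 * ln (real m)) powr (1 / \<beta>)"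
    using level_above by blast
  have "exp (- lk q) \<le> exp (- (4 * ln (real m)))" using q(1) by simp
  also have "\<dots> = 1 / (real m) ^ 4"
  proof -
    have "exp (4 * ln (real m)) = (real m) ^ 4" using m exp_of_nat_mult[of 4 "ln (real m)"] by simp
    then show ?thesis by (simp add: exp_minus inverse_eq_divide)
  qed
  finally have "(real m)\<^sup>2 * rep_const * exp (- lk q) \<le> (real m)\<^sup>2 * rep_const * (1 / (real m) ^ 4)"
    using rep_const_pos by (intro mult_left_mono) auto
  also have "\<dots> = rep_const / (real m)\<^sup>2" using m by (simp add: field_simps power2_eq_square power4_eq_xxxx)
  finally have "measure M {\<omega>. has_rep (4 * 2 ^ q) (prefix m \<omega>)} \<le> rep_const / (real m)\<^sup>2"
    using measure_has_rep_le[of q m] by linarith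
  then show ?thesis using that q by blast
qed

text \<open>The factor 8 is the 4 in the repetition length \<open>4 * 2 ^ q\<close> times the factor
  2 of \<open>level_above\<close>.\<close>

definition rep_bound :: "nat \<Rightarrow> real" where
  "rep_bound m = 8 * (4 * ln (real m)) powr (1 / \<beta>)"

lemma AE_no_rep:
  "AE \<omega> in M. \<forall>\<^sub>F m in sequentially. \<exists>l. real l \<le> rep_bound m \<and> \<not> has_rep l (prefix m \<omega>)"
proof -
  \<comment> \<open>The length has to be chosen from \<open>m\<close> alone, so that the events for
    Borel--Cantelli are fixed.\<close>
  have "\<exists>l. 3 \<le> m \<longrightarrow> real l \<le> rep_bound m \<and> measure M {\<omega>. has_rep l (prefix m \<omega>)} \<le> rep_const / (real m)\<^sup>2" for m
  proof (cases "3 \<le> m")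
    case True
    then obtain q where q: "2 ^ q \<le> 2 * (4 * ln (real m)) powr (1 / \<beta>)"
      "measure M {\<omega>. has_rep (4 * 2 ^ q) (prefix m \<omega>)} \<le> rep_const / (real m)\<^sup>2"
      using rep_level by blast
    have "real (4 * 2 ^ q) \<le> rep_bound m" using q(1) by (simp add: rep_bound_def)
    then show ?thesis using q(2) by blast
  qed simp
  then obtain l where l: "\<And>m. 3 \<le> m \<Longrightarrow> real (l m) \<le> rep_bound m \<and> measure M {\<omega>. has_rep (l m) (prefix m \<omega>)} \<le> rep_const / (real m)\<^sup>2"
    by metis
  let ?A = "\<lambda>m. {\<omega>. has_rep (l m) (prefix m \<omega>)}"
  have A: "?A m \<in> sets M" for m using prefix_sets[of m "{x. has_rep (l m) x}"] by simp
  have "summable (\<lambda>m. measure M (?A m))"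
  proof (rule summable_comparison_test)
    have "summable (\<lambda>m. 1 / (real m)\<^sup>2)" using inverse_power_summable[of 2, where 'a = real] by (simp add: inverse_eq_divide)
    then show "summable (\<lambda>m. rep_const * (1 / (real m)\<^sup>2))" by (rule summable_mult)
    show "\<exists>N. \<forall>m\<ge>N. norm (measure M (?A m)) \<le> rep_const * (1 / (real m)\<^sup>2)"
      using l by (intro exI[of _ 3]) auto
  qed
  then have "AE \<omega> in M. \<forall>\<^sub>F m in sequentially. \<omega> \<in> space M - ?A m"
    by (intro borel_cantelli_AE1 A) (auto simp: emeasure_eq_measure)
  then show ?thesis
  proof eventually_elim
    case (elim \<omega>)
    show ?case using elim eventually_ge_at_top[of 3]
    proof eventually_elim
      case (elim m)
      then show ?case using l[of m] by (intro exI[of _ "l m"]) auto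
    qed
  qed
qed

section \<open>Number of distinct subwords\<close>

lemma AE_subwords:
  "AE \<omega> in M. \<forall>q m. m \<le> 2 ^ q \<longrightarrow> finite (subwords m \<omega>) \<and> card (subwords m \<omega>) \<le> 2 ^ q * (k q)\<^sup>2"
  using AE_aligned
proof eventually_elim
  case (elim \<omega>)
  show ?case
  proof (intro allI impI)
    fix q m :: nat assume "m \<le> 2 ^ q"
    moreover have "aligned q (prefix N \<omega>)" for N using elim by blast
    ultimately show "finite (subwords m \<omega>) \<and> card (subwords m \<omega>) \<le> 2 ^ q * (k q)\<^sup>2"
      by (intro aligned_subwords) auto
  qed
qed

text \<open>\<open>1 / \<beta>\<close> pays for the offset and 2 for the two labels; the outer
  factor 2 comes from \<open>level_above\<close>.\<close>

definition top_const :: real where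
  "top_const = 2 * (1 / \<beta> + 2)"

text \<open>The cost of an offset inside a block is at most of the order of the cost of one
  label.\<close>

lemma q_ln2_le: "real q * ln 2 \<le> lk q / \<beta>"
proof -
  have "1 + \<beta> * real q * ln 2 \<le> exp (\<beta> * real q * ln 2)" by (rule exp_ge_add_one_self)
  also have "\<dots> = lk q" by (simp add: lk_def powr_def)
  finally show ?thesis using \<beta> by (simp add: field_simps)
qed

lemma subword_level:
  assumes m: "1 \<le> m"
  obtains q where "m \<le> 2 ^ q" "ln (real (2 ^ q * (k q)\<^sup>2)) \<le> top_const * real m powr \<beta>"
proof -
  have t: "1 \<le> real m powr \<beta>" using m \<beta> by (intro ge_one_powr_ge_zero) auto
  obtain q where q: "lk q \<le> 2 * real m powr \<beta>" "(real m powr \<beta>) powr (1 / \<beta>) \<le> 2 ^ q"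
    using level_above[OF t] by blast
  have "(real m powr \<beta>) powr (1 / \<beta>) = real m" using m \<beta> by (simp add: powr_powr)
  then have "real m \<le> real (2 ^ q)" using q(2) by simp
  then have mq: "m \<le> 2 ^ q" by (simp only: of_nat_le_iff)
  have "ln (real (2 ^ q * (k q)\<^sup>2)) = real q * ln 2 + 2 * ln (real (k q))"
    using k_ge_2[of q] by (simp add: ln_mult ln_realpow)
  also have "\<dots> \<le> lk q / \<beta> + 2 * lk q" using q_ln2_le[of q] ln_k_le[of q] by linarith
  also have "\<dots> = (1 / \<beta> + 2) * lk q" by (simp add: algebra_simps)
  also have "\<dots> \<le> (1 / \<beta> + 2) * (2 * real m powr \<beta>)" using q(1) \<beta> by (intro mult_left_mono) auto
  finally have "ln (real (2 ^ q * (k q)\<^sup>2)) \<le> top_const * real m powr \<beta>"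
    by (simp only: top_const_def mult.assoc mult.left_commute[of 2])
  then show ?thesis using that mq by blast
qed

lemma AE_H_top_upper: "AE \<omega> in M. \<forall>m\<ge>1. H_top m \<omega> \<le> top_const * real m powr \<beta>"
  using AE_subwords
proof eventually_elim
  case (elim \<omega>)
  show ?case
  proof (intro allI impI)
    fix m :: nat assume "1 \<le> m"
    then obtain q where q: "m \<le> 2 ^ q" "ln (real (2 ^ q * (k q)\<^sup>2)) \<le> top_const * real m powr \<beta>"
      using subword_level by blast
    then have c: "finite (subwords m \<omega>)" "card (subwords m \<omega>) \<le> 2 ^ q * (k q)\<^sup>2" using elim by blast+
    then have "0 < card (subwords m \<omega>)" using subwords_nonempty by (simp add: card_gt_0_iff)
    then have "ln (real (card (subwords m \<omega>))) \<le> ln (real (2 ^ q * (k q)\<^sup>2))"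
      using of_nat_mono[OF c(2), where 'a = real] k_ge_2[of q] by (subst ln_le_cancel_iff) auto
    then show "H_top m \<omega> \<le> top_const * real m powr \<beta>" unfolding H_top_subwords using q(2) by linarith
  qed
qed

lemma EH_F_upper: "1 \<le> m \<Longrightarrow> EH_F M (k 0) m \<le> top_const * real m powr \<beta>"
proof -
  assume "1 \<le> m"
  then obtain q where q: "m \<le> 2 ^ q" "ln (real (2 ^ q * (k q)\<^sup>2)) \<le> top_const * real m powr \<beta>"
    using subword_level by blast
  have "EH_F M (k 0) m \<le> ln (real (2 ^ q * (k q)\<^sup>2))"
  proof (rule EH_F_le)
    show "AE \<omega> in M. finite (subwords m \<omega>) \<and> card (subwords m \<omega>) \<le> 2 ^ q * (k q)\<^sup>2"
      using AE_subwords by eventually_elim (use q(1) in blast)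
    show "0 < 2 ^ q * (k q)\<^sup>2" using k_ge_2[of q] by simp
  qed
  then show ?thesis using q(2) by linarith
qed

text \<open>Inverts the repetition bound: a prefix of length about
  \<open>exp (a * m powr \<beta>)\<close> eventually has no repetition of length \<open>m\<close>,
  so nearly all of its windows of that length are different subwords.\<close>

lemma AE_H_top_lower:
  "AE \<omega> in M. \<exists>c>0. \<forall>\<^sub>F m in sequentially. c * real m powr \<beta> \<le> H_top m \<omega>"
  using AE_no_rep AE_subwords
proof eventually_elim
  case (elim \<omega>)
  \<comment> \<open>Chosen so that \<open>8 * (4 * (a * m powr \<beta>)) powr (1 / \<beta>)\<close>
    equals \<open>m\<close>, that is, \<open>rep_bound\<close> at length
    \<open>exp (a * m powr \<beta>)\<close>.\<close>
  define a where "a = 1 / (4 * 8 powr \<beta>)"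
  have a: "0 < a" by (simp add: a_def)
  define N where "N m = nat \<lfloor>exp (a * real m powr \<beta>)\<rfloor>" for m :: nat
  have N: "exp (a * real m powr \<beta>) - 1 \<le> real (N m)" "real (N m) \<le> exp (a * real m powr \<beta>)" for m
    unfolding N_def by (simp_all add: of_nat_nat)
  have "filterlim N at_top sequentially"
  proof -
    have "filterlim (\<lambda>m. exp (a * real m powr \<beta>) - 1) at_top sequentially" using a \<beta> by real_asymp
    then have "filterlim (\<lambda>m. real (N m)) at_top sequentially"
      by (rule filterlim_at_top_mono) (use N in auto)
    then show ?thesis by (simp add: filterlim_sequentially_iff_filterlim_real)
  qed
  then have ev: "\<forall>\<^sub>F m in sequentially. \<exists>l. real l \<le> rep_bound (N m) \<and> \<not> has_rep l (prefix (N m) \<omega>)"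
    using elim(1) by (rule eventually_compose_filterlim[rotated])
  have ev2: "\<forall>\<^sub>F m in sequentially. real m + 1 \<le> exp (a * real m powr \<beta>) / 4" using a \<beta> by real_asymp
  have ev3: "\<forall>\<^sub>F m in sequentially. 2 * ln 4 \<le> a * real m powr \<beta>" using a \<beta> by real_asymp
  have "\<forall>\<^sub>F m in sequentially. a / 2 * real m powr \<beta> \<le> H_top m \<omega>"
    using ev ev2 ev3 eventually_ge_at_top[of 1]
  proof eventually_elim
    case (elim m)
    let ?y = "a * real m powr \<beta>"
    obtain l where l: "real l \<le> rep_bound (N m)" "\<not> has_rep l (prefix (N m) \<omega>)" using elim(1) by blast
    have "1 \<le> B \<and> C \<le> B" if "A - 1 \<le> B" "C + 1 \<le> A / 4" "0 \<le> C" for A B C :: real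
      using that by linarith
    from this[OF N(1) elim(2)] have N1: "1 \<le> real (N m)" and Nm: "real m \<le> real (N m)" by simp_all
    have "ln (real (N m)) \<le> ?y"
    proof -
      have "ln (real (N m)) \<le> ln (exp ?y)" using N(2)[of m] N1 by (subst ln_le_cancel_iff) auto
      then show ?thesis by simp
    qed
    then have "(4 * ln (real (N m))) powr (1 / \<beta>) \<le> (4 * ?y) powr (1 / \<beta>)"
      using N1 \<beta> by (intro powr_mono2) auto
    also have "4 * ?y = (real m / 8) powr \<beta>" by (simp add: a_def powr_divide)
    also have "((real m / 8) powr \<beta>) powr (1 / \<beta>) = real m / 8" using \<beta> by (simp add: powr_powr)
    finally have "rep_bound (N m) \<le> real m" by (simp add: rep_bound_def)
    then have "l \<le> m" using l(1) by linarith
    then have nr: "\<not> has_rep m (prefix (N m) \<omega>)" using l(2) has_rep_mono by blast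
    obtain q where "m \<le> 2 ^ q" using subword_level[OF elim(4)] by blast
    then have fin: "finite (subwords m \<omega>)" using \<open>\<forall>q m. _\<close> by blast
    have mN: "m \<le> N m" using Nm by (simp only: of_nat_le_iff)
    have "real (N m - m + 1) \<le> real (card (subwords m \<omega>))"
      by (rule of_nat_mono[OF card_subwords_ge[OF fin nr mN]])
    then have "real (N m) - real m + 1 \<le> real (card (subwords m \<omega>))" using mN by (simp add: of_nat_diff)
    moreover have "A / 4 \<le> D" if "A - 1 \<le> B" "C + 1 \<le> A / 4" "0 \<le> C" "B - C + 1 \<le> D" for A B C D :: real
      using that by linarith
    ultimately have c: "exp ?y / 4 \<le> real (card (subwords m \<omega>))"
      using N(1) elim(2) of_nat_0_le_iff by blast
    then have "0 < real (card (subwords m \<omega>))" by (rule less_le_trans[rotated]) simp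
    then have "ln (exp ?y / 4) \<le> ln (real (card (subwords m \<omega>)))"
      using c by (subst ln_le_cancel_iff) simp_all
    then have "?y - ln 4 \<le> H_top m \<omega>" unfolding H_top_subwords by (simp add: ln_div)
    then show "a / 2 * real m powr \<beta> \<le> H_top m \<omega>" using elim(3) by linarith
  qed
  then show ?case using a by (intro exI[of _ "a / 2"]) auto
qed

section \<open>Maximal repetition and the Hilberg property\<close>

lemma AE_L_rep_upper:
  "AE \<omega> in M. \<exists>C. \<forall>\<^sub>F m in sequentially. real (L_rep (prefix m \<omega>)) \<le> C * ln (real m) powr (1 / \<beta>)"
  using AE_no_rep
proof eventually_elim
  case (elim \<omega>)
  have "\<forall>\<^sub>F m in sequentially. real (L_rep (prefix m \<omega>)) \<le> (8 * 4 powr (1 / \<beta>)) * ln (real m) powr (1 / \<beta>)"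
    using elim eventually_ge_at_top[of 3]
  proof eventually_elim
    case (elim m)
    then obtain l where l: "real l \<le> rep_bound m" "\<not> has_rep l (prefix m \<omega>)" by blast
    have "prefix m \<omega> \<noteq> []" using elim(2) length_prefix[of m \<omega>] by (metis list.size(3) not_numeral_le_zero)
    then have "\<not> l \<le> L_rep (prefix m \<omega>)" using l(2) le_L_rep_iff_has_rep by blast
    then have "real (L_rep (prefix m \<omega>)) \<le> rep_bound m" using l(1) by linarith
    also have "\<dots> = (8 * 4 powr (1 / \<beta>)) * ln (real m) powr (1 / \<beta>)"
      using ln_ge_1[OF elim(2)] by (simp add: rep_bound_def powr_mult)
    finally show ?case .
  qed
  then show ?case by blast
qed

text \<open>With \<open>lk q\<close> at most half of \<open>ln m\<close> there are at most
  \<open>sqrt m\<close> labels: far fewer than blocks in a prefix of length \<open>m\<close>, and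
  the whole word list is short compared with \<open>m\<close>.\<close>

lemma half_log_level:
  obtains m0 where "3 \<le> m0" "\<And>m. m0 \<le> m \<Longrightarrow> \<exists>q. lk q \<le> ln (real m) / 2 \<and> 2 ^ q \<le> (ln (real m) / 2) powr (1 / \<beta>) \<and>
    (ln (real m) / 2) powr (1 / \<beta>) \<le> 2 * 2 ^ q \<and> real (k q) \<le> sqrt (real m)"
proof -
  have "\<forall>\<^sub>F m in sequentially. 1 \<le> ln (real m) / 2" by real_asymp
  then obtain m1 where m1: "\<And>m. m1 \<le> m \<Longrightarrow> 1 \<le> ln (real m) / 2" by (auto simp: eventually_sequentially)
  have "\<exists>q. lk q \<le> ln (real m) / 2 \<and> 2 ^ q \<le> (ln (real m) / 2) powr (1 / \<beta>) \<and>
    (ln (real m) / 2) powr (1 / \<beta>) \<le> 2 * 2 ^ q \<and> real (k q) \<le> sqrt (real m)" if "max 3 m1 \<le> m" for m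
  proof -
    have t: "1 \<le> ln (real m) / 2" and m: "3 \<le> m" using that m1 by auto
    obtain q where q: "lk q \<le> ln (real m) / 2" "2 ^ q \<le> (ln (real m) / 2) powr (1 / \<beta>)"
      "(ln (real m) / 2) powr (1 / \<beta>) \<le> 2 * 2 ^ q"
      using level_below[OF t] by blast
    have "real (k q) \<le> exp (ln (real m) / 2)" using k_le[of q] q(1) by (meson exp_le_cancel_iff order_trans)
    also have "\<dots> = sqrt (real m)"
      using m by (simp add: ln_sqrt[symmetric])
    finally show ?thesis using q by blast
  qed
  then show ?thesis using that[of "max 3 m1"] by simp
qed

text \<open>The pigeonhole bound holds for every aligned prefix, so \<open>c\<close> and
  \<open>m0\<close> can be chosen outside the almost sure quantifier.\<close>

lemma AE_L_rep_lower:
  "\<exists>c>0. \<exists>m0. AE \<omega> in M. \<forall>m\<ge>m0. c * ln (real m) powr (1 / \<beta>) \<le> real (L_rep (prefix m \<omega>))"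
proof -
  obtain m0 where m0: "3 \<le> m0" "\<And>m. m0 \<le> m \<Longrightarrow> \<exists>q. lk q \<le> ln (real m) / 2 \<and> 2 ^ q \<le> (ln (real m) / 2) powr (1 / \<beta>) \<and>
    (ln (real m) / 2) powr (1 / \<beta>) \<le> 2 * 2 ^ q \<and> real (k q) \<le> sqrt (real m)" using half_log_level by blast
  have "\<forall>\<^sub>F m in sequentially. (sqrt (real m) + 3) * (ln (real m) / 2) powr (1 / \<beta>) \<le> real m"
    using \<beta> by real_asymp
  then obtain m1 where m1: "\<And>m. m1 \<le> m \<Longrightarrow> (sqrt (real m) + 3) * (ln (real m) / 2) powr (1 / \<beta>) \<le> real m"
    by (auto simp: eventually_sequentially)
  define c where "c = (1 / 2) powr (1 / \<beta>) / 2"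
  have "AE \<omega> in M. \<forall>m\<ge>max m0 m1. c * ln (real m) powr (1 / \<beta>) \<le> real (L_rep (prefix m \<omega>))"
    using AE_aligned
  proof eventually_elim
    case (elim \<omega>)
    show ?case
    proof (intro allI impI)
      fix m assume m: "max m0 m1 \<le> m"
      then obtain q where q: "2 ^ q \<le> (ln (real m) / 2) powr (1 / \<beta>)"
        "(ln (real m) / 2) powr (1 / \<beta>) \<le> 2 * 2 ^ q" "real (k q) \<le> sqrt (real m)" using m0(2)[of m] by auto
      have "real (k q + 2) * 2 ^ q \<le> (sqrt (real m) + 3) * (ln (real m) / 2) powr (1 / \<beta>)"
        using q(1,3) by (intro mult_mono) auto
      also have "\<dots> \<le> real m" using m1 m by simp
      finally have "real ((k q + 2) * 2 ^ q) \<le> real m" by (simp only: of_nat_mult of_nat_power of_nat_numeral)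
      then have "(k q + 2) * 2 ^ q \<le> m" by (simp only: of_nat_le_iff)
      then have "k q + 2 \<le> m div 2 ^ q" by (simp add: less_eq_div_iff_mult_less_eq)
      then have "has_rep (2 ^ q) (prefix m \<omega>)" using elim by (intro aligned_has_rep) auto
      moreover have "prefix m \<omega> \<noteq> []" using m m0(1) length_prefix[of m \<omega>] by (metis list.size(3) max.bounded_iff le_zero_eq not_numeral_le_zero)
      ultimately have "2 ^ q \<le> L_rep (prefix m \<omega>)" using le_L_rep_iff_has_rep by blast
      then have L: "2 ^ q \<le> real (L_rep (prefix m \<omega>))" by (metis of_nat_le_iff of_nat_numeral of_nat_power)
      have "1 \<le> ln (real m)" using m m0(1) by (intro ln_ge_1) auto
      then have "c * ln (real m) powr (1 / \<beta>) = (ln (real m) / 2) powr (1 / \<beta>) / 2"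
        by (simp add: c_def powr_divide)
      then show "c * ln (real m) powr (1 / \<beta>) \<le> real (L_rep (prefix m \<omega>))" using q(2) L by linarith
    qed
  qed
  moreover have "0 < c" by (simp add: c_def)
  ultimately show ?thesis by blast
qed

lemma regular_hilberg_M: "regular_hilberg M \<beta>"
proof -
  obtain c m0 where c: "0 < c" "AE \<omega> in M. \<forall>m\<ge>m0. c * ln (real m) powr (1 / \<beta>) \<le> real (L_rep (prefix m \<omega>))"
    using AE_L_rep_lower by blast
  have "AE \<omega> in M. \<forall>m\<ge>max m0 1. real (L_rep (prefix m \<omega>)) \<ge> c * ln (real m) powr (1 / \<beta>) \<and> H_top m \<omega> \<le> top_const * real m powr \<beta>"
    using c(2) AE_H_top_upper by eventually_elim auto
  moreover have "AE \<omega> in M. \<exists>c'>0. \<exists>C'. \<forall>\<^sub>F m in sequentially.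
        real (L_rep (prefix m \<omega>)) \<le> C' * ln (real m) powr (1 / \<beta>) \<and> H_top m \<omega> \<ge> c' * real m powr \<beta>"
    using AE_L_rep_upper AE_H_top_lower
  proof eventually_elim
    case (elim \<omega>)
    then obtain C c' where "\<forall>\<^sub>F m in sequentially. real (L_rep (prefix m \<omega>)) \<le> C * ln (real m) powr (1 / \<beta>)"
      "0 < c'" "\<forall>\<^sub>F m in sequentially. c' * real m powr \<beta> \<le> H_top m \<omega>" by blast
    then show ?case by (intro exI[of _ c'] conjI exI[of _ C]) (auto intro: eventually_conj)
  qed
  ultimately show ?thesis unfolding regular_hilberg_def using stationary_M c(1) by blast
qed

section \<open>Block entropy and redundancy\<close>

definition ent_upper :: real where
  "ent_upper = 2 * 2 powr (1 / \<beta> - 1) + 1"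

text \<open>With \<open>t = ln m / 2\<close> the labels cost at most about
  \<open>2 * m * t powr (1 - 1 / \<beta>)\<close>, which gives the first summand of
  \<open>ent_upper\<close>. The word list, the offset and the three extra labels are of lower order
  and are absorbed by the summand 1. No iterated logarithm is lost.\<close>

lemma H_mu_upper_asymp:
  "\<forall>\<^sub>F m in sequentially. H_mu M m \<le> ent_upper * real m * ln (real m) powr (1 - 1 / \<beta>)"
proof -
  obtain m0 where m0: "3 \<le> m0" "\<And>m. m0 \<le> m \<Longrightarrow> \<exists>q. lk q \<le> ln (real m) / 2 \<and> 2 ^ q \<le> (ln (real m) / 2) powr (1 / \<beta>) \<and>
    (ln (real m) / 2) powr (1 / \<beta>) \<le> 2 * 2 ^ q \<and> real (k q) \<le> sqrt (real m)" using half_log_level by blast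
  have "\<forall>\<^sub>F m in sequentially. sqrt (real m) * (ln (real m) / 2) powr (1 / \<beta>) + (1 / \<beta> + 3) * (ln (real m) / 2)
      \<le> real m * ln (real m) powr (1 - 1 / \<beta>)"
    using \<beta> by real_asymp
  then show ?thesis using eventually_ge_at_top[of m0]
  proof eventually_elim
    case (elim m)
    let ?t = "ln (real m) / 2"
    obtain q where q: "lk q \<le> ?t" "2 ^ q \<le> ?t powr (1 / \<beta>)" "?t powr (1 / \<beta>) \<le> 2 * 2 ^ q" "real (k q) \<le> sqrt (real m)"
      using m0(2)[OF elim(2)] by blast
    have t: "0 < ?t" using ln_ge_1[of m] m0(1) elim(2) by auto
    have k0: "ln (real (k 0)) \<le> 1" using ln_k_le[of 0] by (simp add: lk_def)
    have "H_mu M m \<le> real (k q) * 2 ^ q * ln (k 0) + q * ln 2 + (real (m div 2 ^ q) + 3) * ln (k q)"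
      by (rule H_mu_upper)
    also have "\<dots> \<le> sqrt (real m) * ?t powr (1 / \<beta>) * 1 + ?t / \<beta> + (2 * real m / ?t powr (1 / \<beta>) + 3) * ?t"
    proof (intro add_mono mult_mono)
      show "real q * ln 2 \<le> ?t / \<beta>" using q_ln2_le[of q] q(1) \<beta> by (meson divide_right_mono less_imp_le order_trans)
      show "ln (real (k q)) \<le> ?t" using ln_k_le[of q] q(1) by linarith
      have "real (m div 2 ^ q) \<le> real m / 2 ^ q" using of_nat_div_le_of_nat[of m "2 ^ q", where 'a = real] by simp
      also have "\<dots> \<le> real m / (?t powr (1 / \<beta>) / 2)" using q(3) t by (intro divide_left_mono) auto
      finally show "real (m div 2 ^ q) \<le> 2 * real m / ?t powr (1 / \<beta>)" by (simp add: mult.commute)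
      show "0 \<le> ln (real (k 0))" "0 \<le> ln (real (k q))" using k_ge_2[of 0] k_ge_2[of q] by auto
    qed (use q t k0 in auto)
    also have "\<dots> = (sqrt (real m) * ?t powr (1 / \<beta>) + (1 / \<beta> + 3) * ?t) + 2 * real m * (?t / ?t powr (1 / \<beta>))"
      by (simp add: algebra_simps)
    also have "?t / ?t powr (1 / \<beta>) = ?t powr (1 - 1 / \<beta>)" using t by (simp add: powr_diff)
    also have "\<dots> = 2 powr (1 / \<beta> - 1) * ln (real m) powr (1 - 1 / \<beta>)"
      using t by (simp add: powr_divide powr_minus_divide[symmetric] powr_diff field_simps)
    finally show ?case using elim(1) by (simp add: ent_upper_def algebra_simps)
  qed
qed

text \<open>The number of blocks is about \<open>m / (8 * (4 * ln m) powr (1 / \<beta>))\<close>. Of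
  the remaining factor 4, one 2 is for the probability \<open>1 / 2\<close> of having no repetition
  and one 2 absorbs the rounding loss \<open>ln m\<close>.\<close>

definition ent_lower :: real where
  "ent_lower = 1 / (32 * 4 powr (1 / \<beta>))"

text \<open>With probability at least \<open>1 / 2\<close> the prefix has no repetition of block
  length, and then each of its \<open>J\<close> complete blocks contributes information at least
  \<open>ln m\<close>.\<close>

lemma H_mu_lower_asymp:
  "\<forall>\<^sub>F m in sequentially. ent_lower * real m * ln (real m) powr (1 - 1 / \<beta>) \<le> H_mu M m"
proof -
  have "\<forall>\<^sub>F m in sequentially. rep_const / (real m)\<^sup>2 \<le> 1 / 2" by real_asymp
  moreover have "\<forall>\<^sub>F m in sequentially. ln (real m) \<le>
      ent_lower * real m * ln (real m) powr (1 - 1 / \<beta>)"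
    unfolding ent_lower_def using \<beta> by real_asymp
  ultimately show ?thesis using eventually_ge_at_top[of 3]
  proof eventually_elim
    case (elim m)
    obtain q where q: "4 * ln (real m) \<le> lk q" "2 ^ q \<le> 2 * (4 * ln (real m)) powr (1 / \<beta>)"
      "measure M {\<omega>. has_rep (4 * 2 ^ q) (prefix m \<omega>)} \<le> rep_const / (real m)\<^sup>2"
      using rep_level[OF elim(3)] .
    have ln1: "1 \<le> ln (real m)" by (rule ln_ge_1[OF elim(3)])
    \<comment> \<open>The shift by one makes the block length \<open>2 ^ Suc Q\<close> equal to the
      repetition length \<open>4 * 2 ^ q\<close>.\<close>
    define Q where "Q = Suc q"
    have LQ: "2 ^ Suc Q = (4 * 2 ^ q :: nat)" by (simp add: Q_def)
    have lkQ: "4 * ln (real m) \<le> lk Q" using q(1) lk_mono[of q Q] by (simp add: Q_def)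
    have "(real m) ^ 4 \<le> exp (lk Q)"
    proof -
      have "(real m) ^ 4 = exp (4 * ln (real m))" using elim(3) exp_of_nat_mult[of 4 "ln (real m)"] by simp
      then show ?thesis using lkQ by simp
    qed
    then have "(real m) ^ 4 / 2 \<le> real (k Q)" using k_ge[of Q] by linarith
    moreover have "real m * 2 \<le> (real m) ^ 4"
    proof -
      have "2 \<le> real m" using elim(3) by simp
      moreover have "real m ^ 1 \<le> real m ^ 3" using elim(3) by (intro power_increasing) auto
      ultimately have "2 \<le> real m ^ 3" unfolding power_one_right by (rule order_trans)
      then have "real m * 2 \<le> real m * real m ^ 3" by (intro mult_left_mono) auto
      also have "real m * real m ^ 3 = real m ^ 4" by (simp add: power_numeral_reduce)
      finally show ?thesis .
    qed
    ultimately have mk: "real m \<le> real (k Q)" by linarith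
    define J where "J = m div 2 ^ Suc Q - 1"
    have "J \<le> m" unfolding J_def by (meson diff_le_self div_le_dividend le_trans)
    have k2: "2 * real (k Q) \<le> (real (k Q))\<^sup>2" using k_ge_2[of Q] by (simp add: power2_eq_square)
    \<comment> \<open>As \<open>J \<le> m \<le> k Q\<close>, subtracting \<open>J\<close> leaves at
      least \<open>k Q\<close> of the square, hence a factor whose logarithm is at least
      \<open>lk Q / 4 \<ge> ln m\<close>.\<close>
    have Jk: "real (k Q) \<le> (real (k Q))\<^sup>2 - real J" using \<open>J \<le> m\<close> mk k2 by linarith
    have "0 < real (k Q)" using k_ge_2[of Q] by simp
    then have "real J < (real (k Q))\<^sup>2" using Jk by linarith
    then have JN: "J < (k Q)\<^sup>2" by (simp only: of_nat_power[symmetric] of_nat_less_iff)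
    let ?b = "1 / ((real (k Q))\<^sup>2 - real J) ^ J"
    have one: "1 \<le> (real (k Q))\<^sup>2 - real J" using Jk k_ge_2[of Q] by linarith
    have "0 < 1 / b \<and> 1 / b \<le> 1" if "1 \<le> b" for b :: real using that by simp
    from this[OF one_le_power[OF one]] have b: "0 < ?b" "?b \<le> 1" by blast+
    have "measure M {\<omega>. \<not> has_rep (4 * 2 ^ q) (prefix m \<omega>)} * - ln ?b \<le> H_mu M m"
    proof (rule H_mu_lower)
      fix x :: "nat list" assume "length x = m" "\<not> has_rep (4 * 2 ^ q) x"
      then show "measure M (cyl x) \<le> ?b"
        using measure_cyl_nonrepetitive[of x m Q] JN LQ unfolding J_def by simp
    next
      show "0 < ?b" "?b \<le> 1" by (fact b)+
    qed
    moreover have "1 / 2 * (real J * ln (real m)) \<le> measure M {\<omega>. \<not> has_rep (4 * 2 ^ q) (prefix m \<omega>)} * - ln ?b"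
    proof (rule mult_mono)
      have "{\<omega>. \<not> has_rep (4 * 2 ^ q) (prefix m \<omega>)} = space M - {\<omega>. has_rep (4 * 2 ^ q) (prefix m \<omega>)}"
        by (auto simp: space_M)
      moreover have "{\<omega>. has_rep (4 * 2 ^ q) (prefix m \<omega>)} \<in> sets M"
        using prefix_sets[of m "{x. has_rep (4 * 2 ^ q) x}"] by simp
      ultimately have "measure M {\<omega>. \<not> has_rep (4 * 2 ^ q) (prefix m \<omega>)} =
          1 - measure M {\<omega>. has_rep (4 * 2 ^ q) (prefix m \<omega>)}" using prob_compl by simp
      then show "1 / 2 \<le> measure M {\<omega>. \<not> has_rep (4 * 2 ^ q) (prefix m \<omega>)}" using q(3) elim(1) by linarith
      have "ln (real m) \<le> lk Q / 4" using lkQ by linarith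
      also have "\<dots> \<le> ln (real (k Q))" by (rule ln_k_ge)
      also have "\<dots> \<le> ln ((real (k Q))\<^sup>2 - real J)" using Jk one \<open>0 < real (k Q)\<close> by (subst ln_le_cancel_iff) linarith+
      finally have "real J * ln (real m) \<le> real J * ln ((real (k Q))\<^sup>2 - real J)" by (intro mult_left_mono) auto
      also have "\<dots> = - ln ?b"
      proof -
        have "real J * ln X = - ln (1 / X ^ J)" if "0 < X" for X :: real
          using that by (simp add: ln_div ln_realpow)
        then show ?thesis using one by (meson less_le_trans zero_less_one)
      qed
      finally show "real J * ln (real m) \<le> - ln ?b" .
    qed (use ln1 in auto)
    moreover have "ent_lower * real m * ln (real m) powr (1 - 1 / \<beta>) \<le> 1 / 2 * (real J * ln (real m))"
    proof -
      let ?L = "real (4 * 2 ^ q)"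
      have L: "0 < ?L" "?L \<le> 8 * (4 * ln (real m)) powr (1 / \<beta>)" using q(2) by auto
      have "real m < (real (m div (4 * 2 ^ q)) + 1) * ?L"
      proof -
        have "m < (m div (4 * 2 ^ q) + 1) * (4 * 2 ^ q)" by (rule less_div_add_one_mult) simp
        then have "real m < real ((m div (4 * 2 ^ q) + 1) * (4 * 2 ^ q))" by (simp only: of_nat_less_iff)
        then show ?thesis by (simp only: of_nat_mult of_nat_add of_nat_1)
      qed
      then have "real m / ?L < real (m div (4 * 2 ^ q)) + 1" using L(1) by (simp add: pos_divide_less_eq)
      then have J: "real m / ?L - 2 \<le> real J" unfolding J_def LQ
      proof -
        have "real n - 1 \<le> real (n - 1)" for n by (cases n) auto
        from this[of "m div (4 * 2 ^ q)"] show "real m / ?L - 2 \<le> real (m div (4 * 2 ^ q) - 1)"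
          using \<open>real m / ?L < real (m div (4 * 2 ^ q)) + 1\<close> by linarith
      qed
      have "real m / (8 * (4 * ln (real m)) powr (1 / \<beta>)) \<le> real m / ?L"
        using L ln1 by (intro divide_left_mono mult_pos_pos) auto
      also have "real m / (8 * (4 * ln (real m)) powr (1 / \<beta>)) = 4 * ent_lower * real m * ln (real m) powr (- 1 / \<beta>)"
        using ln1 by (simp add: ent_lower_def powr_mult powr_minus field_simps)
      finally have "4 * ent_lower * real m * ln (real m) powr (- 1 / \<beta>) - 2 \<le> real J" using J by linarith
      then have "(4 * ent_lower * real m * ln (real m) powr (- 1 / \<beta>) - 2) * ln (real m) \<le> real J * ln (real m)"
        using ln1 by (intro mult_right_mono) auto
      moreover have "ln (real m) powr (1 - 1 / \<beta>) = ln (real m) powr (- 1 / \<beta>) * ln (real m)"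
        using ln1 by (simp add: powr_diff powr_minus field_simps)
      then have "(4 * ent_lower * real m * ln (real m) powr (- 1 / \<beta>) - 2) * ln (real m) =
          4 * (ent_lower * real m * ln (real m) powr (1 - 1 / \<beta>)) - 2 * ln (real m)" by (simp add: algebra_simps)
      ultimately show ?thesis using elim(2) by linarith
    qed
    ultimately show ?case by linarith
  qed
qed

lemma ent_lower_pos: "0 < ent_lower"
  by (simp add: ent_lower_def)

text \<open>Since \<open>\<beta> < 1\<close>, the bound \<open>m powr \<beta>\<close> for the
  components is negligible against \<open>m\<close> divided by a power of
  \<open>ln m\<close>.\<close>

lemma redundancy_at_top: "filterlim (\<lambda>m. H_mu M m - EH_F M (k 0) m) at_top sequentially"
proof (rule filterlim_at_top_mono)
  show "filterlim (\<lambda>m. ent_lower * real m * ln (real m) powr (1 - 1 / \<beta>) - top_const * real m powr \<beta>) at_top sequentially"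
    using \<beta> ent_lower_pos by real_asymp
  show "\<forall>\<^sub>F m in sequentially. ent_lower * real m * ln (real m) powr (1 - 1 / \<beta>) - top_const * real m powr \<beta>
      \<le> H_mu M m - EH_F M (k 0) m"
    using H_mu_lower_asymp eventually_ge_at_top[of 1]
  proof eventually_elim
    case (elim m)
    then show ?case using EH_F_upper[of m] by linarith
  qed
qed

lemma not_ergodic: "\<not> ergodic M"
proof
  assume "ergodic M"
  then have "H_mu M m - EH_F M (k 0) m = 0" for m by (simp add: EH_F_ergodic)
  then have "filterlim (\<lambda>m :: nat. 0 :: real) at_top sequentially" using redundancy_at_top by simp
  then have "\<forall>\<^sub>F m :: nat in sequentially. (1 :: real) \<le> 0" by (rule filterlim_at_top[THEN iffD1, rule_format])
  then show False by simp
qed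

text \<open>The upper bound is available without the iterated logarithm, which is inserted as a
  factor that is at least 1 eventually.\<close>

lemma entropy_bounds:
  defines "\<alpha> \<equiv> 1 / \<beta> - 1"
  shows "\<forall>\<^sub>F m in sequentially. ent_lower * real m / ln (real m) powr \<alpha> \<le> H_mu M m \<and>
           H_mu M m \<le> ent_upper * real m * (ln (ln (real m)) / ln (real m)) powr \<alpha>"
proof -
  have \<alpha>: "0 < \<alpha>" using \<beta> by (simp add: \<alpha>_def field_simps)
  have "\<forall>\<^sub>F m in sequentially. 1 \<le> ln (ln (real m))" by real_asymp
  then show ?thesis using H_mu_lower_asymp H_mu_upper_asymp eventually_ge_at_top[of 3]
  proof eventually_elim
    case (elim m)
    have ln1: "1 \<le> ln (real m)" by (rule ln_ge_1[OF elim(4)])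
    have e: "ln (real m) powr (1 - 1 / \<beta>) = 1 / ln (real m) powr \<alpha>"
      by (simp add: \<alpha>_def powr_minus_divide[symmetric])
    have "1 / ln (real m) powr \<alpha> \<le> ln (ln (real m)) powr \<alpha> / ln (real m) powr \<alpha>"
      using elim(1) \<alpha> by (intro divide_right_mono ge_one_powr_ge_zero) auto
    also have "\<dots> = (ln (ln (real m)) / ln (real m)) powr \<alpha>" using elim(1) ln1 by (simp add: powr_divide)
    finally have "ent_upper * real m * (1 / ln (real m) powr \<alpha>) \<le> ent_upper * real m * (ln (ln (real m)) / ln (real m)) powr \<alpha>"
      by (intro mult_left_mono) (auto simp: ent_upper_def)
    then show ?case using elim(2,3) e by simp
  qed
qed

lemma entropy_rate_zero: "(\<lambda>m. H_mu M m / real m) \<longlonglongrightarrow> 0"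
proof (rule tendsto_sandwich)
  show "\<forall>\<^sub>F m in sequentially. 0 \<le> H_mu M m / real m" using H_mu_nonneg by simp
  show "\<forall>\<^sub>F m in sequentially. H_mu M m / real m \<le> ent_upper * ln (real m) powr (1 - 1 / \<beta>)"
    using H_mu_upper_asymp eventually_gt_at_top[of 0]
    by eventually_elim (simp add: field_simps)
  have "1 - 1 / \<beta> < 0" using \<beta> by (simp add: field_simps)
  then show "(\<lambda>m. ent_upper * ln (real m) powr (1 - 1 / \<beta>)) \<longlonglongrightarrow> 0" by real_asymp
qed simp

end

theorem theorem5:
  fixes \<beta> :: real and M :: "(nat \<Rightarrow> nat) measure"
    and k :: "nat \<Rightarrow> nat" and \<alpha> :: real
  assumes k_def: "\<And>n. k n = nat \<lfloor>exp (2 powr (\<beta> * real n))\<rfloor>"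
    and \<alpha>_def: "\<alpha> = 1 / \<beta> - 1"
    and "0 < \<beta>" and "\<beta> < 1"
    and perp: "\<forall>n\<ge>1. k (n - 1) \<le> k n \<and> k n \<le> (k (n - 1))\<^sup>2"
    and "prob_space M" and "sets M = sets seq_space"
    and mean: "\<forall>x. (\<lambda>N. (\<Sum>i=1..N. rha_prob k i x) / real N) \<longlonglongrightarrow> measure M (cyl x)"
  shows "((\<lambda>m. H_mu M m / real m) \<longlonglongrightarrow> 0)
    \<and> (\<exists>C1>0. \<exists>C2>0. \<forall>\<^sub>F m in sequentially.
           C1 * real m / ln (real m) powr \<alpha> \<le> H_mu M m \<and>
           H_mu M m \<le> C2 * real m * (ln (ln (real m)) / ln (real m)) powr \<alpha>)
    \<and> regular_hilberg M \<beta>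
    \<and> \<not> ergodic M \<and> filterlim (\<lambda>m. H_mu M m - EH_F M (k 0) m) at_top sequentially"
proof -
  have kn: "k (n - 1) \<le> k n \<and> k n \<le> (k (n - 1))\<^sup>2" if "1 \<le> n" for n using perp that by blast
  \<comment> \<open>At \<open>n = 0\<close> the perplexity is the integer part of
    \<open>exp 1\<close>.\<close>
  have "real 2 \<le> exp 1" using exp_ge_add_one_self[of 1] by simp
  then have k0: "2 \<le> k 0" by (simp add: k_def le_nat_iff le_floor_iff)
  interpret rha k
  proof
    show "k n \<le> k (Suc n)" "k (Suc n) \<le> (k n)\<^sup>2" for n using kn[of "Suc n"] by simp_all
  qed (rule k0)
  interpret prob_space M by fact
  interpret hilberg k M \<beta>
    by standard (use assms in auto)
  have "0 < ent_upper" by (simp add: ent_upper_def add_pos_pos)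
  then have "\<exists>C1>0. \<exists>C2>0. \<forall>\<^sub>F m in sequentially.
      C1 * real m / ln (real m) powr \<alpha> \<le> H_mu M m \<and>
      H_mu M m \<le> C2 * real m * (ln (ln (real m)) / ln (real m)) powr \<alpha>"
    using ent_lower_pos entropy_bounds unfolding \<alpha>_def by blast
  then show ?thesis
    using entropy_rate_zero regular_hilberg_M not_ergodic redundancy_at_top by blast
qed

end
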